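(* Let $(U_n)_{n\ge1}$ be an i.i.d. sequence of centered $\mathbb R^d$-valued random variables with unit covariance matrix satisfying (GC) (see context), and let $f:\mathbb R^d\to\mathbb R$ be a Lipschitz continuous function such that $G(f)=\int_{\mathbb R^d}f(x)G(dx)=0$, where $G(dx)=\exp(-|x|^2/2)\frac{dx}{(2\pi)^{d/2}}$. Set $Z_0=0$, $Z_n:=\frac1{\sqrt n}\sum_{k=1}^nU_k$ for $n\ge1$, and, with $\gamma_k=1/k$ and $\Gamma_n=\sum_{k=1}^n\gamma_k$, $$\nu_n^Z:=\frac1{\Gamma_n}\sum_{k=1}^n\gamma_k\delta_{Z_k}.$$ Then there exist two (explicit) monotonic sequences $c_n\le1\le C_n$, $n\ge1$, with $\lim_nC_n=\lim_nc_n=1$, such that for all $a>0$ and $n\ge1$: $$\mathbb P\Big[\sqrt{\log(n)+1}\;|\nu_n^Z(f)|\ge a\Big]\le2C_n\exp\Big(-c_n\frac{a^2}{2\|\nabla\varphi\|_\infty^2}\Big),$$ where $\varphi$ denotes the solution (centered with respect to $G$ and with linear growth) of the Poisson equation $$\forall x\in\mathbb R^d,\quad\tfrac12\Delta\varphi(x)-\tfrac12x\cdot\nabla\varphi(x)=f(x),$$ which, under the current assumptions, is unique and belongs to $W^2_{p,\mathrm{loc}}(\mathbb R^d,\mathbb R)$ for any $p>1$, with $\|\nabla\varphi\|_\infty\le2[f]_1$.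
   Context: (GC): $\mathbb E[U_1]=0$, $\mathbb E[U_1^iU_1^j]=\delta_{ij}$, $\mathbb E[U_1^iU_1^jU_1^k]=0$ for all $i,j,k\in\{1,\dots,d\}$, and for every $1$-Lipschitz function $g:\mathbb R^d\to\mathbb R$ and every $\lambda>0$, $\mathbb E[\exp(\lambda g(U_1))]\le\exp(\lambda\mathbb E[g(U_1)]+\lambda^2/2)$. $[f]_1$ is the Lipschitz constant of $f$, $\|\nabla\varphi\|_\infty$ the supremum of the Euclidean norm of $\nabla\varphi$, and $W^2_{p,\mathrm{loc}}$ the local Sobolev space of functions with two weak derivatives in $L^p_{\mathrm{loc}}$. *)

theory Defs
  imports "HOL-Probability.Probability"
begin

section \<open>Derivatives of functions on \<open>\<real>\<^sup>d\<close>\<close>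

definition partial :: "'d::finite \<Rightarrow> (real ^ 'd \<Rightarrow> real) \<Rightarrow> real ^ 'd \<Rightarrow> real" where
  "partial i u x = frechet_derivative u (at x) (axis i 1)"

definition grad :: "(real ^ 'd::finite \<Rightarrow> real) \<Rightarrow> real ^ 'd \<Rightarrow> real ^ 'd" where
  "grad u x = (\<chi> i. partial i u x)"

definition laplacian :: "(real ^ 'd::finite \<Rightarrow> real) \<Rightarrow> real ^ 'd \<Rightarrow> real" where
  "laplacian u x = (\<Sum>i\<in>UNIV. partial i (partial i u) x)"

text \<open>\<open>C\<^sup>k\<close> functions: all partial derivatives up to order \<open>k\<close> exist and are continuous.\<close>

primrec Ck :: "nat \<Rightarrow> (real ^ 'd::finite \<Rightarrow> real) \<Rightarrow> bool" where
  "Ck 0 u = continuous_on UNIV u"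
| "Ck (Suc k) u = ((\<forall>x. u differentiable (at x)) \<and> (\<forall>i. Ck k (partial i u)))"

text \<open>As a real-valued supremum this is only meaningful for bounded gradients.\<close>

definition grad_sup :: "(real ^ 'd::finite \<Rightarrow> real) \<Rightarrow> real" where
  "grad_sup u = (SUP x. norm (grad u x))"

text \<open>The Lipschitz constant; as a real-valued supremum it is only meaningful for
  Lipschitz functions.\<close>

definition lip_const :: "(real ^ 'd::finite \<Rightarrow> real) \<Rightarrow> real" where
  "lip_const u = (SUP (x, y)\<in>{(x, y). x \<noteq> y}. \<bar>u x - u y\<bar> / norm (x - y))"


section \<open>Local Sobolev spaces\<close>

definition test_function :: "(real ^ 'd::finite \<Rightarrow> real) \<Rightarrow> bool" where
  "test_function \<eta> \<longleftrightarrow> (\<forall>k. Ck k \<eta>) \<and> compact (closure {x. \<eta> x \<noteq> 0})"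

definition Lp_loc :: "real \<Rightarrow> (real ^ 'd::finite \<Rightarrow> real) \<Rightarrow> bool" where
  "Lp_loc p u \<longleftrightarrow> u \<in> borel_measurable borel \<and>
     (\<forall>K. compact K \<longrightarrow> set_integrable lborel K (\<lambda>x. \<bar>u x\<bar> powr p))"

definition weak_partial ::
  "'d::finite \<Rightarrow> (real ^ 'd \<Rightarrow> real) \<Rightarrow> (real ^ 'd \<Rightarrow> real) \<Rightarrow> bool" where
  "weak_partial i u v \<longleftrightarrow> Lp_loc 1 u \<and> Lp_loc 1 v \<and>
     (\<forall>\<eta>. test_function \<eta> \<longrightarrow>
        (\<integral>x. u x * partial i \<eta> x \<partial>lborel) = - (\<integral>x. v x * \<eta> x \<partial>lborel))"

text \<open>\<open>u\<close> belongs to \<open>W\<^sup>2\<^sub>p\<^sub>,\<^sub>l\<^sub>o\<^sub>c\<close>, with weak derivatives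
  \<open>D i\<close> of first order and \<open>H i j\<close> of second order.\<close>

definition W2_loc_derivs ::
  "real \<Rightarrow> (real ^ 'd::finite \<Rightarrow> real) \<Rightarrow> ('d \<Rightarrow> real ^ 'd \<Rightarrow> real) \<Rightarrow>
   ('d \<Rightarrow> 'd \<Rightarrow> real ^ 'd \<Rightarrow> real) \<Rightarrow> bool" where
  "W2_loc_derivs p u D H \<longleftrightarrow> Lp_loc p u \<and>
     (\<forall>i. Lp_loc p (D i) \<and> weak_partial i u (D i)) \<and>
     (\<forall>i j. Lp_loc p (H i j) \<and> weak_partial j (D i) (H i j))"

definition W2_loc :: "real \<Rightarrow> (real ^ 'd::finite \<Rightarrow> real) \<Rightarrow> bool" where
  "W2_loc p u \<longleftrightarrow> (\<exists>D H. W2_loc_derivs p u D H)"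


section \<open>The Gaussian measure and the Poisson equation\<close>

definition gauss :: "(real ^ 'd::finite) measure" where
  "gauss = density lborel
     (\<lambda>x. ennreal (exp (- (norm x)\<^sup>2 / 2) / (2 * pi) powr (real CARD('d) / 2)))"

definition classical_poisson_solution ::
  "(real ^ 'd::finite \<Rightarrow> real) \<Rightarrow> (real ^ 'd \<Rightarrow> real) \<Rightarrow> bool" where
  "classical_poisson_solution f \<phi> \<longleftrightarrow> Ck 2 \<phi> \<and>
     (\<forall>x. laplacian \<phi> x / 2 - (x \<bullet> grad \<phi> x) / 2 = f x) \<and>
     (\<exists>K. \<forall>x. \<bar>\<phi> x\<bar> \<le> K * (1 + norm x)) \<and>
     (\<integral>x. \<phi> x \<partial>gauss) = 0"

text \<open>Elements of the Sobolev space are determined up to null sets only, so for them the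
  equation and the growth condition are required almost everywhere.\<close>

definition strong_poisson_solution ::
  "real \<Rightarrow> (real ^ 'd::finite \<Rightarrow> real) \<Rightarrow> (real ^ 'd \<Rightarrow> real) \<Rightarrow> bool" where
  "strong_poisson_solution p f \<phi> \<longleftrightarrow>
     (\<exists>D H. W2_loc_derivs p \<phi> D H \<and>
        (AE x in lborel. (\<Sum>i\<in>UNIV. H i i x) / 2 - (\<Sum>i\<in>UNIV. x $ i * D i x) / 2 = f x)) \<and>
     (\<exists>K. AE x in lborel. \<bar>\<phi> x\<bar> \<le> K * (1 + norm x)) \<and>
     (\<integral>x. \<phi> x \<partial>gauss) = 0"


section \<open>Gaussian concentration\<close>

text \<open>Integrability is spelled out because the integral of a non-integrable function is 0.\<close>

definition GC :: "'a measure \<Rightarrow> ('a \<Rightarrow> real ^ 'd::finite) \<Rightarrow> bool" where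
  "GC M X \<longleftrightarrow>
     integrable M X \<and> (\<integral>\<omega>. X \<omega> \<partial>M) = 0 \<and>
     (\<forall>i j. integrable M (\<lambda>\<omega>. X \<omega> $ i * X \<omega> $ j) \<and>
        (\<integral>\<omega>. X \<omega> $ i * X \<omega> $ j \<partial>M) = (if i = j then 1 else 0)) \<and>
     (\<forall>i j k. integrable M (\<lambda>\<omega>. X \<omega> $ i * X \<omega> $ j * X \<omega> $ k) \<and>
        (\<integral>\<omega>. X \<omega> $ i * X \<omega> $ j * X \<omega> $ k \<partial>M) = 0) \<and>
     (\<forall>(g :: real ^ 'd \<Rightarrow> real) l. 1-lipschitz_on UNIV g \<longrightarrow> 0 < l \<longrightarrow>
        integrable M (\<lambda>\<omega>. exp (l * g (X \<omega>))) \<and>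
        (\<integral>\<omega>. exp (l * g (X \<omega>)) \<partial>M) \<le> exp (l * (\<integral>\<omega>. g (X \<omega>) \<partial>M) + l\<^sup>2 / 2))"


section \<open>Normalized sums and their weighted empirical measures\<close>

definition step :: "nat \<Rightarrow> real" where
  "step k = 1 / real k"

definition step_sum :: "nat \<Rightarrow> real" where
  "step_sum n = (\<Sum>k = 1..n. step k)"

definition Zn :: "(nat \<Rightarrow> 'a \<Rightarrow> real ^ 'd::finite) \<Rightarrow> nat \<Rightarrow> 'a \<Rightarrow> real ^ 'd" where
  "Zn U n \<omega> = (if n = 0 then 0 else (1 / sqrt (real n)) *\<^sub>R (\<Sum>k = 1..n. U k \<omega>))"

text \<open>The measure \<open>(1 / \<Gamma>\<^sub>n) * (\<Sum>k = 1..n. \<gamma>\<^sub>k * \<delta>(Z\<^sub>k))\<close> is the image of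
  the weights on \<open>{1..n}\<close> under \<open>k \<mapsto> Z\<^sub>k\<close>.\<close>

definition nuZ :: "(nat \<Rightarrow> 'a \<Rightarrow> real ^ 'd::finite) \<Rightarrow> nat \<Rightarrow> 'a \<Rightarrow> (real ^ 'd) measure" where
  "nuZ U n \<omega> = distr (point_measure {1..n} (\<lambda>k. ennreal (step k / step_sum n)))
                  borel (\<lambda>k. Zn U k \<omega>)"

lemma integral_nuZ:
  assumes "f \<in> borel_measurable borel"
  shows "(\<integral>x. f x \<partial>nuZ U n \<omega>) = (1 / step_sum n) * (\<Sum>k = 1..n. step k * f (Zn U k \<omega>))"
proof -
  have nonneg: "step k / step_sum n \<ge> 0" for k
    by (simp add: step_def step_sum_def sum_nonneg)
  have "(\<integral>x. f x \<partial>nuZ U n \<omega>) =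
      (\<integral>k. f (Zn U k \<omega>) \<partial>point_measure {1..n} (\<lambda>k. ennreal (step k / step_sum n)))"
    unfolding nuZ_def using assms by (intro integral_distr) auto
  also have "\<dots> = (\<Sum>k = 1..n. (step k / step_sum n) * f (Zn U k \<omega>))"
    by (subst lebesgue_integral_point_measure_finite) (auto simp: nonneg)
  finally show ?thesis
    by (simp add: sum_distrib_left)
qed

end

theory Submission
  imports Defs
begin

text \<open>
  The solution of the Poisson equation is \<open>-2 \<integral>\<^sub>0\<^sup>1 (E f(s x + sqrt(1 - s^2) N)) / s ds\<close>, up to a
  constant, with \<open>N\<close> standard Gaussian: this is minus the potential of the Ornstein--Uhlenbeck
  semigroup after the substitution \<open>s = exp(-t/2)\<close>. The inner
  expectation has Lipschitz constant at most \<open>s [f]\<^sub>1\<close> in \<open>x\<close>, hence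
  \<open>\<parallel>\<nabla>\<phi>\<parallel> \<le> 2 [f]\<^sub>1\<close>. Its derivatives can be moved from \<open>f\<close> to the Gaussian density, and this gives a
  Hessian that is Hoelder continuous with exponent 1/2. Uniqueness is by duality: a
  difference of two solutions is tested against smooth solutions of the Poisson equation for
  smooth data, multiplied with the Gaussian density and cut off.

  Since \<open>Z\<^sub>k = sqrt(1 - 1/k) Z\<^sub>k\<^sub>-\<^sub>1 + sqrt(1/k) U\<^sub>k\<close>, a second order Taylor expansion and the moment
  conditions show that \<open>f(Z\<^sub>k\<^sub>-\<^sub>1) / k\<close> is the conditional mean of the increment of \<open>\<phi>(Z)\<close> up to an
  error of order \<open>k powr (-5/4) * (1 + norm Z\<^sub>k\<^sub>-\<^sub>1)\<close>. Hence \<open>\<Sum> f(Z\<^sub>k) / k\<close> is a sum of martingale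
  increments, whose exponential moments are bounded by (GC) with Lipschitz constants
  \<open>\<parallel>\<nabla>\<phi>\<parallel> / sqrt k\<close>, plus a remainder that is sub-Gaussian uniformly in \<open>n\<close>. Hoelder's inequality
  with exponents \<open>p \<rightarrow> 1\<close>, \<open>q \<rightarrow> \<infinity>\<close> and the Chernoff bound give the deviation inequality.
\<close>

text \<open>Since \<open>f\<close> is only Lipschitz, placing two derivatives on the Gaussian kernel
  costs a Lipschitz constant of order 1 / (1 - s) for the Hessian integrand, which is not integrable
  at s = 1. Hoelder exponent 1/2 is a compromise: the geometric mean of a size bound and a Lipschitz
  bound costs only (1 - s) to the power -3/4. With noise of size \<open>sqrt (1 / k)\<close> this
  exponent leaves an error of order k to the power -5/4. Any positive Hoelder exponent would serve;
  what matters is that the errors are summable, so that the remainder does not grow with n.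

  The weak derivatives of a strong solution are known only through integrals, hence the duality
  argument for uniqueness, in which only the solution itself appears.

  All explicit constants are functions of \<open>x = 1 / sqrt (step_sum n)\<close>. The Hoelder
  exponents are \<open>p = 1 + x\<close> and \<open>q = (1 + x) / x\<close>: the first tends to 1,
  and the second is of the order of the square root of \<open>step_sum n\<close>, hence negligible
  against the variance of the martingale, which has the order of \<open>step_sum n\<close>
  itself.\<close>

lemma norm_integral_le:
  fixes f :: "'a \<Rightarrow> 'b::{banach, second_countable_topology}"
  assumes "integrable M g" "\<And>x. x \<in> space M \<Longrightarrow> norm (f x) \<le> g x"
  shows "norm (\<integral>x. f x \<partial>M) \<le> (\<integral>x. g x \<partial>M)"
proof -
  have "norm (\<integral>x. f x \<partial>M) \<le> (\<integral>x. norm (f x) \<partial>M)" by (rule integral_norm_bound)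
  also have "\<dots> \<le> (\<integral>x. g x \<partial>M)"
    by (rule integral_mono') (use assms in \<open>auto intro: order_trans[OF norm_ge_zero]\<close>)
  finally show ?thesis .
qed

section \<open>The standard Gaussian measure\<close>

definition gauss_density :: "real ^ 'd::finite \<Rightarrow> real" where
  "gauss_density z = exp (- (norm z)\<^sup>2 / 2) / (2 * pi) powr (real CARD('d) / 2)"

lemma gauss_density_pos: "0 < gauss_density z"
  by (simp add: gauss_density_def)

lemma gauss_density_measurable [measurable]: "gauss_density \<in> borel_measurable borel"
  unfolding gauss_density_def[abs_def] by measurable

lemma gauss_eq_density: "gauss = density lborel (\<lambda>x. ennreal (gauss_density x))"
  by (simp add: gauss_def gauss_density_def)

lemma sets_gauss [simp, measurable_cong]: "sets gauss = sets borel"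
  by (simp add: gauss_def)

lemma space_gauss [simp]: "space gauss = UNIV"
  by (simp add: gauss_def)

lemma measurable_gauss_iff [simp]: "measurable gauss N = measurable borel N"
  by (rule measurable_cong_sets) simp_all

lemma integral_gauss:
  fixes F :: "real ^ 'd::finite \<Rightarrow> 'b::{banach, second_countable_topology}"
  assumes "F \<in> borel_measurable borel"
  shows "(\<integral>z. F z \<partial>gauss) = (\<integral>z. gauss_density z *\<^sub>R F z \<partial>lborel)"
  unfolding gauss_eq_density using assms
  by (subst integral_density) (auto intro: less_imp_le[OF gauss_density_pos])

lemma integrable_gauss:
  fixes F :: "real ^ 'd::finite \<Rightarrow> 'b::{banach, second_countable_topology}"
  assumes "F \<in> borel_measurable borel"
  shows "integrable gauss F \<longleftrightarrow> integrable lborel (\<lambda>z. gauss_density z *\<^sub>R F z)"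
  unfolding gauss_eq_density using assms
  by (subst integrable_density) (auto intro: less_imp_le[OF gauss_density_pos])

lemma AE_gauss_iff:
  assumes "AE x in lborel. P x" shows "AE x in gauss. P x"
  unfolding gauss_eq_density by (subst AE_density) (use assms in auto)

lemma norm_sq_Basis_sum: "(norm (x :: 'a::euclidean_space))\<^sup>2 = (\<Sum>b\<in>Basis. (x \<bullet> b)\<^sup>2)"
  unfolding power2_norm_eq_inner by (subst euclidean_inner) (simp add: power2_eq_square)

text \<open>Two variances are needed: \<sigma> = 1 normalizes \<open>gauss\<close>, and \<sigma> =
  sqrt 2 is the density behind \<open>integrable_gauss_exp_sq\<close>.\<close>

lemma prod_normal_density:
  fixes x :: "'a::euclidean_space"
  assumes "\<sigma> > 0"
  shows "(\<Prod>b\<in>Basis. normal_density 0 \<sigma> (x \<bullet> b)) =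
    exp (- (norm x)\<^sup>2 / (2 * \<sigma>\<^sup>2)) / (2 * pi * \<sigma>\<^sup>2) powr (real DIM('a) / 2)"
proof -
  have *: "sqrt (2 * pi * \<sigma>\<^sup>2) ^ DIM('a) = (2 * pi * \<sigma>\<^sup>2) powr (real DIM('a) / 2)"
  proof -
    have p: "0 < 2 * pi * \<sigma>\<^sup>2" using assms by simp
    have "sqrt (2 * pi * \<sigma>\<^sup>2) ^ DIM('a) = sqrt (2 * pi * \<sigma>\<^sup>2) powr (real DIM('a))"
      by (rule powr_realpow[symmetric]) (use p in \<open>simp only: real_sqrt_gt_zero\<close>)
    also have "\<dots> = ((2 * pi * \<sigma>\<^sup>2) powr (1 / 2)) powr (real DIM('a))"
      using p by (simp only: powr_half_sqrt)
    also have "\<dots> = (2 * pi * \<sigma>\<^sup>2) powr (1 / 2 * real DIM('a))"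
      by (rule powr_powr)
    also have "1 / 2 * real DIM('a) = real DIM('a) / 2" by simp
    finally show ?thesis .
  qed
  have "(\<Prod>b\<in>Basis. normal_density 0 \<sigma> (x \<bullet> b)) =
     (\<Prod>b\<in>Basis. (1 / sqrt (2 * pi * \<sigma>\<^sup>2)) * exp (- (x \<bullet> b)\<^sup>2 / (2 * \<sigma>\<^sup>2)))"
    by (simp add: normal_density_def)
  also have "\<dots> = (1 / sqrt (2 * pi * \<sigma>\<^sup>2)) ^ DIM('a) * exp (\<Sum>b\<in>Basis. - (x \<bullet> b)\<^sup>2 / (2 * \<sigma>\<^sup>2))"
    by (subst prod.distrib) (simp add: exp_sum)
  also have "(\<Sum>b\<in>Basis. - (x \<bullet> b)\<^sup>2 / (2 * \<sigma>\<^sup>2)) = - (norm x)\<^sup>2 / (2 * \<sigma>\<^sup>2)"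
    by (simp add: norm_sq_Basis_sum sum_negf sum_divide_distrib)
  also have "(1 / sqrt (2 * pi * \<sigma>\<^sup>2)) ^ DIM('a) = 1 / (2 * pi * \<sigma>\<^sup>2) powr (real DIM('a) / 2)"
    by (subst power_one_over) (simp only: *)
  finally show ?thesis by simp
qed

lemma nn_integral_prod_normal_density:
  assumes "\<sigma> > 0"
  shows "(\<integral>\<^sup>+x. ennreal (\<Prod>b\<in>Basis. normal_density 0 \<sigma> (x \<bullet> b)) \<partial>(lborel :: 'a::euclidean_space measure)) = 1"
proof -
  have "(\<integral>\<^sup>+x. ennreal (normal_density 0 \<sigma> x) \<partial>lborel) = 1"
    using prob_space.emeasure_space_1[OF prob_space_normal_density[OF assms, of 0]]
    by (simp add: emeasure_density)
  then show ?thesis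
    using nn_integral_lborel_prod[where f = "\<lambda>b :: 'a. \<lambda>x. ennreal (normal_density 0 \<sigma> x)"]
    by (subst prod_ennreal[symmetric]) auto
qed

lemma gauss_density_eq_prod:
  "gauss_density (x :: real ^ 'd::finite) = (\<Prod>b\<in>Basis. normal_density 0 1 (x \<bullet> b))"
  by (subst prod_normal_density) (simp_all add: gauss_density_def)

lemma prob_space_gauss: "prob_space (gauss :: (real ^ 'd::finite) measure)"
proof
  show "emeasure (gauss :: (real ^ 'd) measure) (space gauss) = 1"
    using nn_integral_prod_normal_density[of 1, where 'a = "real ^ 'd"]
    by (simp add: gauss_eq_density emeasure_density gauss_density_eq_prod)
qed

interpretation gauss: prob_space "gauss :: (real ^ 'd::finite) measure"
  by (rule prob_space_gauss)

text \<open>The standard density times exp (|z|^2 / 4) is a multiple of the normal density with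
  covariance twice the identity. Functions of exponential or polynomial growth are compared with
  this majorant below.\<close>

lemma integrable_gauss_exp_sq: "integrable (gauss :: (real ^ 'd::finite) measure) (\<lambda>z. exp ((norm z)\<^sup>2 / 4))"
proof -
  let ?h = "\<lambda>x :: real ^ 'd. (\<Prod>b\<in>Basis. normal_density 0 (sqrt 2) (x \<bullet> b))"
  have "integrable lborel ?h"
    by (rule integrableI_nonneg)
       (auto intro!: prod_nonneg simp: nn_integral_prod_normal_density)
  moreover have "gauss_density x * exp ((norm x)\<^sup>2 / 4) =
     ((2 * pi * 2) powr (real CARD('d) / 2) / (2 * pi) powr (real CARD('d) / 2)) * ?h x" for x :: "real ^ 'd"
    by (subst prod_normal_density) (simp_all add: gauss_density_def flip: exp_add)
  ultimately show ?thesis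
    by (subst integrable_gauss) auto
qed

lemma exp_linear_le_exp_sq: "exp (c * t) \<le> exp (c\<^sup>2) * exp (t\<^sup>2 / 4)" for c t :: real
proof -
  have "0 \<le> (c - t / 2)\<^sup>2" by simp
  then have "c * t \<le> c\<^sup>2 + t\<^sup>2 / 4" by (simp add: power2_eq_square algebra_simps)
  then show ?thesis by (simp flip: exp_add)
qed

lemma integrable_gauss_bound_sq:
  fixes F :: "real ^ 'd::finite \<Rightarrow> 'b::{banach, second_countable_topology}"
  assumes "F \<in> borel_measurable borel" "\<And>z. norm (F z) \<le> C * exp ((norm z)\<^sup>2 / 4)"
  shows "integrable gauss F"
proof (rule Bochner_Integration.integrable_bound)
  show "integrable (gauss :: (real ^ 'd) measure) (\<lambda>z. C * exp ((norm z)\<^sup>2 / 4))"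
    by (rule integrable_mult_right) (rule integrable_gauss_exp_sq)
  show "AE x in gauss. norm (F x) \<le> norm (C * exp ((norm x)\<^sup>2 / 4))"
    using assms(2) by (auto intro!: order_trans[OF assms(2)])
qed (use assms in simp)

lemma integrable_gauss_bound_exp:
  fixes F :: "real ^ 'd::finite \<Rightarrow> 'b::{banach, second_countable_topology}"
  assumes "F \<in> borel_measurable borel" "\<And>z. norm (F z) \<le> C * exp (c * norm z)"
  shows "integrable gauss F"
proof (rule integrable_gauss_bound_sq[where C = "\<bar>C\<bar> * exp (c\<^sup>2)"])
  fix z :: "real ^ 'd"
  have "norm (F z) \<le> \<bar>C\<bar> * exp (c * norm z)"
    by (rule order_trans[OF assms(2)]) (simp add: mult_right_mono)
  also have "\<dots> \<le> \<bar>C\<bar> * (exp (c\<^sup>2) * exp ((norm z)\<^sup>2 / 4))"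
    by (intro mult_left_mono exp_linear_le_exp_sq) simp
  finally show "norm (F z) \<le> \<bar>C\<bar> * exp (c\<^sup>2) * exp ((norm z)\<^sup>2 / 4)" by simp
qed (use assms in auto)

lemma one_plus_power_le_exp: "(1 + t) ^ k \<le> exp (real k * t)" if "t \<ge> 0" for t :: real
proof -
  have "(1 + t) ^ k \<le> (exp t) ^ k" using that by (intro power_mono exp_ge_add_one_self) auto
  then show ?thesis by (simp add: exp_of_nat_mult)
qed

lemma integrable_gauss_bound_poly:
  fixes F :: "real ^ 'd::finite \<Rightarrow> 'b::{banach, second_countable_topology}"
  assumes "F \<in> borel_measurable borel" "\<And>z. norm (F z) \<le> C * (1 + norm z) ^ k"
  shows "integrable gauss F"
proof (rule integrable_gauss_bound_exp[where C = "\<bar>C\<bar>" and c = "real k"])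
  fix z :: "real ^ 'd"
  have "norm (F z) \<le> \<bar>C\<bar> * (1 + norm z) ^ k"
    by (rule order_trans[OF assms(2)]) (simp add: mult_right_mono)
  also have "\<dots> \<le> \<bar>C\<bar> * exp (real k * norm z)"
    by (intro mult_left_mono one_plus_power_le_exp) auto
  finally show "norm (F z) \<le> \<bar>C\<bar> * exp (real k * norm z)" .
qed (use assms in auto)

text \<open>The density of the law of \<open>v + r *\<^sub>R N\<close> with respect to the law of
  \<open>N\<close>, for \<open>N\<close> standard Gaussian.\<close>

definition gauss_weight :: "real ^ 'd::finite \<Rightarrow> real \<Rightarrow> real ^ 'd \<Rightarrow> real" where
  "gauss_weight v r z = exp ((norm z)\<^sup>2 / 2 - (norm (z - v))\<^sup>2 / (2 * r\<^sup>2)) / r ^ CARD('d)"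

lemma gauss_weight_measurable [measurable]: "gauss_weight v r \<in> borel_measurable borel"
  unfolding gauss_weight_def[abs_def] by measurable

lemma gauss_weight_affine:
  fixes v :: "real ^ 'd::finite"
  assumes "r > 0"
  shows "r ^ CARD('d) * (gauss_density (v + r *\<^sub>R z) * gauss_weight v r (v + r *\<^sub>R z)) = gauss_density z"
  using assms
  by (simp add: gauss_density_def gauss_weight_def power_mult_distrib flip: exp_add)

text \<open>The affine map leaves \<open>F\<close> and enters a weight that is smooth in
  \<open>v\<close> and \<open>r\<close>; this is what makes averages of a non-differentiable
  \<open>F\<close> differentiable.\<close>

lemma
  fixes F :: "real ^ 'd::finite \<Rightarrow> 'b::{banach, second_countable_topology}"
  assumes [measurable]: "F \<in> borel_measurable borel" and r: "r > 0"
  shows gauss_affine: "(\<integral>z. F (v + r *\<^sub>R z) \<partial>gauss) = (\<integral>z. gauss_weight v r z *\<^sub>R F z \<partial>gauss)"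
    and integrable_gauss_affine:
      "integrable gauss (\<lambda>z. F (v + r *\<^sub>R z)) \<longleftrightarrow> integrable gauss (\<lambda>z. gauss_weight v r z *\<^sub>R F z)"
proof -
  let ?G = "\<lambda>z. gauss_density z *\<^sub>R gauss_weight v r z *\<^sub>R F z"
  have lb: "lborel = density (distr lborel borel (\<lambda>x. v + r *\<^sub>R x)) (\<lambda>_. ennreal (r ^ CARD('d)))"
    using lborel_affine[of r v] r by simp
  have G: "?G \<in> borel_measurable borel" by measurable
  have eq: "r ^ CARD('d) *\<^sub>R ?G (v + r *\<^sub>R z) = gauss_density z *\<^sub>R F (v + r *\<^sub>R z)" for z
    using gauss_weight_affine[OF r, of v z] by (simp add: mult.assoc)
  have "(\<integral>z. gauss_weight v r z *\<^sub>R F z \<partial>gauss) = (\<integral>z. ?G z \<partial>lborel)"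
    by (subst integral_gauss) auto
  also have "\<dots> = (\<integral>z. ?G z \<partial>density (distr lborel borel (\<lambda>x. v + r *\<^sub>R x)) (\<lambda>_. ennreal (r ^ CARD('d))))"
    by (simp add: lb[symmetric])
  also have "\<dots> = (\<integral>z. r ^ CARD('d) *\<^sub>R ?G (v + r *\<^sub>R z) \<partial>lborel)"
    using G r by (subst integral_density) (auto simp: integral_distr)
  also have "\<dots> = (\<integral>z. F (v + r *\<^sub>R z) \<partial>gauss)"
    by (simp only: eq) (subst integral_gauss, auto)
  finally show "(\<integral>z. F (v + r *\<^sub>R z) \<partial>gauss) = (\<integral>z. gauss_weight v r z *\<^sub>R F z \<partial>gauss)" ..
  have "integrable gauss (\<lambda>z. gauss_weight v r z *\<^sub>R F z) \<longleftrightarrow> integrable lborel ?G"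
    by (subst integrable_gauss) auto
  also have "\<dots> \<longleftrightarrow> integrable (density (distr lborel borel (\<lambda>x. v + r *\<^sub>R x)) (\<lambda>_. ennreal (r ^ CARD('d)))) ?G"
    by (simp add: lb[symmetric])
  also have "\<dots> \<longleftrightarrow> integrable lborel (\<lambda>z. r ^ CARD('d) *\<^sub>R ?G (v + r *\<^sub>R z))"
    using G r by (subst integrable_density) (auto simp: integrable_distr_eq)
  also have "\<dots> \<longleftrightarrow> integrable gauss (\<lambda>z. F (v + r *\<^sub>R z))"
    by (simp only: eq) (subst integrable_gauss, auto)
  finally show "integrable gauss (\<lambda>z. F (v + r *\<^sub>R z)) \<longleftrightarrow> integrable gauss (\<lambda>z. gauss_weight v r z *\<^sub>R F z)" ..
qed

text \<open>For \<open>r = 1\<close> the quadratic terms in \<open>z\<close> cancel and the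
  Cameron-Martin exponential is left.\<close>

lemma gauss_weight_shift: "gauss_weight v 1 z = exp (v \<bullet> z - (norm v)\<^sup>2 / 2)"
  by (simp add: gauss_weight_def power2_norm_eq_inner inner_diff_left inner_diff_right
      inner_commute diff_divide_distrib add_divide_distrib)

section \<open>Derivatives\<close>

lemma partial_eq:
  assumes "(u has_derivative (\<lambda>h. D \<bullet> h)) (at x)"
  shows "partial i u x = D $ i"
  by (simp add: partial_def frechet_derivative_at[OF assms, symmetric] inner_axis)

lemma grad_eq:
  assumes "(u has_derivative (\<lambda>h. D \<bullet> h)) (at x)"
  shows "grad u x = D"
  using partial_eq[OF assms] by (simp add: grad_def vec_eq_iff)

lemma has_derivative_grad:
  assumes "u differentiable (at x)"
  shows "(u has_derivative (\<lambda>h. grad u x \<bullet> h)) (at x)"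
proof -
  let ?D = "frechet_derivative u (at x)"
  have d: "(u has_derivative ?D) (at x)"
    using assms by (simp add: frechet_derivative_works)
  then interpret D: bounded_linear ?D by (rule has_derivative_bounded_linear)
  have "?D h = grad u x \<bullet> h" for h
  proof -
    have h: "h = (\<Sum>i\<in>UNIV. h $ i *\<^sub>R axis i 1)"
      using basis_expansion[of h] by (simp add: scalar_mult_eq_scaleR)
    have "?D h = ?D (\<Sum>i\<in>UNIV. h $ i *\<^sub>R axis i 1)" using h by simp
    also have "\<dots> = (\<Sum>i\<in>UNIV. h $ i * partial i u x)"
      by (simp add: D.sum D.scaleR partial_def)
    finally show ?thesis by (simp add: inner_vec_def grad_def mult.commute)
  qed
  then have "?D = (\<lambda>h. grad u x \<bullet> h)" by auto
  with d show ?thesis by simp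
qed

lemma gradient_mean_value:
  fixes u :: "'v::real_inner \<Rightarrow> real"
  assumes "\<And>x. (u has_derivative (\<lambda>h. D x \<bullet> h)) (at x)"
  shows "\<exists>t. 0 < t \<and> t < 1 \<and> u (x + h) - u x = D (x + t *\<^sub>R h) \<bullet> h"
proof -
  have "\<exists>t>0. t < 1 \<and> u (x + 1 *\<^sub>R h) - u (x + 0 *\<^sub>R h) = (1 - 0) * (D (x + t *\<^sub>R h) \<bullet> h)"
  proof (rule MVT2)
    fix t :: real
    have "((\<lambda>t. u (x + t *\<^sub>R h)) has_derivative (\<lambda>k. D (x + t *\<^sub>R h) \<bullet> (k *\<^sub>R h))) (at t)"
      by (rule has_derivative_compose[OF _ assms]) (auto intro!: derivative_eq_intros)
    then show "((\<lambda>t. u (x + t *\<^sub>R h)) has_real_derivative D (x + t *\<^sub>R h) \<bullet> h) (at t)"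
      by (simp add: has_field_derivative_def mult_commute_abs)
  qed simp
  then show ?thesis by auto
qed

lemma gradient_Hoelder_remainder:
  fixes u :: "'v::real_inner \<Rightarrow> real"
  assumes "\<And>x. (u has_derivative (\<lambda>h. D x \<bullet> h)) (at x)"
    and "\<And>x y. norm (D x - D y) \<le> \<kappa> * sqrt (norm (x - y))" and "\<kappa> \<ge> 0"
  shows "\<bar>u (x + h) - u x - D x \<bullet> h\<bar> \<le> \<kappa> * sqrt (norm h) * norm h"
proof -
  obtain t where t: "0 < t" "t < 1" "u (x + h) - u x = D (x + t *\<^sub>R h) \<bullet> h"
    using gradient_mean_value[OF assms(1)] by blast
  have "\<bar>u (x + h) - u x - D x \<bullet> h\<bar> = \<bar>(D (x + t *\<^sub>R h) - D x) \<bullet> h\<bar>"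
    by (simp add: t(3) inner_diff_left)
  also have "\<dots> \<le> norm (D (x + t *\<^sub>R h) - D x) * norm h" by (rule Cauchy_Schwarz_ineq2)
  also have "\<dots> \<le> (\<kappa> * sqrt (norm (t *\<^sub>R h))) * norm h"
    using assms(2)[of "x + t *\<^sub>R h" x] by (intro mult_right_mono) auto
  also have "\<dots> \<le> (\<kappa> * sqrt (norm h)) * norm h"
    using t assms(3) by (intro mult_right_mono mult_left_mono real_sqrt_le_mono) (auto intro: mult_left_le_one_le)
  finally show ?thesis .
qed

text \<open>A remainder bound with an explicit constant survives integration over a parameter, which
  mere differentiability does not; the next lemma returns from such a bound to a derivative in this
  way.\<close>

lemma has_derivative_Hoelder_remainderI:
  fixes u :: "'v::real_inner \<Rightarrow> real"
  assumes "\<And>h. \<bar>u (x + h) - u x - D \<bullet> h\<bar> \<le> \<kappa> * sqrt (norm h) * norm h"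
  shows "(u has_derivative (\<lambda>h. D \<bullet> h)) (at x)"
  unfolding has_derivative_at
proof
  show "bounded_linear (\<lambda>h. D \<bullet> h)" by (rule bounded_linear_inner_right)
  have lim: "((\<lambda>h::'v. \<kappa> * sqrt (norm h)) \<longlongrightarrow> 0) (at 0)"
    by (auto intro!: tendsto_eq_intros)
  show "(\<lambda>h. norm (u (x + h) - u x - D \<bullet> h) / norm h) \<midarrow>0\<rightarrow> 0"
  proof (rule Lim_null_comparison[OF _ lim])
    show "\<forall>\<^sub>F h in at 0. norm (norm (u (x + h) - u x - D \<bullet> h) / norm h) \<le> \<kappa> * sqrt (norm h)"
      using assms by (auto simp: eventually_at_filter divide_simps)
  qed
qed

text \<open>Hoelder continuity of the gradient with an integrable constant replaces dominated
  convergence here, and the integral inherits it.\<close>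

lemma
  fixes F :: "'s \<Rightarrow> 'v::euclidean_space \<Rightarrow> real"
  assumes der: "\<And>s x. s \<in> space N \<Longrightarrow> (F s has_derivative (\<lambda>h. D s x \<bullet> h)) (at x)"
    and Ho: "\<And>s x y. s \<in> space N \<Longrightarrow> norm (D s x - D s y) \<le> \<kappa> s * sqrt (norm (x - y))"
    and nn: "\<And>s. s \<in> space N \<Longrightarrow> 0 \<le> \<kappa> s"
    and int: "integrable N \<kappa>" "\<And>x. integrable N (\<lambda>s. F s x)" "\<And>x. integrable N (\<lambda>s. D s x)"
  shows has_derivative_param_integral:
      "((\<lambda>x. \<integral>s. F s x \<partial>N) has_derivative (\<lambda>h. (\<integral>s. D s x \<partial>N) \<bullet> h)) (at x)"
    and param_integral_Hoelder:
      "norm ((\<integral>s. D s x \<partial>N) - (\<integral>s. D s y \<partial>N)) \<le> (\<integral>s. \<kappa> s \<partial>N) * sqrt (norm (x - y))"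
proof -
  show "((\<lambda>x. \<integral>s. F s x \<partial>N) has_derivative (\<lambda>h. (\<integral>s. D s x \<partial>N) \<bullet> h)) (at x)"
  proof (rule has_derivative_Hoelder_remainderI)
    fix h
    have i: "integrable N (\<lambda>s. D s x \<bullet> h)" using int by auto
    have "(\<integral>s. F s (x + h) \<partial>N) - (\<integral>s. F s x \<partial>N) - (\<integral>s. D s x \<partial>N) \<bullet> h =
        (\<integral>s. (F s (x + h) - F s x - D s x \<bullet> h) \<partial>N)"
      using int i by simp
    also have "\<bar>\<dots>\<bar> \<le> (\<integral>s. \<kappa> s * (sqrt (norm h) * norm h) \<partial>N)"
      unfolding real_norm_def[symmetric]
    proof (rule norm_integral_le)
      fix s assume s: "s \<in> space N"
      show "norm (F s (x + h) - F s x - D s x \<bullet> h) \<le> \<kappa> s * (sqrt (norm h) * norm h)"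
        using gradient_Hoelder_remainder[OF der[OF s] Ho[OF s] nn[OF s]] by (simp add: mult.assoc)
    qed (use int i in auto)
    finally show "\<bar>(\<integral>s. F s (x + h) \<partial>N) - (\<integral>s. F s x \<partial>N) - (\<integral>s. D s x \<partial>N) \<bullet> h\<bar>
       \<le> (\<integral>s. \<kappa> s \<partial>N) * sqrt (norm h) * norm h" by (simp add: mult.assoc)
  qed
  have "(\<integral>s. D s x \<partial>N) - (\<integral>s. D s y \<partial>N) = (\<integral>s. D s x - D s y \<partial>N)" using int by simp
  also have "norm \<dots> \<le> (\<integral>s. \<kappa> s * sqrt (norm (x - y)) \<partial>N)"
    by (rule norm_integral_le) (use int Ho in auto)
  finally show "norm ((\<integral>s. D s x \<partial>N) - (\<integral>s. D s y \<partial>N)) \<le> (\<integral>s. \<kappa> s \<partial>N) * sqrt (norm (x - y))"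
    by simp
qed

section \<open>Gaussian averages of Lipschitz functions\<close>

text \<open>A local variant with a general modulus: the Gaussian tilt below is controlled only for
  shifts of norm at most 1, and there with a quadratic remainder.\<close>

lemma has_derivative_remainderI:
  fixes u :: "'v::real_inner \<Rightarrow> real"
  assumes "\<delta> > 0" "((\<lambda>h::'v. \<omega> (norm h)) \<longlongrightarrow> 0) (at 0)"
    and "\<And>h. norm h \<le> \<delta> \<Longrightarrow> \<bar>u (x + h) - u x - D \<bullet> h\<bar> \<le> \<omega> (norm h) * norm h"
  shows "(u has_derivative (\<lambda>h. D \<bullet> h)) (at x)"
  unfolding has_derivative_at
proof
  show "bounded_linear (\<lambda>h. D \<bullet> h)" by (rule bounded_linear_inner_right)
  show "(\<lambda>h. norm (u (x + h) - u x - D \<bullet> h) / norm h) \<midarrow>0\<rightarrow> 0"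
  proof (rule Lim_null_comparison[OF _ assms(2)])
    show "\<forall>\<^sub>F h in at 0. norm (norm (u (x + h) - u x - D \<bullet> h) / norm h) \<le> \<omega> (norm h)"
      unfolding eventually_at using assms(1,3)
      by (intro exI[of _ \<delta>]) (auto simp: divide_simps)
  qed
qed

lemma exp_remainder_bounds:
  fixes t :: real
  shows "\<bar>exp t - 1\<bar> \<le> \<bar>t\<bar> * exp \<bar>t\<bar>" "\<bar>exp t - 1 - t\<bar> \<le> t\<^sup>2 * exp \<bar>t\<bar>"
  using Taylor_exp_field[of t 0] Taylor_exp_field[of t 1]
  by (simp_all add: power2_eq_square mult.commute diff_diff_eq)

text \<open>The expansion to first order in \<open>v\<close> of an affine weight under the
  Cameron-Martin shift. Its linear coefficient
  \<open>(\<alpha> + \<beta> \<bullet> z) *\<^sub>R z - \<beta>\<close> is \<open>z\<close> for the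
  weight 1 and \<open>z $ i *\<^sub>R z - axis i 1\<close> for the weight \<open>z $ i\<close>, so
  that one statement serves for first and second derivatives.\<close>

lemma exp_tilt_remainder:
  fixes v z \<beta> :: "'v::real_inner"
  assumes v: "norm v \<le> 1"
  shows "\<bar>(\<alpha> + \<beta> \<bullet> (z - v)) * exp (v \<bullet> z - (norm v)\<^sup>2 / 2) - (\<alpha> + \<beta> \<bullet> z)
      - ((\<alpha> + \<beta> \<bullet> z) *\<^sub>R z - \<beta>) \<bullet> v\<bar>
    \<le> (norm v)\<^sup>2 * (3 * (\<bar>\<alpha>\<bar> + norm \<beta>) * exp (1 + norm z) * (1 + norm z) ^ 3)"
proof -
  define t where "t = v \<bullet> z - (norm v)\<^sup>2 / 2"
  define m where "m = \<bar>\<alpha>\<bar> + norm \<beta>"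
  define p where "p = \<alpha> + \<beta> \<bullet> z"
  define w where "w = 1 + norm z"
  define e where "e = exp w"
  have w: "w \<ge> 1" and e: "e \<ge> 1" by (auto simp: w_def e_def)
  have vz: "\<bar>v \<bullet> z\<bar> \<le> norm v * norm z" by (rule Cauchy_Schwarz_ineq2)
  have bv: "\<bar>\<beta> \<bullet> v\<bar> \<le> norm \<beta> * norm v" by (rule Cauchy_Schwarz_ineq2)
  have v2: "(norm v)\<^sup>2 \<le> norm v" using v by (simp add: power2_eq_square mult_left_le)
  have t: "\<bar>t\<bar> \<le> norm v * w"
  proof -
    have "\<bar>t\<bar> \<le> \<bar>v \<bullet> z\<bar> + (norm v)\<^sup>2 / 2"
      unfolding t_def by (rule order_trans[OF abs_triangle_ineq4]) simp
    also have "\<dots> \<le> norm v * norm z + norm v" using vz v2 norm_ge_zero[of v] by linarith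
    finally show ?thesis by (simp add: w_def algebra_simps)
  qed
  have t': "\<bar>t\<bar> \<le> w" using t v w by (smt (verit) mult_left_le_one_le norm_ge_zero)
  have et: "exp \<bar>t\<bar> \<le> e" using t' by (simp add: e_def)
  have t2: "t\<^sup>2 \<le> (norm v)\<^sup>2 * w\<^sup>2"
    using t w by (metis abs_le_square_iff abs_mult abs_norm_cancel abs_of_nonneg order_trans power_mult_distrib zero_le_one)
  have E1: "\<bar>exp t - 1\<bar> \<le> norm v * w * e"
    using exp_remainder_bounds(1)[of t] mult_mono[OF t et] w by auto
  have E2: "\<bar>exp t - 1 - t\<bar> \<le> (norm v)\<^sup>2 * w\<^sup>2 * e"
    using exp_remainder_bounds(2)[of t] mult_mono[OF t2 et] w by auto
  \<comment> \<open>Here \<open>t\<close> and \<open>v \<bullet> z\<close> differ by half the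
    squared norm of \<open>v\<close>; as \<open>w\<^sup>2 * e\<close> is at least 1, this fits into
    the bound \<open>E2\<close> at the price of a factor 2.\<close>
  have "1 \<le> w\<^sup>2 * e" using w e by (simp add: mult_ge1_I)
  then have "(norm v)\<^sup>2 * 1 \<le> (norm v)\<^sup>2 * (w\<^sup>2 * e)" by (intro mult_left_mono) auto
  then have E3: "\<bar>exp t - 1 - v \<bullet> z\<bar> \<le> 2 * ((norm v)\<^sup>2 * w\<^sup>2 * e)"
  proof -
    have tr: "\<bar>X - 1 - V\<bar> \<le> 2 * Y" if "N \<le> Y" "\<bar>X - 1 - (V - N / 2)\<bar> \<le> Y" "0 \<le> N" for X V N Y :: real
      using that by linarith
    show ?thesis
      by (rule tr[of "(norm v)\<^sup>2"]) (use E2 \<open>(norm v)\<^sup>2 * 1 \<le> _\<close> in \<open>simp_all add: t_def mult.assoc\<close>)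
  qed
  have bz: "\<bar>\<beta> \<bullet> z\<bar> \<le> norm \<beta> * norm z" by (rule Cauchy_Schwarz_ineq2)
  have p: "\<bar>p\<bar> \<le> m * w"
    using bz by (simp add: p_def m_def w_def algebra_simps)
       (smt (verit, best) abs_ge_zero mult_nonneg_nonneg norm_ge_zero)
  have m: "m \<ge> 0" "norm \<beta> \<le> m" by (auto simp: m_def)
  have A: "\<bar>p * (exp t - 1 - v \<bullet> z)\<bar> \<le> (m * w) * (2 * ((norm v)\<^sup>2 * w\<^sup>2 * e))"
    unfolding abs_mult using p E3 m w by (intro mult_mono) auto
  have "\<bar>(\<beta> \<bullet> v) * (exp t - 1)\<bar> \<le> (m * norm v) * (norm v * w * e)"
    unfolding abs_mult using E1 m w order_trans[OF bv mult_right_mono[OF m(2) norm_ge_zero]] by (intro mult_mono) auto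
  also have "\<dots> = (m * (norm v)\<^sup>2 * e) * w" by (simp add: power2_eq_square)
  also have "\<dots> \<le> (m * (norm v)\<^sup>2 * e) * w ^ 3"
    using m e w power_increasing[of 1 3 w] by (intro mult_left_mono) auto
  finally have B: "\<bar>(\<beta> \<bullet> v) * (exp t - 1)\<bar> \<le> (m * (norm v)\<^sup>2 * e) * w ^ 3" .
  \<comment> \<open>After subtraction of the constant and linear terms there remain \<open>p\<close>
    times a second-order remainder of the exponential, and \<open>\<beta> \<bullet> v\<close>,
    already of first order, times a first-order one.\<close>
  have "(\<alpha> + \<beta> \<bullet> (z - v)) * exp t - p - (p *\<^sub>R z - \<beta>) \<bullet> v =
      p * (exp t - 1 - v \<bullet> z) - (\<beta> \<bullet> v) * (exp t - 1)"
    by (simp add: p_def algebra_simps inner_commute)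
  also have "\<bar>\<dots>\<bar> \<le> (m * w) * (2 * ((norm v)\<^sup>2 * w\<^sup>2 * e)) + (m * (norm v)\<^sup>2 * e) * w ^ 3"
    using A B by linarith
  also have "\<dots> = (norm v)\<^sup>2 * (3 * m * e * w ^ 3)"
    by (simp add: power2_eq_square power3_eq_cube algebra_simps)
  finally show ?thesis unfolding t_def p_def m_def e_def w_def .
qed

text \<open>The cube stems from one power for a Lipschitz increment of \<open>f\<close> and two for
  the weight \<open>(\<alpha> + \<beta> \<bullet> z) *\<^sub>R z - \<beta>\<close>. The type token
  carries the dimension, the only datum on which the value depends.\<close>

definition cubic_moment :: "'d::finite itself \<Rightarrow> real" where
  "cubic_moment _ = (\<integral>z. (1 + norm z) ^ 3 \<partial>(gauss :: (real ^ 'd) measure))"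

lemma integrable_cubic: "integrable (gauss :: (real ^ 'd::finite) measure) (\<lambda>z. (1 + norm z) ^ 3)"
  by (rule integrable_gauss_bound_poly[where C = 1 and k = 3]) auto

lemma cubic_moment_nonneg: "0 \<le> cubic_moment TYPE('d::finite)"
  unfolding cubic_moment_def by (rule Bochner_Integration.integral_nonneg) simp

lemma norm_gauss_integral_cubic:
  fixes F :: "real ^ 'd::finite \<Rightarrow> 'b::{banach, second_countable_topology}"
  assumes "\<And>z. norm (F z) \<le> C * (1 + norm z) ^ 3"
  shows "norm (\<integral>z. F z \<partial>gauss) \<le> C * cubic_moment TYPE('d)"
proof -
  have "norm (\<integral>z. F z \<partial>gauss) \<le> (\<integral>z. C * (1 + norm z) ^ 3 \<partial>(gauss :: (real ^ 'd) measure))"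
    by (rule norm_integral_le) (use integrable_cubic assms in auto)
  then show ?thesis by (simp add: cubic_moment_def)
qed

lemma norm_affine_weight:
  fixes z \<beta> :: "'v::real_inner"
  shows "norm ((\<alpha> + \<beta> \<bullet> z) *\<^sub>R z - \<beta>) \<le> (\<bar>\<alpha>\<bar> + norm \<beta>) * (1 + norm z)\<^sup>2"
    and "\<bar>\<alpha> + \<beta> \<bullet> z\<bar> \<le> (\<bar>\<alpha>\<bar> + norm \<beta>) * (1 + norm z)"
proof -
  have "\<bar>\<beta> \<bullet> z\<bar> \<le> norm \<beta> * norm z" by (rule Cauchy_Schwarz_ineq2)
  then show p: "\<bar>\<alpha> + \<beta> \<bullet> z\<bar> \<le> (\<bar>\<alpha>\<bar> + norm \<beta>) * (1 + norm z)"
    by (simp add: algebra_simps) (smt (verit, best) abs_ge_zero mult_nonneg_nonneg norm_ge_zero)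
  have "norm ((\<alpha> + \<beta> \<bullet> z) *\<^sub>R z - \<beta>) \<le> \<bar>\<alpha> + \<beta> \<bullet> z\<bar> * norm z + norm \<beta>"
    by (rule order_trans[OF norm_triangle_ineq4]) simp
  also have "\<dots> \<le> ((\<bar>\<alpha>\<bar> + norm \<beta>) * (1 + norm z)) * norm z + (\<bar>\<alpha>\<bar> + norm \<beta>) * (1 + norm z)"
    using p by (intro add_mono mult_right_mono) (auto simp: algebra_simps)
  also have "\<dots> = (\<bar>\<alpha>\<bar> + norm \<beta>) * (1 + norm z)\<^sup>2"
    by (simp add: power2_eq_square algebra_simps)
  finally show "norm ((\<alpha> + \<beta> \<bullet> z) *\<^sub>R z - \<beta>) \<le> (\<bar>\<alpha>\<bar> + norm \<beta>) * (1 + norm z)\<^sup>2" .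
qed

text \<open>\<open>L\<close> is an arbitrary Lipschitz bound, not the optimal one: the locale is
  used for the given \<open>f\<close> with \<open>lip_const f\<close>, for the constant 1 with bound
  0, and for test functions minus their Gaussian mean.\<close>

locale lipschitz_fun =
  fixes f :: "real ^ 'd::finite \<Rightarrow> real" and L :: real
  assumes lip: "L-lipschitz_on UNIV f"
begin

lemma L_nonneg: "0 \<le> L" using lip by (rule lipschitz_on_nonneg)

lemma lip_abs: "\<bar>f x - f y\<bar> \<le> L * norm (x - y)"
  using lipschitz_onD[OF lip, of x y] by (simp add: dist_norm)

lemma f_continuous: "continuous_on UNIV f"
  using lip by (rule lipschitz_on_continuous_on)

lemma f_measurable [measurable]: "f \<in> borel_measurable borel"
  using f_continuous by (rule borel_measurable_continuous_onI)

lemma growth: "\<bar>f (y + \<sigma> *\<^sub>R z)\<bar> \<le> (\<bar>f 0\<bar> + L) * (1 + norm y + \<bar>\<sigma>\<bar>) * (1 + norm z)"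
proof -
  have "\<bar>f (y + \<sigma> *\<^sub>R z)\<bar> \<le> \<bar>f 0\<bar> + L * norm (y + \<sigma> *\<^sub>R z)"
    using lip_abs[of "y + \<sigma> *\<^sub>R z" 0] by simp
  also have "\<dots> \<le> \<bar>f 0\<bar> + L * (norm y + \<bar>\<sigma>\<bar> * norm z)"
    using norm_triangle_ineq[of y "\<sigma> *\<^sub>R z"] L_nonneg by (intro add_left_mono mult_left_mono) auto
  also have "\<dots> \<le> (\<bar>f 0\<bar> + L) * ((1 + norm y + \<bar>\<sigma>\<bar>) * (1 + norm z))"
    unfolding distrib_right
  proof (rule add_mono)
    have "1 * 1 \<le> (1 + norm y + \<bar>\<sigma>\<bar>) * (1 + norm z)" by (intro mult_mono) auto
    then show "\<bar>f 0\<bar> \<le> \<bar>f 0\<bar> * (1 * (1 + norm z) + norm y * (1 + norm z) + \<bar>\<sigma>\<bar> * (1 + norm z))"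
      by (intro mult_le_cancel_left1[THEN iffD2]) (auto simp: distrib_right)
    show "L * (norm y + \<bar>\<sigma>\<bar> * norm z) \<le> L * (1 * (1 + norm z) + norm y * (1 + norm z) + \<bar>\<sigma>\<bar> * (1 + norm z))"
      by (rule mult_left_mono[OF _ L_nonneg]) (simp add: distrib_left add_nonneg_nonneg)
  qed
  finally show ?thesis by (simp add: mult.assoc)
qed

lemma integrable_weighted:
  fixes q :: "real ^ 'd \<Rightarrow> 'b::{banach, second_countable_topology}"
  assumes [measurable]: "q \<in> borel_measurable borel" and q: "\<And>z. norm (q z) \<le> C * (1 + norm z) ^ k"
  shows "integrable gauss (\<lambda>z. f (y + \<sigma> *\<^sub>R z) *\<^sub>R q z)"
proof (rule integrable_gauss_bound_poly[where k = "Suc k"])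
  fix z :: "real ^ 'd"
  have "norm (f (y + \<sigma> *\<^sub>R z) *\<^sub>R q z) \<le>
      ((\<bar>f 0\<bar> + L) * (1 + norm y + \<bar>\<sigma>\<bar>) * (1 + norm z)) * (C * (1 + norm z) ^ k)"
    unfolding norm_scaleR using growth[of y \<sigma> z] q L_nonneg by (intro mult_mono) auto
  then show "norm (f (y + \<sigma> *\<^sub>R z) *\<^sub>R q z) \<le> ((\<bar>f 0\<bar> + L) * (1 + norm y + \<bar>\<sigma>\<bar>) * C) * (1 + norm z) ^ Suc k"
    by (simp add: mult_ac)
qed measurable

lemma integrable_plain: "integrable gauss (\<lambda>z. f (y + \<sigma> *\<^sub>R z))"
  using integrable_weighted[of "\<lambda>_. 1 :: real" 1 0] by simp

lemma integrable_affine: "integrable gauss (\<lambda>z. f (y + \<sigma> *\<^sub>R z) * (\<alpha> + \<beta> \<bullet> z))"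
  using integrable_weighted[of "\<lambda>z. \<alpha> + \<beta> \<bullet> z" "\<bar>\<alpha>\<bar> + norm \<beta>" 1] norm_affine_weight(2)[of \<alpha> \<beta>] by simp

lemma integrable_daffine: "integrable gauss (\<lambda>z. f (y + \<sigma> *\<^sub>R z) *\<^sub>R ((\<alpha> + \<beta> \<bullet> z) *\<^sub>R z - \<beta>))"
  by (rule integrable_weighted[where k = 2]) (use norm_affine_weight(1)[of \<alpha> \<beta>] in auto)

text \<open>The Gaussian shift moves the increment of \<open>y\<close> from the merely Lipschitz \<open>f\<close> to the
  exponential weight.\<close>

lemma has_derivative_gauss_average:
  assumes \<sigma>: "\<sigma> > 0"
  shows "((\<lambda>y. \<integral>z. f (y + \<sigma> *\<^sub>R z) * (\<alpha> + \<beta> \<bullet> z) \<partial>gauss) has_derivative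
    (\<lambda>h. ((1 / \<sigma>) *\<^sub>R (\<integral>z. f (y + \<sigma> *\<^sub>R z) *\<^sub>R ((\<alpha> + \<beta> \<bullet> z) *\<^sub>R z - \<beta>) \<partial>gauss)) \<bullet> h)) (at y)"
proof -
  let ?p = "\<lambda>z. \<alpha> + \<beta> \<bullet> z" and ?q = "\<lambda>z. (\<alpha> + \<beta> \<bullet> z) *\<^sub>R z - \<beta>"
  define B where "B z = 3 * (\<bar>\<alpha>\<bar> + norm \<beta>) * exp (1 + norm z) * (1 + norm z) ^ 3" for z :: "real ^ 'd"
  have [measurable]: "B \<in> borel_measurable borel" unfolding B_def[abs_def] by measurable
  have B0: "0 \<le> B z" for z by (simp add: B_def)
  have iB: "integrable gauss (\<lambda>z. \<bar>f (y + \<sigma> *\<^sub>R z)\<bar> * B z)"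
  proof (rule integrable_gauss_bound_exp)
    fix z :: "real ^ 'd"
    define K where "K = (\<bar>f 0\<bar> + L) * (1 + norm y + \<bar>\<sigma>\<bar>) * 3 * (\<bar>\<alpha>\<bar> + norm \<beta>) * exp 1"
    have K: "K \<ge> 0" using L_nonneg by (simp add: K_def)
    have "\<bar>f (y + \<sigma> *\<^sub>R z)\<bar> * B z \<le> ((\<bar>f 0\<bar> + L) * (1 + norm y + \<bar>\<sigma>\<bar>) * (1 + norm z)) * B z"
      using growth[of y \<sigma> z] B0[of z] by (rule mult_right_mono)
    also have "\<dots> = K * exp (norm z) * (1 + norm z) ^ 4"
      by (simp add: B_def K_def exp_add power_numeral_reduce mult_ac)
    also have "\<dots> \<le> K * exp (norm z) * exp (real 4 * norm z)"
      using K by (intro mult_left_mono one_plus_power_le_exp) auto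
    also have "\<dots> = K * exp (5 * norm z)" by (simp add: mult.assoc flip: exp_add)
    finally show "norm (\<bar>f (y + \<sigma> *\<^sub>R z)\<bar> * B z) \<le> K * exp (5 * norm z)" using B0[of z] by simp
  qed measurable
  define I where "I = (\<integral>z. \<bar>f (y + \<sigma> *\<^sub>R z)\<bar> * B z \<partial>gauss)"
  show ?thesis
  \<comment> \<open>The radius \<sigma> ensures that the rescaled shift
    \<open>v = (1 / \<sigma>) *\<^sub>R h\<close> satisfies the norm bound of
    \<open>exp_tilt_remainder\<close>.\<close>
  proof (rule has_derivative_remainderI[where \<delta> = \<sigma> and \<omega> = "\<lambda>r. (I / \<sigma>\<^sup>2) * r"])
    show "((\<lambda>h. I / \<sigma>\<^sup>2 * norm h) \<longlongrightarrow> 0) (at (0::real ^ 'd))"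
      by (intro tendsto_mult_right_zero tendsto_norm_zero tendsto_ident_at)
    fix h :: "real ^ 'd"
    assume h: "norm h \<le> \<sigma>"
    define v where "v = (1 / \<sigma>) *\<^sub>R h"
    have v: "norm v \<le> 1" using h \<sigma> by (simp add: v_def)
    have hv: "h = \<sigma> *\<^sub>R v" using \<sigma> by (simp add: v_def)
    let ?F = "\<lambda>z. f (y + \<sigma> *\<^sub>R z) * ?p (z - v)"
    have [measurable]: "?F \<in> borel_measurable borel" by measurable
    \<comment> \<open>The increment \<open>h\<close> is absorbed by shifting \<open>z\<close> by
      \<open>v\<close>; in return the affine factor is evaluated at \<open>z - v\<close>.\<close>
    have sh: "f (y + h + \<sigma> *\<^sub>R z) * ?p z = ?F (v + 1 *\<^sub>R z)" for z
      by (simp add: hv algebra_simps)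
    have "integrable gauss (\<lambda>z. f (y + h + \<sigma> *\<^sub>R z) * ?p z)" by (rule integrable_affine)
    then have i1: "integrable gauss (\<lambda>z. gauss_weight v 1 z *\<^sub>R ?F z)"
      unfolding sh by (subst (asm) integrable_gauss_affine) auto
    have e1: "(\<integral>z. f (y + h + \<sigma> *\<^sub>R z) * ?p z \<partial>gauss) = (\<integral>z. gauss_weight v 1 z *\<^sub>R ?F z \<partial>gauss)"
      unfolding sh by (subst gauss_affine) auto
    let ?lhs = "(\<integral>z. f (y + h + \<sigma> *\<^sub>R z) * ?p z \<partial>gauss) - (\<integral>z. f (y + \<sigma> *\<^sub>R z) * ?p z \<partial>gauss)
         - ((1 / \<sigma>) *\<^sub>R (\<integral>z. f (y + \<sigma> *\<^sub>R z) *\<^sub>R ?q z \<partial>gauss)) \<bullet> h"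
    let ?rhs = "(\<integral>z. gauss_weight v 1 z *\<^sub>R ?F z - f (y + \<sigma> *\<^sub>R z) * ?p z - (f (y + \<sigma> *\<^sub>R z) *\<^sub>R ?q z) \<bullet> v \<partial>gauss)"
    have i2: "integrable gauss (\<lambda>z. (f (y + \<sigma> *\<^sub>R z) *\<^sub>R ?q z) \<bullet> v)"
      by (intro integrable_inner_left impI integrable_daffine)
    have "((1 / \<sigma>) *\<^sub>R (\<integral>z. f (y + \<sigma> *\<^sub>R z) *\<^sub>R ?q z \<partial>gauss)) \<bullet> h =
        (\<integral>z. f (y + \<sigma> *\<^sub>R z) *\<^sub>R ?q z \<partial>gauss) \<bullet> v"
      by (simp add: v_def)
    also have "\<dots> = (\<integral>z. (f (y + \<sigma> *\<^sub>R z) *\<^sub>R ?q z) \<bullet> v \<partial>gauss)"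
      using integrable_daffine by (intro integral_inner_left[symmetric]) auto
    finally have eq: "?lhs = ?rhs"
      unfolding e1 by (subst Bochner_Integration.integral_diff;
        (intro Bochner_Integration.integrable_diff i1 i2 integrable_affine)?)
        (subst Bochner_Integration.integral_diff, rule i1, rule integrable_affine, simp)
    have "\<bar>?lhs\<bar> = norm ?rhs" by (simp only: eq real_norm_def)
    also have "\<dots> \<le> (\<integral>z. (norm v)\<^sup>2 * (\<bar>f (y + \<sigma> *\<^sub>R z)\<bar> * B z) \<partial>gauss)"
    proof (rule norm_integral_le)
      fix z
      have "gauss_weight v 1 z *\<^sub>R ?F z - f (y + \<sigma> *\<^sub>R z) * ?p z - (f (y + \<sigma> *\<^sub>R z) *\<^sub>R ?q z) \<bullet> v
        = f (y + \<sigma> *\<^sub>R z) * (?p (z - v) * exp (v \<bullet> z - (norm v)\<^sup>2 / 2) - ?p z - ?q z \<bullet> v)"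
        by (simp add: gauss_weight_shift algebra_simps)
      also have "norm \<dots> \<le> \<bar>f (y + \<sigma> *\<^sub>R z)\<bar> * ((norm v)\<^sup>2 * B z)"
        unfolding real_norm_def abs_mult B_def by (intro mult_left_mono exp_tilt_remainder v) simp
      finally show "norm (gauss_weight v 1 z *\<^sub>R ?F z - f (y + \<sigma> *\<^sub>R z) * ?p z - (f (y + \<sigma> *\<^sub>R z) *\<^sub>R ?q z) \<bullet> v)
         \<le> (norm v)\<^sup>2 * (\<bar>f (y + \<sigma> *\<^sub>R z)\<bar> * B z)" by (simp add: mult_ac)
    qed (use iB in simp)
    also have "\<dots> = (norm v)\<^sup>2 * I" unfolding I_def by (rule integral_mult_right_zero)
    also have "norm v = norm h / \<sigma>" using \<sigma> by (simp add: v_def)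
    also have "(norm h / \<sigma>)\<^sup>2 * I = (I / \<sigma>\<^sup>2 * norm h) * norm h"
      by (simp add: power2_eq_square)
    finally show "\<bar>?lhs\<bar> \<le> (I / \<sigma>\<^sup>2 * norm h) * norm h" .
  qed (use \<sigma> in auto)
qed

end

text \<open>The average of the constant function 1 does not depend on the shift, so its derivative
  vanishes.\<close>

lemma gauss_affine_weight_mean:
  "(\<integral>z. ((\<alpha> + \<beta> \<bullet> z) *\<^sub>R z - \<beta>) \<partial>(gauss :: (real ^ 'd::finite) measure)) = 0" (is "?V = 0")
proof -
  interpret c: lipschitz_fun "\<lambda>_ :: real ^ 'd. 1 :: real" 0
    by standard (auto intro: lipschitz_intros)
  have "((\<lambda>y :: real ^ 'd. \<integral>z. (\<alpha> + \<beta> \<bullet> z) \<partial>gauss) has_derivative (\<lambda>h. ?V \<bullet> h)) (at 0)"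
    using c.has_derivative_gauss_average[of 1 \<alpha> \<beta> 0] by simp
  moreover have "((\<lambda>y :: real ^ 'd. \<integral>z. (\<alpha> + \<beta> \<bullet> z) \<partial>gauss) has_derivative (\<lambda>h. 0)) (at 0)"
    by (rule has_derivative_const)
  ultimately have "(\<lambda>h. ?V \<bullet> h) = (\<lambda>h. 0)" by (rule has_derivative_unique)
  then have "?V \<bullet> ?V = 0" by metis
  then show ?thesis by simp
qed

context lipschitz_fun
begin

text \<open>The weight has mean 0, so \<open>f y\<close> may be subtracted from
  \<open>f (y + \<sigma> *\<^sub>R z)\<close>. The Lipschitz increment then yields a factor
  \<sigma>, which cancels the \<open>1 / \<sigma>\<close> produced by differentiation.\<close>

lemma gauss_average_bound:
  "norm (\<integral>z. f (y + \<sigma> *\<^sub>R z) *\<^sub>R ((\<alpha> + \<beta> \<bullet> z) *\<^sub>R z - \<beta>) \<partial>gauss) \<le>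
     \<bar>\<sigma>\<bar> * L * (\<bar>\<alpha>\<bar> + norm \<beta>) * cubic_moment TYPE('d)"
proof -
  let ?q = "\<lambda>z. (\<alpha> + \<beta> \<bullet> z) *\<^sub>R z - \<beta>"
  have i: "integrable gauss ?q"
    by (rule integrable_gauss_bound_poly[where k = 2]) (use norm_affine_weight(1)[of \<alpha> \<beta>] in auto)
  have "(\<integral>z. f (y + \<sigma> *\<^sub>R z) *\<^sub>R ?q z \<partial>gauss) =
      (\<integral>z. f (y + \<sigma> *\<^sub>R z) *\<^sub>R ?q z \<partial>gauss) - f y *\<^sub>R (\<integral>z. ?q z \<partial>gauss)"
    by (simp only: gauss_affine_weight_mean) simp
  also have "\<dots> = (\<integral>z. f (y + \<sigma> *\<^sub>R z) *\<^sub>R ?q z - f y *\<^sub>R ?q z \<partial>gauss)"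
    using i integrable_daffine by (simp del: scaleR_diff_right)
  also have "norm \<dots> \<le> \<bar>\<sigma>\<bar> * L * (\<bar>\<alpha>\<bar> + norm \<beta>) * cubic_moment TYPE('d)"
  proof (rule norm_gauss_integral_cubic)
    fix z :: "real ^ 'd"
    have "norm (f (y + \<sigma> *\<^sub>R z) *\<^sub>R ?q z - f y *\<^sub>R ?q z) = \<bar>f (y + \<sigma> *\<^sub>R z) - f y\<bar> * norm (?q z)"
      by (simp only: scaleR_left_diff_distrib[symmetric] norm_scaleR)
    also have "\<dots> \<le> (L * (\<bar>\<sigma>\<bar> * (1 + norm z))) * ((\<bar>\<alpha>\<bar> + norm \<beta>) * (1 + norm z)\<^sup>2)"
    proof (intro mult_mono norm_affine_weight)
      show "\<bar>f (y + \<sigma> *\<^sub>R z) - f y\<bar> \<le> L * (\<bar>\<sigma>\<bar> * (1 + norm z))"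
        using lip_abs[of "y + \<sigma> *\<^sub>R z" y] L_nonneg
        by (smt (verit, ccfv_SIG) add_diff_cancel_left' mult_left_mono norm_scaleR abs_ge_zero)
    qed (use L_nonneg in auto)
    also have "\<dots> = \<bar>\<sigma>\<bar> * L * (\<bar>\<alpha>\<bar> + norm \<beta>) * (1 + norm z) ^ 3"
      by (simp add: power2_eq_square power3_eq_cube mult_ac)
    finally show "norm (f (y + \<sigma> *\<^sub>R z) *\<^sub>R ?q z - f y *\<^sub>R ?q z) \<le>
        \<bar>\<sigma>\<bar> * L * (\<bar>\<alpha>\<bar> + norm \<beta>) * (1 + norm z) ^ 3" .
  qed
  finally show ?thesis .
qed

text \<open>Here the increment of \<open>f\<close> in \<open>y\<close> is used instead, and no power
  of \<sigma> is gained; this bound and the previous one are the two ends of the interpolation in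
  \<open>pot_gradient_Hoelder\<close>.\<close>

lemma gauss_average_lipschitz:
  "norm ((\<integral>z. f (y + \<sigma> *\<^sub>R z) *\<^sub>R ((\<alpha> + \<beta> \<bullet> z) *\<^sub>R z - \<beta>) \<partial>gauss)
     - (\<integral>z. f (y' + \<sigma> *\<^sub>R z) *\<^sub>R ((\<alpha> + \<beta> \<bullet> z) *\<^sub>R z - \<beta>) \<partial>gauss)) \<le>
     norm (y - y') * L * (\<bar>\<alpha>\<bar> + norm \<beta>) * cubic_moment TYPE('d)"
proof -
  let ?q = "\<lambda>z. (\<alpha> + \<beta> \<bullet> z) *\<^sub>R z - \<beta>"
  have "(\<integral>z. f (y + \<sigma> *\<^sub>R z) *\<^sub>R ?q z \<partial>gauss) - (\<integral>z. f (y' + \<sigma> *\<^sub>R z) *\<^sub>R ?q z \<partial>gauss) =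
      (\<integral>z. f (y + \<sigma> *\<^sub>R z) *\<^sub>R ?q z - f (y' + \<sigma> *\<^sub>R z) *\<^sub>R ?q z \<partial>gauss)"
    using integrable_daffine by (simp del: scaleR_diff_right)
  also have "norm \<dots> \<le> norm (y - y') * L * (\<bar>\<alpha>\<bar> + norm \<beta>) * cubic_moment TYPE('d)"
  proof (rule norm_gauss_integral_cubic)
    fix z :: "real ^ 'd"
    have "norm (f (y + \<sigma> *\<^sub>R z) *\<^sub>R ?q z - f (y' + \<sigma> *\<^sub>R z) *\<^sub>R ?q z) =
        \<bar>f (y + \<sigma> *\<^sub>R z) - f (y' + \<sigma> *\<^sub>R z)\<bar> * norm (?q z)"
      by (simp only: scaleR_left_diff_distrib[symmetric] norm_scaleR)
    also have "\<dots> \<le> (L * norm (y - y')) * ((\<bar>\<alpha>\<bar> + norm \<beta>) * (1 + norm z) ^ 3)"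
    proof (intro mult_mono)
      show "norm (?q z) \<le> (\<bar>\<alpha>\<bar> + norm \<beta>) * (1 + norm z) ^ 3"
        using power_increasing[of 2 3 "1 + norm z"]
        by (intro order_trans[OF norm_affine_weight(1)] mult_left_mono) auto
    qed (use lip_abs[of "y + \<sigma> *\<^sub>R z" "y' + \<sigma> *\<^sub>R z"] L_nonneg in auto)
    finally show "norm (f (y + \<sigma> *\<^sub>R z) *\<^sub>R ?q z - f (y' + \<sigma> *\<^sub>R z) *\<^sub>R ?q z) \<le>
        norm (y - y') * L * (\<bar>\<alpha>\<bar> + norm \<beta>) * (1 + norm z) ^ 3" by (simp add: mult_ac)
  qed
  finally show ?thesis .
qed

end

section \<open>The Ornstein--Uhlenbeck potential\<close>

definition unit_ival :: "real measure" where
  "unit_ival = restrict_space lborel {0<..<1}"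

lemma space_unit_ival [simp]: "space unit_ival = {0<..<1}"
  by (simp add: unit_ival_def space_restrict_space)

lemma measurable_unit_ival [measurable (raw)]:
  "g \<in> measurable borel N \<Longrightarrow> g \<in> measurable unit_ival N"
  unfolding unit_ival_def by (rule measurable_restrict_space1) simp

lemma finite_measure_unit_ival: "finite_measure unit_ival"
  unfolding unit_ival_def
  by standard (simp add: emeasure_restrict_space space_restrict_space)

interpretation unit_ival: finite_measure unit_ival by (rule finite_measure_unit_ival)

text \<open>The coefficient of the noise in Mehler's formula when the initial point is multiplied by
  \<open>s\<close>.\<close>

definition cosgn :: "real \<Rightarrow> real" where "cosgn s = sqrt (1 - s\<^sup>2)"

lemma cosgn_measurable [measurable]: "cosgn \<in> borel_measurable borel"
  unfolding cosgn_def[abs_def] by measurable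

lemma cosgn_bounds:
  assumes "0 < s" "s < 1"
  shows "0 < cosgn s" "cosgn s < 1" "(cosgn s)\<^sup>2 = 1 - s\<^sup>2" "1 - cosgn s \<le> s"
proof -
  have s2: "0 < s\<^sup>2" "s\<^sup>2 < 1" using assms by (auto simp: power_less_one_iff)
  show "0 < cosgn s" "cosgn s < 1" "(cosgn s)\<^sup>2 = 1 - s\<^sup>2" using s2 by (auto simp: cosgn_def)
  have "(1 - s)\<^sup>2 \<le> 1 - s\<^sup>2" using assms by (simp add: power2_eq_square algebra_simps mult_left_le)
  then have "1 - s \<le> cosgn s" unfolding cosgn_def by (rule real_le_rsqrt)
  then show "1 - cosgn s \<le> s" by simp
qed

text \<open>An integrable singularity that dominates \<open>cosgn s\<close> to the power -3/2: since
  \<open>cosgn s\<close> is at least \<open>sqrt (1 - s)\<close>, half of the exponent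
  remains.\<close>

definition sing_bound :: "real \<Rightarrow> real" where "sing_bound s = (1 - s) powr (- 3 / 4)"

lemma integrable_sing_bound: "integrable unit_ival sing_bound"
proof -
  let ?F = "\<lambda>s :: real. - 4 * (1 - s) powr (1 / 4)"
  have "set_integrable lborel (einterval 0 1) sing_bound"
  proof (rule interval_integral_FTC_nonneg(1)[where F = ?F and A = "- 4" and B = 0])
    fix x assume "0 < ereal x" "ereal x < 1"
    then have x: "0 < x" "x < 1" by auto
    have "(?F has_real_derivative - 4 * ((1 / 4) * (1 - x) powr (1 / 4 - 1) * (0 - 1))) (at x)"
      using x by (auto intro!: derivative_eq_intros)
    then show "(?F has_real_derivative sing_bound x) (at x)"
      by (simp add: sing_bound_def)
    show "isCont sing_bound x"
      using x unfolding sing_bound_def[abs_def] by (intro continuous_intros) auto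
  next
    have "((\<lambda>s. - 4 * (1 - s) powr (1 / 4)) \<longlongrightarrow> - 4 * (1 - 0) powr (1 / 4)) (at_right (0::real))"
      by (intro tendsto_intros) auto
    then show "((?F \<circ> real_of_ereal) \<longlongrightarrow> - 4) (at_right 0)"
      unfolding zero_ereal_def by (simp add: ereal_tendsto_simps)
    have "((\<lambda>s. - 4 * (1 - s) powr (1 / 4)) \<longlongrightarrow> - 4 * 0) (at_left (1::real))"
    proof (intro tendsto_mult_left)
      have "((\<lambda>s :: real. (1 - s) powr (1 / 4)) \<longlongrightarrow> (1 - 1) powr (1 / 4)) (at_left 1)"
        by (rule tendsto_powr'[OF tendsto_diff[OF tendsto_const tendsto_ident_at] tendsto_const])
          (auto intro!: eventually_at_leftI[of 0])
      then show "((\<lambda>s :: real. (1 - s) powr (1 / 4)) \<longlongrightarrow> 0) (at_left 1)" by simp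
    qed
    then show "((?F \<circ> real_of_ereal) \<longlongrightarrow> 0) (at_left 1)"
      unfolding one_ereal_def by (simp add: ereal_tendsto_simps)
  qed (auto simp: sing_bound_def)
  moreover have "einterval 0 1 = {0<..<1}"
    by (auto simp: einterval_def)
  ultimately show ?thesis
    by (simp add: unit_ival_def integrable_restrict_space set_integrable_def)
qed

lemma inverse_cosgn_le:
  assumes "0 < s" "s < 1"
  shows "1 / (cosgn s * sqrt (cosgn s)) \<le> sing_bound s" "1 / cosgn s \<le> sing_bound s"
proof -
  have c: "0 < cosgn s" "cosgn s < 1" using cosgn_bounds[OF assms] by auto
  have q: "0 < 1 - s\<^sup>2" using assms by (simp add: power_less_one_iff)
  have "1 / (cosgn s * sqrt (cosgn s)) = 1 / (cosgn s powr 1 * cosgn s powr (1 / 2))"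
    using c by (simp add: powr_half_sqrt)
  also have "\<dots> = 1 / cosgn s powr (1 + 1 / 2)" by (simp only: powr_add)
  also have "\<dots> = cosgn s powr (- 3 / 2)" by (simp add: powr_minus_divide[of _ "3 / 2"])
  also have "\<dots> = ((1 - s\<^sup>2) powr (1 / 2)) powr (- 3 / 2)"
    using q by (simp only: cosgn_def powr_half_sqrt)
  also have "\<dots> = (1 - s\<^sup>2) powr (- 3 / 4)" by (simp add: powr_powr)
  also have "\<dots> \<le> (1 - s) powr (- 3 / 4)"
  proof (rule powr_mono2')
    show "1 - s \<le> 1 - s\<^sup>2" using assms by (simp add: power2_eq_square mult_left_le)
  qed (use assms in auto)
  finally show 1: "1 / (cosgn s * sqrt (cosgn s)) \<le> sing_bound s" by (simp add: sing_bound_def)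
  have "1 / cosgn s \<le> 1 / (cosgn s * sqrt (cosgn s))"
    using c by (intro divide_left_mono) (auto intro!: mult_left_le mult_pos_pos)
  with 1 show "1 / cosgn s \<le> sing_bound s" by simp
qed

lemma interpolate_bounds:
  fixes X A B :: real
  assumes "0 \<le> X" "X \<le> A" "X \<le> B" shows "X \<le> sqrt (A * B)"
proof (rule real_le_rsqrt)
  show "X\<^sup>2 \<le> A * B" using assms by (auto simp: power2_eq_square intro: mult_mono)
qed

context lipschitz_fun
begin

lemma gauss_average_measurable [measurable]:
  fixes q :: "real ^ 'd \<Rightarrow> 'b::{banach, second_countable_topology}"
  assumes [measurable]: "q \<in> borel_measurable borel"
  shows "(\<lambda>s. \<integral>z. f (s *\<^sub>R x + cosgn s *\<^sub>R z) *\<^sub>R q z \<partial>gauss) \<in> borel_measurable borel"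
  by measurable

lemma gauss_average_measurable' [measurable]:
  assumes [measurable]: "q \<in> borel_measurable borel"
  shows "(\<lambda>s. \<integral>z. f (s *\<^sub>R x + cosgn s *\<^sub>R z) * q z \<partial>gauss) \<in> borel_measurable borel"
  by measurable

text \<open>Both differentiations of the potential are instances: \<open>a s = 1 / s\<close> with
  weight 1 leads to the gradient, \<open>a s = 1 / cosgn s\<close> with weight \<open>z $ i\<close>
  to a row of the Hessian. In each, the chain rule contributes a factor \<open>s\<close> and the
  Gaussian shift a factor \<open>1 / cosgn s\<close>; \<open>a_bound\<close> controls the
  singularity at 1 in both cases.\<close>

context
  fixes a :: "real \<Rightarrow> real" and \<alpha> :: real and \<beta> :: "real ^ 'd"
  assumes a_measurable [measurable]: "a \<in> borel_measurable borel"
    and a_nonneg: "\<And>s. 0 < s \<Longrightarrow> s < 1 \<Longrightarrow> 0 \<le> a s"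
    and a_bound: "\<And>s. 0 < s \<Longrightarrow> s < 1 \<Longrightarrow> a s * s \<le> 1 / cosgn s"
    and pot_integrable: "\<And>x. integrable unit_ival
      (\<lambda>s. a s * (\<integral>z. f (s *\<^sub>R x + cosgn s *\<^sub>R z) * (\<alpha> + \<beta> \<bullet> z) \<partial>gauss))"
begin

private abbreviation "mC \<equiv> L * (\<bar>\<alpha>\<bar> + norm \<beta>) * cubic_moment TYPE('d)"

private lemma mC_nonneg: "0 \<le> mC"
  using L_nonneg cubic_moment_nonneg by (intro mult_nonneg_nonneg) auto

private abbreviation "potD s x \<equiv> (a s * s / cosgn s) *\<^sub>R
  (\<integral>z. f (s *\<^sub>R x + cosgn s *\<^sub>R z) *\<^sub>R ((\<alpha> + \<beta> \<bullet> z) *\<^sub>R z - \<beta>) \<partial>gauss)"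

lemma pot_gradient_bound:
  assumes s: "0 < s" "s < 1"
  shows "norm (potD s x) \<le> a s * s * mC"
proof -
  note c = cosgn_bounds[OF s]
  have "norm (potD s x) \<le> (a s * s / cosgn s) * (\<bar>cosgn s\<bar> * mC)"
    unfolding norm_scaleR
    using a_nonneg[OF s] s c gauss_average_bound[of "s *\<^sub>R x" "cosgn s" \<alpha> \<beta>]
    by (intro mult_mono) (auto simp: mult.assoc)
  also have "\<dots> = a s * s * mC" using c by simp
  finally show ?thesis .
qed

text \<open>The integrand of the gradient is bounded by a multiple of \<open>a s * s\<close>, and
  its Lipschitz constant exceeds this by a factor \<open>1 / cosgn s\<close>. For the Hessian that
  constant has order 1 / (1 - s) and is not integrable; the geometric mean of the two bounds costs
  only \<open>cosgn s\<close> to the power -3/2.\<close>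

lemma pot_gradient_Hoelder:
  assumes s: "0 < s" "s < 1"
  shows "norm (potD s x - potD s y) \<le> (sing_bound s * (2 * mC)) * sqrt (norm (x - y))"
proof -
  note c = cosgn_bounds[OF s]
  define A where "A = a s * s * mC"
  have as: "0 \<le> a s * s" using a_nonneg[OF s] s by simp
  have A0: "0 \<le> A" unfolding A_def using mult_nonneg_nonneg[OF as mC_nonneg] .
  have 1: "norm (potD s x - potD s y) \<le> 2 * A"
    using pot_gradient_bound[OF s, of x] pot_gradient_bound[OF s, of y]
      norm_triangle_ineq4[of "potD s x" "potD s y"] unfolding A_def by linarith
  have "norm (potD s x - potD s y) \<le> (a s * s / cosgn s) * (norm (s *\<^sub>R x - s *\<^sub>R y) * mC)"
    unfolding scaleR_diff_right[symmetric] norm_scaleR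
  proof (rule mult_mono)
    show "norm ((\<integral>z. f (s *\<^sub>R x + cosgn s *\<^sub>R z) *\<^sub>R ((\<alpha> + \<beta> \<bullet> z) *\<^sub>R z - \<beta>) \<partial>gauss) -
        (\<integral>z. f (s *\<^sub>R y + cosgn s *\<^sub>R z) *\<^sub>R ((\<alpha> + \<beta> \<bullet> z) *\<^sub>R z - \<beta>) \<partial>gauss))
      \<le> \<bar>s\<bar> * norm (x - y) * mC"
      using gauss_average_lipschitz[of "s *\<^sub>R x" "cosgn s" \<alpha> \<beta> "s *\<^sub>R y"]
      by (simp only: mult.assoc scaleR_diff_right[symmetric] norm_scaleR)
  qed (use as c(1) in auto)
  also have "\<dots> = s * norm (x - y) * (A / cosgn s)"
    using s by (simp add: A_def flip: scaleR_diff_right)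
  also have "\<dots> \<le> norm (x - y) * (A / cosgn s)"
    using s A0 c(1) by (intro mult_right_mono) (auto intro: mult_left_le_one_le)
  finally have 2: "norm (potD s x - potD s y) \<le> norm (x - y) * (A / cosgn s)" .
  have "norm (potD s x - potD s y) \<le> sqrt ((2 * A) * (norm (x - y) * (A / cosgn s)))"
    by (rule interpolate_bounds[OF norm_ge_zero 1 2])
  also have "\<dots> = sqrt 2 * (A * (sqrt (norm (x - y)) / sqrt (cosgn s)))"
    using A0 by (simp add: real_sqrt_mult real_sqrt_divide)
  also have "\<dots> \<le> 2 * (A * (sqrt (norm (x - y)) / sqrt (cosgn s)))"
    using A0 c(1) by (intro mult_right_mono) (auto simp: sqrt2_less_2[THEN less_imp_le])
  also have "\<dots> \<le> 2 * (((1 / cosgn s) * mC) * (sqrt (norm (x - y)) / sqrt (cosgn s)))"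
    unfolding A_def using a_bound[OF s] mC_nonneg c(1) by (intro mult_left_mono mult_right_mono) auto
  also have "\<dots> = (1 / (cosgn s * sqrt (cosgn s))) * (2 * mC * sqrt (norm (x - y)))" by simp
  also have "\<dots> \<le> sing_bound s * (2 * mC * sqrt (norm (x - y)))"
    using mC_nonneg by (intro mult_right_mono inverse_cosgn_le s) (auto intro!: mult_nonneg_nonneg)
  finally show ?thesis by (simp add: mult.assoc)
qed

lemma pot_gradient_integrable: "integrable unit_ival (\<lambda>s. potD s x)"
proof (rule Bochner_Integration.integrable_bound)
  show "integrable unit_ival (\<lambda>s. sing_bound s * mC)" using integrable_sing_bound by simp
  have "norm (potD s x) \<le> sing_bound s * mC" if s: "0 < s" "s < 1" for s
  proof -
    have "norm (potD s x) \<le> a s * s * mC" by (rule pot_gradient_bound[OF s])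
    also have "\<dots> \<le> sing_bound s * mC"
      using a_bound[OF s] inverse_cosgn_le(2)[OF s] mC_nonneg by (intro mult_right_mono) auto
    finally show ?thesis .
  qed
  then show "AE s in unit_ival. norm (potD s x) \<le> norm (sing_bound s * mC)"
    unfolding real_norm_def[of "sing_bound _ * mC"]
    by (intro AE_I2) (rule order_trans[OF _ abs_ge_self], simp del: norm_scaleR)
qed measurable

lemma pot_term_derivative:
  assumes s: "0 < s" "s < 1"
  shows "((\<lambda>x. a s * (\<integral>z. f (s *\<^sub>R x + cosgn s *\<^sub>R z) * (\<alpha> + \<beta> \<bullet> z) \<partial>gauss)) has_derivative
    (\<lambda>h. potD s x \<bullet> h)) (at x)"
proof -
  have "((\<lambda>x. \<integral>z. f (s *\<^sub>R x + cosgn s *\<^sub>R z) * (\<alpha> + \<beta> \<bullet> z) \<partial>gauss) has_derivative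
    (\<lambda>h. ((1 / cosgn s) *\<^sub>R (\<integral>z. f (s *\<^sub>R x + cosgn s *\<^sub>R z) *\<^sub>R ((\<alpha> + \<beta> \<bullet> z) *\<^sub>R z - \<beta>) \<partial>gauss)) \<bullet> (s *\<^sub>R h))) (at x)"
    by (rule has_derivative_compose[OF _ has_derivative_gauss_average[OF cosgn_bounds(1)[OF s]]])
       (auto intro!: derivative_eq_intros)
  from has_derivative_mult_right[OF this, of "a s"] show ?thesis by (simp add: mult_ac)
qed

lemma has_derivative_pot:
  "((\<lambda>x. \<integral>s. a s * (\<integral>z. f (s *\<^sub>R x + cosgn s *\<^sub>R z) * (\<alpha> + \<beta> \<bullet> z) \<partial>gauss) \<partial>unit_ival) has_derivative
    (\<lambda>h. (\<integral>s. potD s x \<partial>unit_ival) \<bullet> h)) (at x)"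
  and pot_Hoelder: "norm ((\<integral>s. potD s x \<partial>unit_ival) - (\<integral>s. potD s y \<partial>unit_ival)) \<le>
    (\<integral>s. sing_bound s * (2 * mC) \<partial>unit_ival) * sqrt (norm (x - y))"
proof -
  have i: "integrable unit_ival (\<lambda>s. sing_bound s * (2 * mC))"
    using integrable_sing_bound by simp
  have nn: "0 \<le> sing_bound s * (2 * mC)" for s
    using L_nonneg cubic_moment_nonneg by (intro mult_nonneg_nonneg) (auto simp: sing_bound_def)
  note d = pot_term_derivative pot_gradient_Hoelder
  show "((\<lambda>x. \<integral>s. a s * (\<integral>z. f (s *\<^sub>R x + cosgn s *\<^sub>R z) * (\<alpha> + \<beta> \<bullet> z) \<partial>gauss) \<partial>unit_ival) has_derivative
    (\<lambda>h. (\<integral>s. potD s x \<partial>unit_ival) \<bullet> h)) (at x)"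
    by (rule has_derivative_param_integral[OF _ _ _ i pot_integrable pot_gradient_integrable])
       (use d nn in auto)
  show "norm ((\<integral>s. potD s x \<partial>unit_ival) - (\<integral>s. potD s y \<partial>unit_ival)) \<le>
    (\<integral>s. sing_bound s * (2 * mC) \<partial>unit_ival) * sqrt (norm (x - y))"
    by (rule param_integral_Hoelder[OF _ _ _ i pot_integrable pot_gradient_integrable])
       (use d nn in auto)
qed

end

section \<open>The potential with its gradient and Hessian\<close>

definition ou_pot :: "real ^ 'd \<Rightarrow> real" where
  "ou_pot x = - 2 * (\<integral>s. (1 / s) * (\<integral>z. f (s *\<^sub>R x + cosgn s *\<^sub>R z) \<partial>gauss) \<partial>unit_ival)"

text \<open>The factor \<open>s\<close> of the chain rule has cancelled the \<open>1 / s\<close> of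
  \<open>ou_pot\<close>. The factor 2 in both stems from dt = - 2 ds / s.\<close>

definition ou_grad :: "real ^ 'd \<Rightarrow> real ^ 'd" where
  "ou_grad x = - 2 *\<^sub>R (\<integral>s. (1 / cosgn s) *\<^sub>R (\<integral>z. f (s *\<^sub>R x + cosgn s *\<^sub>R z) *\<^sub>R z \<partial>gauss) \<partial>unit_ival)"

text \<open>Row \<open>i\<close> of the Hessian; \<open>z $ i *\<^sub>R z - axis i 1\<close> is a
  row of second-order Hermite polynomials.\<close>

definition ou_hess :: "'d \<Rightarrow> real ^ 'd \<Rightarrow> real ^ 'd" where
  "ou_hess i x = - 2 *\<^sub>R (\<integral>s. (s / (cosgn s)\<^sup>2) *\<^sub>R
     (\<integral>z. f (s *\<^sub>R x + cosgn s *\<^sub>R z) *\<^sub>R (z $ i *\<^sub>R z - axis i 1) \<partial>gauss) \<partial>unit_ival)"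

lemma first_moment_le: "integrable gauss (\<lambda>z :: real ^ 'd. norm z)"
    "(\<integral>z. norm z \<partial>(gauss :: (real ^ 'd) measure)) \<le> cubic_moment TYPE('d)"
proof -
  show i: "integrable gauss (\<lambda>z :: real ^ 'd. norm z)"
    by (rule integrable_gauss_bound_poly[where C = 1 and k = 1]) auto
  have "norm z \<le> (1 + norm z) ^ 3" for z :: "real ^ 'd"
    using self_le_power[of "1 + norm z" 3] by simp
  then show "(\<integral>z. norm z \<partial>(gauss :: (real ^ 'd) measure)) \<le> cubic_moment TYPE('d)"
    unfolding cubic_moment_def by (intro Bochner_Integration.integral_mono i integrable_cubic)
qed

text \<open>Because \<open>f\<close> has Gaussian mean 0, \<open>f z\<close> can be subtracted under
  the integral, and the arguments then differ by \<open>s *\<^sub>R x\<close> and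
  \<open>(1 - cosgn s) *\<^sub>R z\<close>, both of order \<open>s\<close>. This compensates the
  factor \<open>1 / s\<close> of the potential near 0.\<close>

lemma ou_average_bound:
  assumes "(\<integral>x. f x \<partial>gauss) = 0" and s: "0 < s" "s < 1"
  shows "\<bar>\<integral>z. f (s *\<^sub>R x + cosgn s *\<^sub>R z) \<partial>gauss\<bar> \<le> s * (L * (norm x + cubic_moment TYPE('d)))"
proof -
  note c = cosgn_bounds[OF s]
  have i: "integrable gauss f" using integrable_plain[of 0 1] by simp
  have "(\<integral>z. f (s *\<^sub>R x + cosgn s *\<^sub>R z) \<partial>gauss) = (\<integral>z. f (s *\<^sub>R x + cosgn s *\<^sub>R z) - f z \<partial>gauss)"
    using integrable_plain i assms(1) by simp
  moreover have "norm (\<integral>z. f (s *\<^sub>R x + cosgn s *\<^sub>R z) - f z \<partial>gauss) \<le>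
    (\<integral>z. L * (s * norm x + s * norm z) \<partial>(gauss :: (real ^ 'd) measure))"
  proof (rule norm_integral_le)
    fix z :: "real ^ 'd"
    have "norm (s *\<^sub>R x + cosgn s *\<^sub>R z - z) = norm (s *\<^sub>R x - (1 - cosgn s) *\<^sub>R z)"
      by (simp add: algebra_simps)
    also have "\<dots> \<le> s * norm x + (1 - cosgn s) * norm z"
      using c s by (intro order_trans[OF norm_triangle_ineq4]) simp
    also have "\<dots> \<le> s * norm x + s * norm z"
      using c by (intro add_left_mono mult_right_mono) auto
    finally have "L * norm (s *\<^sub>R x + cosgn s *\<^sub>R z - z) \<le> L * (s * norm x + s * norm z)"
      using L_nonneg by (rule mult_left_mono)
    then show "norm (f (s *\<^sub>R x + cosgn s *\<^sub>R z) - f z) \<le> L * (s * norm x + s * norm z)"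
      using lip_abs[of "s *\<^sub>R x + cosgn s *\<^sub>R z" z] by simp
  qed (use first_moment_le in simp)
  moreover have "(\<integral>z. L * (s * norm x + s * norm z) \<partial>(gauss :: (real ^ 'd) measure)) =
      s * (L * (norm x + (\<integral>z. norm z \<partial>(gauss :: (real ^ 'd) measure))))"
    using first_moment_le(1) gauss.prob_space[where 'd = 'd] by (simp add: algebra_simps)
  moreover have "\<dots> \<le> s * (L * (norm x + cubic_moment TYPE('d)))"
    using s L_nonneg first_moment_le(2) by (intro mult_left_mono) auto
  ultimately show ?thesis unfolding real_norm_def by linarith
qed

lemma ou_pot_integrable:
  assumes "(\<integral>x. f x \<partial>gauss) = 0"
  shows "integrable unit_ival (\<lambda>s. (1 / s) * (\<integral>z. f (s *\<^sub>R x + cosgn s *\<^sub>R z) \<partial>gauss))"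
proof (rule unit_ival.integrable_const_bound[where B = "L * (norm x + cubic_moment TYPE('d))"])
  show "AE s in unit_ival. norm ((1 / s) * (\<integral>z. f (s *\<^sub>R x + cosgn s *\<^sub>R z) \<partial>gauss)) \<le> L * (norm x + cubic_moment TYPE('d))"
    using ou_average_bound[OF assms, of _ x] by (intro AE_I2) (auto simp: abs_mult divide_simps mult_ac)
  show "(\<lambda>s. (1 / s) * (\<integral>z. f (s *\<^sub>R x + cosgn s *\<^sub>R z) \<partial>gauss)) \<in> borel_measurable unit_ival"
    using gauss_average_measurable[of "\<lambda>_. 1 :: real" x] by simp
qed

lemma ou_pot_deriv:
  assumes "(\<integral>x. f x \<partial>gauss) = 0"
  shows "(ou_pot has_derivative (\<lambda>h. ou_grad x \<bullet> h)) (at x)"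
proof -
  have "((\<lambda>x. \<integral>s. (1 / s) * (\<integral>z. f (s *\<^sub>R x + cosgn s *\<^sub>R z) * (1 + 0 \<bullet> z) \<partial>gauss) \<partial>unit_ival) has_derivative
    (\<lambda>h. (\<integral>s. ((1 / s) * s / cosgn s) *\<^sub>R (\<integral>z. f (s *\<^sub>R x + cosgn s *\<^sub>R z) *\<^sub>R ((1 + 0 \<bullet> z) *\<^sub>R z - 0) \<partial>gauss) \<partial>unit_ival) \<bullet> h)) (at x)"
  proof (rule has_derivative_pot)
    show "(1 / s) * s \<le> 1 / cosgn s" if "0 < s" "s < 1" for s
      using cosgn_bounds[OF that] that by simp
    show "integrable unit_ival (\<lambda>s. (1 / s) * (\<integral>z. f (s *\<^sub>R x + cosgn s *\<^sub>R z) * (1 + 0 \<bullet> z) \<partial>gauss))" for x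
      using ou_pot_integrable[OF assms, of x] by simp
  qed auto
  also have "(\<integral>s. ((1 / s) * s / cosgn s) *\<^sub>R (\<integral>z. f (s *\<^sub>R x + cosgn s *\<^sub>R z) *\<^sub>R ((1 + 0 \<bullet> z) *\<^sub>R z - 0) \<partial>gauss) \<partial>unit_ival)
    = (\<integral>s. (1 / cosgn s) *\<^sub>R (\<integral>z. f (s *\<^sub>R x + cosgn s *\<^sub>R z) *\<^sub>R z \<partial>gauss) \<partial>unit_ival)"
    by (rule Bochner_Integration.integral_cong) auto
  finally have "((\<lambda>x. \<integral>s. (1 / s) * (\<integral>z. f (s *\<^sub>R x + cosgn s *\<^sub>R z) \<partial>gauss) \<partial>unit_ival) has_derivative
    (\<lambda>h. (\<integral>s. (1 / cosgn s) *\<^sub>R (\<integral>z. f (s *\<^sub>R x + cosgn s *\<^sub>R z) *\<^sub>R z \<partial>gauss) \<partial>unit_ival) \<bullet> h)) (at x)"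
    by simp
  from has_derivative_mult_right[OF this, of "- 2"]
  show ?thesis unfolding ou_pot_def[abs_def] ou_grad_def by simp
qed

lemma ou_grad_integrable:
  "integrable unit_ival (\<lambda>s. (1 / cosgn s) *\<^sub>R (\<integral>z. f (s *\<^sub>R x + cosgn s *\<^sub>R z) *\<^sub>R z \<partial>gauss))"
proof (rule unit_ival.integrable_const_bound[where B = "L * cubic_moment TYPE('d)"])
  show "AE s in unit_ival. norm ((1 / cosgn s) *\<^sub>R (\<integral>z. f (s *\<^sub>R x + cosgn s *\<^sub>R z) *\<^sub>R z \<partial>gauss)) \<le> L * cubic_moment TYPE('d)"
  proof (rule AE_I2)
    fix s assume "s \<in> space unit_ival"
    then have c: "0 < cosgn s" using cosgn_bounds(1) by simp
    then show "norm ((1 / cosgn s) *\<^sub>R (\<integral>z. f (s *\<^sub>R x + cosgn s *\<^sub>R z) *\<^sub>R z \<partial>gauss)) \<le> L * cubic_moment TYPE('d)"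
      using gauss_average_bound[of "s *\<^sub>R x" "cosgn s" 1 0] by (simp add: divide_simps mult_ac)
  qed
qed measurable

lemma integrable_weighted_id: "integrable gauss (\<lambda>z. f (y + \<sigma> *\<^sub>R z) *\<^sub>R z)"
  using integrable_daffine[of y \<sigma> 1 0] by simp

lemma integral_weighted_id_nth:
  "(\<integral>z. f (y + \<sigma> *\<^sub>R z) *\<^sub>R z \<partial>gauss) $ i = (\<integral>z. f (y + \<sigma> *\<^sub>R z) * z $ i \<partial>gauss)"
  using integral_bounded_linear[where T = "\<lambda>v. v $ i", OF bounded_linear_vec_nth integrable_weighted_id, of y \<sigma>] by simp

lemma ou_grad_nth_integrable:
  "integrable unit_ival (\<lambda>s. (1 / cosgn s) * (\<integral>z. f (s *\<^sub>R x + cosgn s *\<^sub>R z) * z $ i \<partial>gauss))"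
  using integrable_bounded_linear[where T = "\<lambda>v. v $ i", OF bounded_linear_vec_nth ou_grad_integrable, of x]
  by (simp add: integral_weighted_id_nth)

lemma ou_grad_nth:
  "ou_grad x $ i = - 2 * (\<integral>s. (1 / cosgn s) * (\<integral>z. f (s *\<^sub>R x + cosgn s *\<^sub>R z) * z $ i \<partial>gauss) \<partial>unit_ival)"
  unfolding ou_grad_def
  using integral_bounded_linear[where T = "\<lambda>v. v $ i", OF bounded_linear_vec_nth ou_grad_integrable, of x]
  by (simp add: integral_weighted_id_nth)

definition hess_const :: real where
  "hess_const = 2 * (\<integral>s. sing_bound s * (2 * (L * cubic_moment TYPE('d))) \<partial>unit_ival)"

lemma ou_grad_nth_deriv: "((\<lambda>x. ou_grad x $ i) has_derivative (\<lambda>h. ou_hess i x \<bullet> h)) (at x)"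
  and ou_hess_Hoelder: "norm (ou_hess i x - ou_hess i y) \<le> hess_const * sqrt (norm (x - y))"
  and ou_hess_integrable: "integrable unit_ival (\<lambda>s. (s / (cosgn s)\<^sup>2) *\<^sub>R
     (\<integral>z. f (s *\<^sub>R x + cosgn s *\<^sub>R z) *\<^sub>R (z $ i *\<^sub>R z - axis i 1) \<partial>gauss))"
proof -
  have p: "0 \<le> 1 / cosgn s" "1 / cosgn s * s \<le> 1 / cosgn s" if "0 < s" "s < 1" for s
    using cosgn_bounds[OF that] that by (simp_all add: divide_simps)
  have m: "(\<lambda>s. 1 / cosgn s) \<in> borel_measurable borel" by measurable
  have e: "0 + axis i 1 \<bullet> z = z $ i" for z :: "real ^ 'd" by (simp add: inner_axis')
  have I: "integrable unit_ival
      (\<lambda>s. (1 / cosgn s) * (\<integral>z. f (s *\<^sub>R x + cosgn s *\<^sub>R z) * (0 + axis i 1 \<bullet> z) \<partial>gauss))" for x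
    unfolding e by (rule ou_grad_nth_integrable)
  have q: "(1 / cosgn s * s / cosgn s) = s / (cosgn s)\<^sup>2" for s by (simp add: power2_eq_square)
  note * = has_derivative_pot[OF m p I] pot_Hoelder[OF m p I] pot_gradient_integrable[OF m p I]
  note ** = *[unfolded e q]
  from has_derivative_mult_right[OF **(1), of "- 2"]
  show "((\<lambda>x. ou_grad x $ i) has_derivative (\<lambda>h. ou_hess i x \<bullet> h)) (at x)"
    unfolding ou_grad_nth ou_hess_def by simp
  let ?H = "\<lambda>x. \<integral>s. (s / (cosgn s)\<^sup>2) *\<^sub>R
     (\<integral>z. f (s *\<^sub>R x + cosgn s *\<^sub>R z) *\<^sub>R (z $ i *\<^sub>R z - axis i 1) \<partial>gauss) \<partial>unit_ival"
  have "norm (ou_hess i x - ou_hess i y) = 2 * norm (?H x - ?H y)"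
    unfolding ou_hess_def scaleR_diff_right[symmetric] norm_scaleR by simp
  also have "\<dots> \<le> 2 * ((\<integral>s. sing_bound s * (2 * (L * cubic_moment TYPE('d))) \<partial>unit_ival) * sqrt (norm (x - y)))"
    using **(2)[of x y] by (intro mult_left_mono) (simp_all add: norm_axis_1)
  finally show "norm (ou_hess i x - ou_hess i y) \<le> hess_const * sqrt (norm (x - y))"
    by (simp only: hess_const_def mult.assoc)
  show "integrable unit_ival (\<lambda>s. (s / (cosgn s)\<^sup>2) *\<^sub>R
     (\<integral>z. f (s *\<^sub>R x + cosgn s *\<^sub>R z) *\<^sub>R (z $ i *\<^sub>R z - axis i 1) \<partial>gauss))"
    using **(3) .
qed

text \<open>The averages of \<open>f\<close> are compared directly: the arguments differ by
  \<open>s *\<^sub>R (x - y)\<close>, and \<open>s\<close> cancels against \<open>1 / s\<close>. A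
  bound of \<open>ou_grad\<close> through \<open>gauss_average_bound\<close> would contain a
  Gaussian moment instead of the constant 2.\<close>

lemma ou_pot_lipschitz:
  assumes "(\<integral>x. f x \<partial>gauss) = 0"
  shows "\<bar>ou_pot x - ou_pot y\<bar> \<le> 2 * L * norm (x - y)"
proof -
  let ?A = "\<lambda>s x. (1 / s) * (\<integral>z. f (s *\<^sub>R x + cosgn s *\<^sub>R z) \<partial>gauss)"
  have "norm (\<integral>s. ?A s x - ?A s y \<partial>unit_ival) \<le> (\<integral>s. L * norm (x - y) \<partial>unit_ival)"
  proof (rule norm_integral_le)
    fix s assume "s \<in> space unit_ival"
    then have s: "0 < s" "s < 1" by auto
    have "norm (\<integral>z. f (s *\<^sub>R x + cosgn s *\<^sub>R z) - f (s *\<^sub>R y + cosgn s *\<^sub>R z) \<partial>gauss) \<le>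
      (\<integral>z. L * (s * norm (x - y)) \<partial>(gauss :: (real ^ 'd) measure))"
    proof (rule norm_integral_le)
      fix z show "norm (f (s *\<^sub>R x + cosgn s *\<^sub>R z) - f (s *\<^sub>R y + cosgn s *\<^sub>R z)) \<le> L * (s * norm (x - y))"
        using lip_abs[of "s *\<^sub>R x + cosgn s *\<^sub>R z" "s *\<^sub>R y + cosgn s *\<^sub>R z"] s
        by (simp flip: scaleR_diff_right)
    qed simp
    also have "\<dots> = L * (s * norm (x - y))" using gauss.prob_space[where 'd = 'd] by simp
    finally have "\<bar>(\<integral>z. f (s *\<^sub>R x + cosgn s *\<^sub>R z) \<partial>gauss) - (\<integral>z. f (s *\<^sub>R y + cosgn s *\<^sub>R z) \<partial>gauss)\<bar> \<le> L * (s * norm (x - y))"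
      by (simp add: integrable_plain)
    then show "norm (?A s x - ?A s y) \<le> L * norm (x - y)"
      using s by (simp add: abs_mult divide_simps mult_ac flip: right_diff_distrib diff_divide_distrib)
  qed simp
  also have "\<dots> = L * norm (x - y)"
    by (simp add: unit_ival_def measure_restrict_space space_restrict_space)
  finally have "norm (\<integral>s. ?A s x - ?A s y \<partial>unit_ival) \<le> L * norm (x - y)" .
  moreover have "ou_pot x - ou_pot y = - 2 * (\<integral>s. ?A s x - ?A s y \<partial>unit_ival)"
    unfolding ou_pot_def using Bochner_Integration.integral_diff[OF ou_pot_integrable[OF assms, of x] ou_pot_integrable[OF assms, of y]]
    by simp
  ultimately show ?thesis by (simp add: abs_mult)
qed

end

section \<open>The Poisson equation\<close>

text \<open>Dominated convergence along sequences. It is used for the derivative in the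
  interpolation parameter, where a pointwise majorant is at hand but no Hoelder bound.\<close>

lemma has_real_derivative_integral:
  fixes F :: "real \<Rightarrow> 'z \<Rightarrow> real"
  assumes \<delta>: "\<delta> > 0"
    and der: "\<And>t z. \<bar>t - s\<bar> < \<delta> \<Longrightarrow> z \<in> space M \<Longrightarrow> ((\<lambda>t. F t z) has_real_derivative F' t z) (at t)"
    and bound: "\<And>t z. \<bar>t - s\<bar> < \<delta> \<Longrightarrow> z \<in> space M \<Longrightarrow> \<bar>F' t z\<bar> \<le> B z"
    and intB: "integrable M B" and intF: "\<And>t. \<bar>t - s\<bar> < \<delta> \<Longrightarrow> integrable M (F t)"
    and [measurable]: "F' s \<in> borel_measurable M"
  shows "((\<lambda>t. \<integral>z. F t z \<partial>M) has_real_derivative (\<integral>z. F' s z \<partial>M)) (at s)"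
  unfolding has_field_derivative_iff tendsto_at_iff_sequentially comp_def
proof (intro allI impI)
  fix X :: "nat \<Rightarrow> real"
  assume X: "\<forall>i. X i \<in> UNIV - {s}" "X \<longlonglongrightarrow> s"
  then obtain N where N: "\<And>n. n \<ge> N \<Longrightarrow> \<bar>X n - s\<bar> < \<delta>"
    using LIMSEQ_D[OF X(2) \<delta>] by auto
  \<comment> \<open>Only a tail of the sequence lies in the neighbourhood where the bounds hold,
    hence the offset \<open>N\<close>.\<close>
  let ?q = "\<lambda>n z. (F (X (n + N)) z - F s z) / (X (n + N) - s)"
  have i: "integrable M (F s)" "integrable M (F (X (n + N)))" for n
    using intF[of s] intF[of "X (n + N)"] N[of "n + N"] \<delta> by auto
  have "(\<lambda>n. \<integral>z. ?q n z \<partial>M) \<longlonglongrightarrow> (\<integral>z. F' s z \<partial>M)"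
  proof (rule integral_dominated_convergence[where w = B])
    show "AE z in M. (\<lambda>n. ?q n z) \<longlonglongrightarrow> F' s z"
    proof (rule AE_I2)
      fix z assume z: "z \<in> space M"
      have "((\<lambda>t. (F t z - F s z) / (t - s)) \<longlongrightarrow> F' s z) (at s)"
        using der[of s z] z \<delta> by (simp add: has_field_derivative_iff)
      then have "(\<lambda>n. (F (X n) z - F s z) / (X n - s)) \<longlonglongrightarrow> F' s z"
        using X unfolding tendsto_at_iff_sequentially comp_def by auto
      then show "(\<lambda>n. ?q n z) \<longlonglongrightarrow> F' s z"
        using LIMSEQ_ignore_initial_segment by fastforce
    qed
    show "AE z in M. norm (?q n z) \<le> B z" for n
    proof (rule AE_I2)
      fix z assume z: "z \<in> space M"
      define t where "t = X (n + N)"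
      have t: "t \<noteq> s" "\<bar>t - s\<bar> < \<delta>" using X(1) N[of "n + N"] by (auto simp: t_def)
      have "norm (F t z - F s z) \<le> B z * norm (t - s)"
      proof (rule field_differentiable_bound[where S = "ball s \<delta>" and f = "\<lambda>t. F t z" and f' = "\<lambda>t. F' t z"])
        show "((\<lambda>t. F t z) has_field_derivative F' x z) (at x within ball s \<delta>)" if "x \<in> ball s \<delta>" for x
          by (rule has_field_derivative_at_within, rule der) (use that z in \<open>auto simp: dist_real_def\<close>)
        show "norm (F' x z) \<le> B z" if "x \<in> ball s \<delta>" for x
          using that z bound[of x z] by (auto simp: dist_real_def)
        show "convex (ball s \<delta>)" by (rule convex_ball)
        show "t \<in> ball s \<delta>" "s \<in> ball s \<delta>" using t \<delta> by (auto simp: dist_real_def)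
      qed
      then have "norm (F t z - F s z) / norm (t - s) \<le> B z"
        using t(1) by (subst pos_divide_le_eq) auto
      then show "norm (?q n z) \<le> B z" unfolding t_def by (simp only: norm_divide)
    qed
    show "(\<lambda>z. ?q n z) \<in> borel_measurable M" for n
      using i by measurable
  qed (use intB in measurable)
  moreover have "(\<integral>z. ?q n z \<partial>M) = ((\<integral>z. F (X (n + N)) z \<partial>M) - (\<integral>z. F s z \<partial>M)) / (X (n + N) - s)" for n
    using i by simp
  ultimately have "(\<lambda>n. ((\<integral>z. F (X (n + N)) z \<partial>M) - (\<integral>z. F s z \<partial>M)) / (X (n + N) - s)) \<longlonglongrightarrow> (\<integral>z. F' s z \<partial>M)"
    by (simp only:)
  then show "(\<lambda>n. ((\<integral>z. F (X n) z \<partial>M) - (\<integral>z. F s z \<partial>M)) / (X n - s)) \<longlonglongrightarrow> (\<integral>z. F' s z \<partial>M)"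
    by (rule LIMSEQ_offset)
qed

lemma cosgn_has_derivative:
  assumes "0 < t" "t < 1"
  shows "(cosgn has_real_derivative - t / cosgn t) (at t)"
proof -
  have "0 < 1 - t\<^sup>2" using assms by (simp add: power_less_one_iff)
  then show ?thesis unfolding cosgn_def[abs_def]
    by (auto intro!: derivative_eq_intros simp: divide_simps)
qed

context lipschitz_fun
begin

text \<open>Both the shift and the dilation of the argument of \<open>f\<close> are moved to the Gaussian weight,
  whose logarithm is differentiated.\<close>

lemma ou_average_has_derivative:
  assumes s: "0 < s" "s < 1"
  shows "((\<lambda>t. \<integral>z. f (t *\<^sub>R x + cosgn t *\<^sub>R z) \<partial>gauss) has_real_derivative
    (\<integral>z. f (s *\<^sub>R x + cosgn s *\<^sub>R z) * ((z \<bullet> x) / cosgn s - (s / (cosgn s)\<^sup>2) * (z \<bullet> z - real CARD('d))) \<partial>gauss)) (at s)"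
proof -
  define \<sigma> where "\<sigma> = cosgn s"
  define d where "d = real CARD('d)"
  \<comment> \<open>The argument at \<open>t\<close> is written with the noise scale of
    \<open>s\<close>: it equals \<open>s *\<^sub>R x + \<sigma> *\<^sub>R (c t *\<^sub>R x + r t
    *\<^sub>R z)\<close>. Thus \<open>c t *\<^sub>R x\<close> and \<open>r t\<close> are the
    parameters of \<open>gauss_weight\<close>, \<open>E\<close> is its logarithm and
    \<open>E'\<close> the derivative of \<open>E\<close> in \<open>t\<close>.\<close>
  define c where "c t = (t - s) / \<sigma>" for t
  define r where "r t = cosgn t / \<sigma>" for t
  define r' where "r' t = - t / cosgn t / \<sigma>" for t
  define N2 where "N2 t z = (z \<bullet> z - 2 * c t * (z \<bullet> x) + (c t)\<^sup>2 * (x \<bullet> x))" for t and z :: "real ^ 'd"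
  define E where "E t z = (z \<bullet> z) / 2 - N2 t z / (2 * (r t)\<^sup>2) - d * ln (r t)" for t z
  define E' where "E' t z = (z \<bullet> x - c t * (x \<bullet> x)) / (\<sigma> * (r t)\<^sup>2) + N2 t z * r' t / r t ^ 3 - d * r' t / r t" for t z
  define g where "g z = f (s *\<^sub>R x + \<sigma> *\<^sub>R z)" for z
  have \<sigma>: "0 < \<sigma>" using cosgn_bounds(1)[OF s] by (simp add: \<sigma>_def)
  have N2: "N2 t z = (norm (z - c t *\<^sub>R x))\<^sup>2" for t z
    unfolding power2_norm_eq_inner
    by (simp add: N2_def inner_diff_left inner_diff_right inner_commute power2_eq_square algebra_simps)
  have d0: "d \<ge> 0" by (simp add: d_def)
  have rs: "r s = 1" "c s = 0" using \<sigma> by (simp_all add: r_def c_def \<sigma>_def)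
  have [measurable]: "g \<in> borel_measurable borel" unfolding g_def by measurable
  have weight: "gauss_weight (c t *\<^sub>R x) (r t) z = exp (E t z)" if "r t > 0" for t z
  proof -
    have "exp (E t z) = exp ((z \<bullet> z) / 2 - N2 t z / (2 * (r t)\<^sup>2)) / exp (d * ln (r t))"
      unfolding E_def by (rule exp_diff)
    also have "exp (d * ln (r t)) = r t ^ CARD('d)"
      using that by (simp add: d_def exp_of_nat_mult)
    finally show ?thesis by (simp add: gauss_weight_def N2 power2_norm_eq_inner)
  qed
  have rep: "(\<lambda>z. f (t *\<^sub>R x + cosgn t *\<^sub>R z)) = (\<lambda>z. g (c t *\<^sub>R x + r t *\<^sub>R z))" for t
  proof (rule ext)
    fix z
    have "\<sigma> * c t = t - s" "\<sigma> * r t = cosgn t" using \<sigma> by (simp_all add: c_def r_def)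
    then have "s *\<^sub>R x + \<sigma> *\<^sub>R (c t *\<^sub>R x + r t *\<^sub>R z) = s *\<^sub>R x + ((t - s) *\<^sub>R x + cosgn t *\<^sub>R z)"
      by (simp only: scaleR_add_right scaleR_scaleR)
    also have "\<dots> = t *\<^sub>R x + cosgn t *\<^sub>R z" by (simp add: scaleR_left_diff_distrib)
    finally show "f (t *\<^sub>R x + cosgn t *\<^sub>R z) = g (c t *\<^sub>R x + r t *\<^sub>R z)"
      by (simp only: g_def)
  qed
  define K1 where "K1 = \<bar>r' s\<bar> + 1"
  have cont: "isCont cosgn s" by (rule DERIV_isCont[OF cosgn_has_derivative[OF s]])
  have cs: "cosgn s \<noteq> 0" using cosgn_bounds(1)[OF s] by simp
  have "isCont r s" unfolding r_def[abs_def] using \<sigma> by (intro continuous_intros cont) auto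
  moreover have "isCont r' s" unfolding r'_def[abs_def] using \<sigma> cs by (intro continuous_intros cont) auto
  moreover have "isCont c s" unfolding c_def[abs_def] using \<sigma> by (intro continuous_intros) auto
  ultimately have lims: "(r \<longlongrightarrow> 1) (nhds s)" "((\<lambda>t. (r t)\<^sup>2) \<longlongrightarrow> 1\<^sup>2) (nhds s)"
      "((\<lambda>t. \<bar>r' t\<bar>) \<longlongrightarrow> \<bar>r' s\<bar>) (nhds s)" "((\<lambda>t. \<bar>c t\<bar> * norm x) \<longlongrightarrow> \<bar>0\<bar> * norm x) (nhds s)"
    unfolding continuous_at_imp_continuous_within isCont_def rs(1)[symmetric] rs(2)[symmetric]
    by (auto simp: tendsto_nhds_iff intro!: tendsto_intros)
  \<comment> \<open>With \<open>(r t)\<^sup>2 < 9 / 8\<close> the weight grows at most like exp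
    (|z|^2 / 6), which leaves room for polynomial factors below the integrable exp (|z|^2 / 4);
    \<open>1 / 2 < r t\<close> bounds the inverse powers in \<open>E'\<close>.\<close>
  have "\<forall>\<^sub>F t in nhds s. 0 < t \<and> t < 1 \<and> 1 / 2 < r t \<and> (r t)\<^sup>2 < 9 / 8 \<and> \<bar>r' t\<bar> < K1 \<and> \<bar>c t\<bar> * norm x < 1"
    by (intro eventually_conj order_tendstoD(1)[OF lims(1)] order_tendstoD(2)[OF lims(2)]
        order_tendstoD(2)[OF lims(3)] order_tendstoD(2)[OF lims(4)]
        order_tendstoD(1)[OF filterlim_ident] order_tendstoD(2)[OF filterlim_ident]) (use s in \<open>auto simp: K1_def\<close>)
  then obtain \<delta> where \<delta>: "\<delta> > 0" and near: "\<And>t. \<bar>t - s\<bar> < \<delta> \<Longrightarrow>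
      0 < t \<and> t < 1 \<and> 1 / 2 < r t \<and> (r t)\<^sup>2 < 9 / 8 \<and> \<bar>r' t\<bar> < K1 \<and> \<bar>c t\<bar> * norm x < 1"
    unfolding eventually_nhds_metric dist_real_def by blast
  define KE where "KE = 4 * norm x / \<sigma> + 8 * K1 + 2 * d * K1"
  define KB where "KB = (\<bar>f 0\<bar> + L) * (1 + norm (s *\<^sub>R x) + \<bar>\<sigma>\<bar>) * KE * exp (4 / 3) * 2 ^ CARD('d)"
  have K1: "K1 \<ge> 0" by (simp add: K1_def)
  have KE: "KE \<ge> 0" unfolding KE_def using K1 d0 \<sigma> by (intro add_nonneg_nonneg) auto
  have KB: "KB \<ge> 0" unfolding KB_def using KE L_nonneg by (intro mult_nonneg_nonneg) auto
  have E'_bound: "\<bar>E' t z\<bar> \<le> KE * (1 + norm z)\<^sup>2" if "\<bar>t - s\<bar> < \<delta>" for t z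
  proof -
    note n = near[OF that]
    have r0: "r t > 0" using n by linarith
    have r2: "1 / 4 \<le> (r t)\<^sup>2" using n power_mono[of "1/2" "r t" 2] by (simp add: power2_eq_square)
    have r3: "1 / 8 \<le> (r t) ^ 3" using n power_mono[of "1/2" "r t" 3] by (simp add: power3_eq_cube)
    have nz: "1 \<le> 1 + norm z" by simp
    have sq: "1 + norm z \<le> (1 + norm z)\<^sup>2" using self_le_power[OF nz, of 2] by simp
    have "\<bar>c t * (x \<bullet> x)\<bar> = (\<bar>c t\<bar> * norm x) * norm x"
      by (simp add: abs_mult power2_norm_eq_inner[symmetric] power2_eq_square)
    also have "\<dots> \<le> 1 * norm x" using n by (intro mult_right_mono) auto
    finally have "\<bar>z \<bullet> x - c t * (x \<bullet> x)\<bar> \<le> norm x * (1 + norm z)"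
      using Cauchy_Schwarz_ineq2[of z x] by (simp add: algebra_simps)
    also have "\<dots> \<le> norm x * (1 + norm z)\<^sup>2" using sq by (intro mult_left_mono) auto
    finally have a0: "\<bar>z \<bullet> x - c t * (x \<bullet> x)\<bar> \<le> norm x * (1 + norm z)\<^sup>2" .
    have "\<bar>(z \<bullet> x - c t * (x \<bullet> x)) / (\<sigma> * (r t)\<^sup>2)\<bar> = \<bar>z \<bullet> x - c t * (x \<bullet> x)\<bar> / (\<sigma> * (r t)\<^sup>2)"
      using \<sigma> r0 by (simp add: abs_mult)
    also have "\<dots> \<le> (norm x * (1 + norm z)\<^sup>2) / (\<sigma> * (1 / 4))"
      using a0 r2 \<sigma> by (intro frac_le mult_left_mono) auto
    finally have a: "\<bar>(z \<bullet> x - c t * (x \<bullet> x)) / (\<sigma> * (r t)\<^sup>2)\<bar> \<le> 4 * norm x / \<sigma> * (1 + norm z)\<^sup>2"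
      by (simp add: mult_ac)
    have "norm (z - c t *\<^sub>R x) \<le> norm z + 1"
      using norm_triangle_ineq4[of z "c t *\<^sub>R x"] n by simp
    then have "N2 t z \<le> (1 + norm z)\<^sup>2" unfolding N2 by (intro power_mono) auto
    moreover have "0 \<le> N2 t z" by (simp add: N2)
    moreover have "\<bar>r' t / r t ^ 3\<bar> \<le> K1 / (1 / 8)"
      unfolding abs_divide using n r3 r0 by (intro frac_le) auto
    ultimately have b: "\<bar>N2 t z * (r' t / r t ^ 3)\<bar> \<le> (1 + norm z)\<^sup>2 * (8 * K1)"
      unfolding abs_mult by (intro mult_mono) auto
    have "\<bar>d * (r' t / r t)\<bar> \<le> d * (K1 / (1 / 2))"
      unfolding abs_mult abs_divide using n r0 d0 by (simp only: abs_of_nonneg[OF d0]) (intro mult_left_mono frac_le, auto)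
    also have "\<dots> = (2 * d * K1) * 1" by simp
    also have "\<dots> \<le> (2 * d * K1) * (1 + norm z)\<^sup>2"
      using d0 K1 sq nz by (intro mult_left_mono) auto
    finally have c': "\<bar>d * (r' t / r t)\<bar> \<le> (2 * d * K1) * (1 + norm z)\<^sup>2" .
    have tri: "\<bar>a + b - e\<bar> \<le> \<bar>a\<bar> + \<bar>b\<bar> + \<bar>e\<bar>" for a b e :: real by linarith
    have "\<bar>E' t z\<bar> \<le> \<bar>(z \<bullet> x - c t * (x \<bullet> x)) / (\<sigma> * (r t)\<^sup>2)\<bar> + \<bar>N2 t z * (r' t / r t ^ 3)\<bar> + \<bar>d * (r' t / r t)\<bar>"
      unfolding E'_def times_divide_eq_right by (rule tri)
    also have "\<dots> \<le> KE * (1 + norm z)\<^sup>2"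
      using a b c' by (simp add: KE_def algebra_simps)
    finally show ?thesis .
  qed
  have E_bound: "exp (E t z) \<le> exp (4 / 3) * 2 ^ CARD('d) * exp ((norm z)\<^sup>2 / 6)" if "\<bar>t - s\<bar> < \<delta>" for t z
  proof -
    note n = near[OF that]
    have r0: "r t > 0" using n by linarith
    have v: "norm (c t *\<^sub>R x) \<le> 1" using n by simp
    have "norm z \<le> norm (z - c t *\<^sub>R x) + 1"
      using norm_triangle_ineq[of "z - c t *\<^sub>R x" "c t *\<^sub>R x"] v by simp
    then have "(norm z)\<^sup>2 \<le> (norm (z - c t *\<^sub>R x) + 1)\<^sup>2" by (intro power_mono) auto
    also have "\<dots> \<le> 4 / 3 * N2 t z + 4"
    proof -
      \<comment> \<open>One third of this square is the difference of the two sides.\<close>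
      have "0 \<le> (norm (z - c t *\<^sub>R x) - 3)\<^sup>2" by simp
      then show ?thesis unfolding N2 by (simp add: power2_eq_square algebra_simps)
    qed
    finally have z: "(norm z)\<^sup>2 \<le> 4 / 3 * N2 t z + 4" .
    have "N2 t z / (9 / 4) \<le> N2 t z / (2 * (r t)\<^sup>2)"
      using n r0 by (intro divide_left_mono) (auto simp: N2)
    then have "(norm z)\<^sup>2 / 2 - N2 t z / (2 * (r t)\<^sup>2) \<le> 4 / 3 + (norm z)\<^sup>2 / 6"
      using z by (simp add: field_simps)
    moreover have "- (d * ln (r t)) \<le> d * ln 2"
    proof -
      have "- ln (r t) = ln (1 / r t)" using r0 by (simp add: ln_div)
      also have "\<dots> \<le> ln 2" using n r0 by (subst ln_le_cancel_iff) (auto simp: divide_simps)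
      finally show ?thesis using mult_left_mono[OF _ d0] by fastforce
    qed
    ultimately have "E t z \<le> 4 / 3 + d * ln 2 + (norm z)\<^sup>2 / 6"
      unfolding E_def power2_norm_eq_inner by linarith
    then have "exp (E t z) \<le> exp (4 / 3 + d * ln 2 + (norm z)\<^sup>2 / 6)" by simp
    also have "\<dots> = exp (4 / 3) * 2 ^ CARD('d) * exp ((norm z)\<^sup>2 / 6)"
      by (simp add: exp_add d_def exp_of_nat_mult)
    finally show ?thesis .
  qed
  define B where "B z = KB * ((1 + norm z) ^ 3 * exp ((norm z)\<^sup>2 / 6))" for z :: "real ^ 'd"
  have [measurable]: "B \<in> borel_measurable borel" unfolding B_def[abs_def] by measurable
  have "((\<lambda>t. \<integral>z. g z * exp (E t z) \<partial>gauss) has_real_derivative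
      (\<integral>z. g z * (exp (E s z) * E' s z) \<partial>gauss)) (at s)"
  proof (rule has_real_derivative_integral[OF \<delta>, where B = B])
    fix t and z :: "real ^ 'd" assume t: "\<bar>t - s\<bar> < \<delta>"
    note n = near[OF t]
    have r0: "r t > 0" using n by linarith
    have dr: "(r has_real_derivative r' t) (at t)"
      unfolding r_def[abs_def] r'_def using n \<sigma> by (auto intro!: derivative_eq_intros cosgn_has_derivative)
    have dc: "(c has_real_derivative 1 / \<sigma>) (at t)"
      unfolding c_def[abs_def] using \<sigma> by (auto intro!: derivative_eq_intros)
    have dN: "((\<lambda>t. N2 t z) has_real_derivative - 2 * (z \<bullet> x - c t * (x \<bullet> x)) / \<sigma>) (at t)"
      unfolding N2_def using \<sigma> by (auto intro!: derivative_eq_intros dc simp: field_simps)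
    have d1: "((\<lambda>t. N2 t z / (2 * (r t)\<^sup>2)) has_real_derivative
       - (z \<bullet> x - c t * (x \<bullet> x)) / (\<sigma> * (r t)\<^sup>2) - N2 t z * r' t / r t ^ 3) (at t)"
      using r0 \<sigma> by (auto intro!: derivative_eq_intros dN dr simp: field_simps power2_eq_square power3_eq_cube)
    have d2: "((\<lambda>t. d * ln (r t)) has_real_derivative d * r' t / r t) (at t)"
      using r0 by (auto intro!: derivative_eq_intros dr)
    have e: "0 - (- p / q - b) - e = p / q + b - e" for p q b e :: real by simp
    have "((\<lambda>t. E t z) has_real_derivative E' t z) (at t)"
      unfolding E_def E'_def
      by (rule DERIV_cong[OF DERIV_diff[OF DERIV_diff[OF DERIV_const d1] d2]]) (rule e)
    then show "((\<lambda>t. g z * exp (E t z)) has_real_derivative g z * (exp (E t z) * E' t z)) (at t)"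
      by (auto intro!: derivative_eq_intros)
    have "\<bar>g z * (exp (E t z) * E' t z)\<bar> \<le> ((\<bar>f 0\<bar> + L) * (1 + norm (s *\<^sub>R x) + \<bar>\<sigma>\<bar>) * (1 + norm z)) *
       ((exp (4 / 3) * 2 ^ CARD('d) * exp ((norm z)\<^sup>2 / 6)) * (KE * (1 + norm z)\<^sup>2))"
      unfolding abs_mult g_def
      using E_bound[OF t, of z] E'_bound[OF t, of z] growth[of "s *\<^sub>R x" \<sigma> z] L_nonneg
      by (intro mult_mono) auto
    also have "\<dots> = B z"
      by (simp add: B_def KB_def power2_eq_square power3_eq_cube mult_ac)
    finally show "\<bar>g z * (exp (E t z) * E' t z)\<bar> \<le> B z" .
  next
    show "integrable gauss B"
    proof (rule integrable_gauss_bound_sq)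
      fix z :: "real ^ 'd"
      \<comment> \<open>A twelfth of this square is the difference of the two sides, since 1/4 - 1/6
        = 1/12.\<close>
      have "0 \<le> (norm z - 18)\<^sup>2" by simp
      then have q: "3 * norm z + (norm z)\<^sup>2 / 6 \<le> 27 + (norm z)\<^sup>2 / 4"
        by (simp add: power2_eq_square algebra_simps)
      have "(1 + norm z) ^ 3 * exp ((norm z)\<^sup>2 / 6) \<le> exp (real 3 * norm z) * exp ((norm z)\<^sup>2 / 6)"
        by (intro mult_right_mono one_plus_power_le_exp) auto
      also have "\<dots> \<le> exp 27 * exp ((norm z)\<^sup>2 / 4)"
        using q by (simp flip: exp_add)
      finally show "norm (B z) \<le> (KB * exp 27) * exp ((norm z)\<^sup>2 / 4)"
        unfolding B_def using KB by (simp add: abs_mult mult.assoc mult_left_mono)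
    qed measurable
  next
    fix t assume t: "\<bar>t - s\<bar> < \<delta>"
    then have r0: "r t > 0" using near[OF t] by linarith
    have "integrable gauss (\<lambda>z. f (t *\<^sub>R x + cosgn t *\<^sub>R z))" by (rule integrable_plain)
    then show "integrable gauss (\<lambda>z. g z * exp (E t z))"
      unfolding rep using r0 by (subst (asm) integrable_gauss_affine) (auto simp: weight mult.commute)
  next
    show "(\<lambda>z. g z * (exp (E s z) * E' s z)) \<in> borel_measurable gauss"
      unfolding E_def E'_def N2_def by measurable
  qed
  then have D: "((\<lambda>t. \<integral>z. g z * exp (E t z) \<partial>gauss) has_real_derivative
      (\<integral>z. f (s *\<^sub>R x + cosgn s *\<^sub>R z) * ((z \<bullet> x) / cosgn s - (s / (cosgn s)\<^sup>2) * (z \<bullet> z - real CARD('d))) \<partial>gauss)) (at s)"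
  proof -
    have "E s z = 0" "E' s z = (z \<bullet> x) / cosgn s - (s / (cosgn s)\<^sup>2) * (z \<bullet> z - real CARD('d))" for z
      by (simp_all add: E_def E'_def N2_def rs r'_def \<sigma>_def d_def power2_eq_square algebra_simps diff_divide_distrib)
    then show ?thesis using \<open>((\<lambda>t. \<integral>z. g z * exp (E t z) \<partial>gauss) has_real_derivative _) (at s)\<close>
      by (simp add: g_def \<sigma>_def)
  qed
  show ?thesis
  proof (rule has_field_derivative_transform_within[OF D \<delta> UNIV_I])
    fix t assume "dist t s < \<delta>"
    then have t: "\<bar>t - s\<bar> < \<delta>" by (simp add: dist_real_def)
    then have r0: "r t > 0" using near[OF t] by linarith
    show "(\<integral>z. g z * exp (E t z) \<partial>gauss) = (\<integral>z. f (t *\<^sub>R x + cosgn t *\<^sub>R z) \<partial>gauss)"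
      unfolding rep using r0 by (subst gauss_affine) (auto simp: weight mult.commute)
  qed
qed

text \<open>The derivative is known only inside the unit interval, since \<open>cosgn\<close> is not
  differentiable at 1; the fundamental theorem needs continuity up to the end points.\<close>

lemma ou_average_continuous:
  "continuous_on {0..1} (\<lambda>t. \<integral>z. f (t *\<^sub>R x + cosgn t *\<^sub>R z) \<partial>gauss)"
  unfolding continuous_on_def
proof
  fix s :: real assume "s \<in> {0..1}"
  let ?m = "\<integral>z. norm z \<partial>(gauss :: (real ^ 'd) measure)"
  let ?Q = "\<lambda>t. \<integral>z. f (t *\<^sub>R x + cosgn t *\<^sub>R z) \<partial>gauss"
  define h where "h t = L * (\<bar>t - s\<bar> * norm x + \<bar>cosgn t - cosgn s\<bar> * ?m)" for t
  have bound: "norm (?Q t - ?Q s) \<le> h t" for t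
  proof -
    have "?Q t - ?Q s = (\<integral>z. f (t *\<^sub>R x + cosgn t *\<^sub>R z) - f (s *\<^sub>R x + cosgn s *\<^sub>R z) \<partial>gauss)"
      by (simp add: integrable_plain)
    moreover have "norm (\<integral>z. f (t *\<^sub>R x + cosgn t *\<^sub>R z) - f (s *\<^sub>R x + cosgn s *\<^sub>R z) \<partial>gauss) \<le>
        (\<integral>z. L * (\<bar>t - s\<bar> * norm x + \<bar>cosgn t - cosgn s\<bar> * norm z) \<partial>(gauss :: (real ^ 'd) measure))"
    proof (rule norm_integral_le)
      fix z
      have "(t *\<^sub>R x + cosgn t *\<^sub>R z) - (s *\<^sub>R x + cosgn s *\<^sub>R z) = (t - s) *\<^sub>R x + (cosgn t - cosgn s) *\<^sub>R z"
        by (simp add: algebra_simps)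
      then have "norm ((t *\<^sub>R x + cosgn t *\<^sub>R z) - (s *\<^sub>R x + cosgn s *\<^sub>R z)) \<le> \<bar>t - s\<bar> * norm x + \<bar>cosgn t - cosgn s\<bar> * norm z"
        using norm_triangle_ineq[of "(t - s) *\<^sub>R x" "(cosgn t - cosgn s) *\<^sub>R z"] by simp
      from mult_left_mono[OF this L_nonneg]
      show "norm (f (t *\<^sub>R x + cosgn t *\<^sub>R z) - f (s *\<^sub>R x + cosgn s *\<^sub>R z)) \<le> L * (\<bar>t - s\<bar> * norm x + \<bar>cosgn t - cosgn s\<bar> * norm z)"
        using lip_abs[of "t *\<^sub>R x + cosgn t *\<^sub>R z" "s *\<^sub>R x + cosgn s *\<^sub>R z"] by simp
    qed (use first_moment_le in simp)
    moreover have "(\<integral>z. \<bar>t - s\<bar> * norm x + \<bar>cosgn t - cosgn s\<bar> * norm z \<partial>(gauss :: (real ^ 'd) measure)) =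
        \<bar>t - s\<bar> * norm x + \<bar>cosgn t - cosgn s\<bar> * ?m"
      using first_moment_le(1) gauss.prob_space[where 'd = 'd] by simp
    ultimately show ?thesis by (simp add: h_def)
  qed
  have "continuous_on {0..1} cosgn" unfolding cosgn_def[abs_def] by (intro continuous_intros)
  then have "(cosgn \<longlongrightarrow> cosgn s) (at s within {0..1})" using \<open>s \<in> {0..1}\<close> by (simp add: continuous_on_def)
  then have "(h \<longlongrightarrow> L * (\<bar>s - s\<bar> * norm x + \<bar>cosgn s - cosgn s\<bar> * ?m)) (at s within {0..1})"
    unfolding h_def[abs_def] by (intro tendsto_intros)
  then have "(h \<longlongrightarrow> 0) (at s within {0..1})" by simp
  then have "((\<lambda>t. ?Q t - ?Q s) \<longlongrightarrow> 0) (at s within {0..1})"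
    by (rule Lim_null_comparison[rotated]) (use bound in simp)
  then show "(?Q \<longlongrightarrow> ?Q s) (at s within {0..1})" by (rule LIM_zero_cancel)
qed

text \<open>Up to the factor -2, the derivative of the average in \<open>s\<close> is the integrand
  of \<open>x \<bullet> ou_grad x\<close> minus that of the trace of the Hessian. Its integral over
  the unit interval is the difference of the end values: \<open>f x\<close> at 1, where the noise
  vanishes, and the Gaussian mean of \<open>f\<close>, which is 0, at 0.\<close>

lemma ou_poisson_equation:
  assumes f0: "(\<integral>x. f x \<partial>gauss) = 0"
  shows "(\<Sum>i\<in>UNIV. ou_hess i x $ i) / 2 - (x \<bullet> ou_grad x) / 2 = f x"
proof -
  let ?G = "\<lambda>s. (1 / cosgn s) *\<^sub>R (\<integral>z. f (s *\<^sub>R x + cosgn s *\<^sub>R z) *\<^sub>R z \<partial>gauss)"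
  let ?H = "\<lambda>i s. (s / (cosgn s)\<^sup>2) *\<^sub>R (\<integral>z. f (s *\<^sub>R x + cosgn s *\<^sub>R z) *\<^sub>R (z $ i *\<^sub>R z - axis i 1) \<partial>gauss)"
  let ?Q = "\<lambda>t. \<integral>z. f (t *\<^sub>R x + cosgn t *\<^sub>R z) \<partial>gauss"
  let ?Q' = "\<lambda>s. x \<bullet> ?G s - (\<Sum>i\<in>UNIV. ?H i s $ i)"
  have iH: "integrable gauss (\<lambda>z. f (y + \<sigma> *\<^sub>R z) *\<^sub>R (z $ i *\<^sub>R z - axis i 1))" for y \<sigma> i
    using integrable_daffine[of y \<sigma> 0 "axis i 1"] by (simp add: inner_axis')
  have der: "(?Q has_real_derivative ?Q' s) (at s)" if s: "0 < s" "s < 1" for s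
  proof -
    let ?F = "\<lambda>z. f (s *\<^sub>R x + cosgn s *\<^sub>R z)"
    have t: "(\<Sum>i\<in>UNIV. (z $ i *\<^sub>R z - axis i 1) $ i) = z \<bullet> z - real CARD('d)" for z :: "real ^ 'd"
      by (simp add: inner_vec_def sum_subtractf)
    have 1: "x \<bullet> ?G s = (\<integral>z. ?F z * ((z \<bullet> x) / cosgn s) \<partial>gauss)"
    proof -
      have "x \<bullet> ?G s = (1 / cosgn s) * (x \<bullet> (\<integral>z. ?F z *\<^sub>R z \<partial>gauss))" by simp
      also have "x \<bullet> (\<integral>z. ?F z *\<^sub>R z \<partial>gauss) = (\<integral>z. x \<bullet> (?F z *\<^sub>R z) \<partial>gauss)"
        using integrable_weighted_id by (intro integral_inner_right[symmetric]) auto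
      also have "(1 / cosgn s) * \<dots> = (\<integral>z. (1 / cosgn s) * (x \<bullet> (?F z *\<^sub>R z)) \<partial>gauss)" by simp
      finally show ?thesis by (simp add: inner_commute mult_ac)
    qed
    have "(\<Sum>i\<in>UNIV. ?H i s $ i) = (s / (cosgn s)\<^sup>2) * (\<Sum>i\<in>UNIV. (\<integral>z. ?F z *\<^sub>R (z $ i *\<^sub>R z - axis i 1) \<partial>gauss) $ i)"
      by (simp add: sum_distrib_left)
    also have "(\<Sum>i\<in>UNIV. (\<integral>z. ?F z *\<^sub>R (z $ i *\<^sub>R z - axis i 1) \<partial>gauss) $ i) =
        (\<Sum>i\<in>UNIV. (\<integral>z. (?F z *\<^sub>R (z $ i *\<^sub>R z - axis i 1)) $ i \<partial>gauss))"
      by (intro sum.cong refl integral_bounded_linear[symmetric, OF bounded_linear_vec_nth iH])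
    also have "\<dots> = (\<integral>z. (\<Sum>i\<in>UNIV. (?F z *\<^sub>R (z $ i *\<^sub>R z - axis i 1)) $ i) \<partial>gauss)"
      by (intro Bochner_Integration.integral_sum[symmetric] integrable_bounded_linear[OF bounded_linear_vec_nth iH])
    also have "\<dots> = (\<integral>z. ?F z * (z \<bullet> z - real CARD('d)) \<partial>gauss)"
      by (simp only: t[symmetric] vector_scaleR_component sum_distrib_left real_scaleR_def)
    finally have 2: "(\<Sum>i\<in>UNIV. ?H i s $ i) = (\<integral>z. (s / (cosgn s)\<^sup>2) * (?F z * (z \<bullet> z - real CARD('d))) \<partial>gauss)"
      by simp
    have i1: "integrable gauss (\<lambda>z. ?F z * ((z \<bullet> x) / cosgn s))"
      using integrable_affine[of "s *\<^sub>R x" "cosgn s" 0 "(1 / cosgn s) *\<^sub>R x"] by (simp add: inner_commute)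
    have i2: "integrable gauss (\<lambda>z. (s / (cosgn s)\<^sup>2) * (?F z * (z \<bullet> z - real CARD('d))))"
    proof (intro integrable_mult_right)
      have "integrable gauss (\<lambda>z. \<Sum>i\<in>UNIV. (?F z *\<^sub>R (z $ i *\<^sub>R z - axis i 1)) $ i)"
        by (intro Bochner_Integration.integrable_sum integrable_bounded_linear[OF bounded_linear_vec_nth iH])
      then show "integrable gauss (\<lambda>z. ?F z * (z \<bullet> z - real CARD('d)))"
        by (simp only: t[symmetric] vector_scaleR_component sum_distrib_left real_scaleR_def)
    qed
    have "?Q' s = (\<integral>z. ?F z * ((z \<bullet> x) / cosgn s) - (s / (cosgn s)\<^sup>2) * (?F z * (z \<bullet> z - real CARD('d))) \<partial>gauss)"
      unfolding 1 2 by (rule Bochner_Integration.integral_diff[OF i1 i2, symmetric])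
    also have "\<dots> = (\<integral>z. ?F z * ((z \<bullet> x) / cosgn s - (s / (cosgn s)\<^sup>2) * (z \<bullet> z - real CARD('d))) \<partial>gauss)"
      by (rule Bochner_Integration.integral_cong) (simp_all only: right_diff_distrib mult_ac)
    finally show ?thesis using ou_average_has_derivative[OF s, of x] by (simp only:)
  qed
  have "(?Q' has_integral ?Q 1 - ?Q 0) {0..1}"
    by (rule fundamental_theorem_of_calculus_interior[OF _ ou_average_continuous])
       (use der in \<open>auto simp: has_real_derivative_iff_has_vector_derivative\<close>)
  then have "(?Q' has_integral ?Q 1 - ?Q 0) {0<..<1}"
    by (simp add: has_integral_Icc_iff_Ioo)
  moreover have i: "integrable unit_ival ?Q'"
    by (intro Bochner_Integration.integrable_diff integrable_inner_right ou_grad_integrable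
        Bochner_Integration.integrable_sum integrable_bounded_linear[OF bounded_linear_vec_nth ou_hess_integrable])
  ultimately have int: "(\<integral>s. ?Q' s \<partial>unit_ival) = ?Q 1 - ?Q 0"
  proof -
    have "set_integrable lborel {0<..<1} ?Q'"
      using i by (simp add: unit_ival_def integrable_restrict_space set_integrable_def)
    from set_borel_integral_eq_integral(2)[OF this]
    have "(\<integral>s. ?Q' s \<partial>unit_ival) = integral {0<..<1} ?Q'"
      by (simp add: unit_ival_def integral_restrict_space set_lebesgue_integral_def)
    then show ?thesis using \<open>(?Q' has_integral ?Q 1 - ?Q 0) {0<..<1}\<close> by (simp only: integral_unique)
  qed
  have "?Q 1 = f x" "?Q 0 = 0"
    using f0 gauss.prob_space[where 'd = 'd] by (simp_all add: cosgn_def)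
  moreover have "(\<integral>s. ?Q' s \<partial>unit_ival) = x \<bullet> (\<integral>s. ?G s \<partial>unit_ival) - (\<Sum>i\<in>UNIV. (\<integral>s. ?H i s \<partial>unit_ival) $ i)"
  proof -
    have "(\<integral>s. ?Q' s \<partial>unit_ival) = (\<integral>s. x \<bullet> ?G s \<partial>unit_ival) - (\<integral>s. (\<Sum>i\<in>UNIV. ?H i s $ i) \<partial>unit_ival)"
      by (intro Bochner_Integration.integral_diff integrable_inner_right ou_grad_integrable
        Bochner_Integration.integrable_sum integrable_bounded_linear[OF bounded_linear_vec_nth ou_hess_integrable])
    also have "(\<integral>s. x \<bullet> ?G s \<partial>unit_ival) = x \<bullet> (\<integral>s. ?G s \<partial>unit_ival)"
      using ou_grad_integrable by (intro integral_inner_right) auto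
    also have "(\<integral>s. (\<Sum>i\<in>UNIV. ?H i s $ i) \<partial>unit_ival) = (\<Sum>i\<in>UNIV. (\<integral>s. ?H i s $ i \<partial>unit_ival))"
      by (intro Bochner_Integration.integral_sum integrable_bounded_linear[OF bounded_linear_vec_nth ou_hess_integrable])
    also have "\<dots> = (\<Sum>i\<in>UNIV. (\<integral>s. ?H i s \<partial>unit_ival) $ i)"
      by (intro sum.cong refl integral_bounded_linear[OF bounded_linear_vec_nth ou_hess_integrable])
    finally show ?thesis .
  qed
  moreover have "ou_grad x = - 2 *\<^sub>R (\<integral>s. ?G s \<partial>unit_ival)" by (rule ou_grad_def)
  moreover have "ou_hess i x = - 2 *\<^sub>R (\<integral>s. ?H i s \<partial>unit_ival)" for i by (rule ou_hess_def)
  ultimately show ?thesis using int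
    by (simp only: inner_scaleR_right vector_scaleR_component sum_distrib_left[symmetric] real_scaleR_def)
qed

definition ou_solution :: "real ^ 'd \<Rightarrow> real" where
  "ou_solution x = ou_pot x - (\<integral>y. ou_pot y \<partial>gauss)"

lemma ou_solution_lipschitz:
  assumes "(\<integral>x. f x \<partial>gauss) = 0"
  shows "\<bar>ou_solution x - ou_solution y\<bar> \<le> 2 * L * norm (x - y)"
  using ou_pot_lipschitz[OF assms, of x y] by (simp add: ou_solution_def)

lemma ou_solution_deriv:
  assumes "(\<integral>x. f x \<partial>gauss) = 0"
  shows "(ou_solution has_derivative (\<lambda>h. ou_grad x \<bullet> h)) (at x)"
  unfolding ou_solution_def[abs_def]
  using has_derivative_diff[OF ou_pot_deriv[OF assms, of x] has_derivative_const] by simp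

lemma partial_ou_solution:
  assumes "(\<integral>x. f x \<partial>gauss) = 0"
  shows "partial i ou_solution = (\<lambda>x. ou_grad x $ i)"
  using partial_eq[OF ou_solution_deriv[OF assms]] by auto

lemma grad_ou_solution:
  assumes "(\<integral>x. f x \<partial>gauss) = 0"
  shows "grad ou_solution = ou_grad"
  using grad_eq[OF ou_solution_deriv[OF assms]] by auto

lemma partial_ou_grad: "partial j (\<lambda>x. ou_grad x $ i) = (\<lambda>x. ou_hess i x $ j)"
  using partial_eq[OF ou_grad_nth_deriv] by auto

lemma ou_hess_continuous: "continuous_on UNIV (\<lambda>x. ou_hess i x)"
  unfolding continuous_on_def
proof
  fix y :: "real ^ 'd"
  have "((\<lambda>x. ou_hess i x - ou_hess i y) \<longlongrightarrow> 0) (at y)"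
  proof (rule Lim_null_comparison)
    show "\<forall>\<^sub>F x in at y. norm (ou_hess i x - ou_hess i y) \<le> hess_const * sqrt (norm (x - y))"
      using ou_hess_Hoelder by simp
    have "((\<lambda>x. hess_const * sqrt (norm (x - y))) \<longlongrightarrow> hess_const * sqrt (norm (y - y))) (at y)"
      by (intro tendsto_intros)
    then show "((\<lambda>x. hess_const * sqrt (norm (x - y))) \<longlongrightarrow> 0) (at y)" by simp
  qed
  then show "(ou_hess i \<longlongrightarrow> ou_hess i y) (at y within UNIV)" by (simp add: LIM_zero_cancel)
qed

lemma classical_ou_solution:
  assumes f0: "(\<integral>x. f x \<partial>gauss) = 0"
  shows "classical_poisson_solution f ou_solution"
  unfolding classical_poisson_solution_def
proof (intro conjI allI)
  show "Ck 2 ou_solution"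
    unfolding numeral_2_eq_2 Ck.simps partial_ou_solution[OF f0] partial_ou_grad
    using ou_solution_deriv[OF f0] ou_grad_nth_deriv ou_hess_continuous
    by (auto simp: differentiable_def intro!: continuous_on_component)
  show "laplacian ou_solution x / 2 - x \<bullet> grad ou_solution x / 2 = f x" for x
    using ou_poisson_equation[OF f0, of x]
    by (simp add: laplacian_def partial_ou_solution[OF f0] partial_ou_grad grad_ou_solution[OF f0])
  have lin: "\<bar>u x\<bar> \<le> (\<bar>u 0\<bar> + 2 * L) * (1 + norm x)"
    if "\<And>x y. \<bar>u x - u y\<bar> \<le> 2 * L * norm (x - y)" for u :: "real ^ 'd \<Rightarrow> real" and x
  proof -
    have "\<bar>u x\<bar> \<le> \<bar>u 0\<bar> + 2 * L * norm x" using that[of x 0] by simp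
    also have "\<dots> \<le> \<bar>u 0\<bar> + 2 * L * norm x + \<bar>u 0\<bar> * norm x + 2 * L" using L_nonneg by simp
    finally show ?thesis by (simp add: algebra_simps)
  qed
  show "\<exists>K. \<forall>x. \<bar>ou_solution x\<bar> \<le> K * (1 + norm x)"
    using lin[of ou_solution] ou_solution_lipschitz[OF f0] by blast
  have "continuous_on UNIV ou_pot"
    using ou_pot_deriv[OF f0] by (meson has_derivative_continuous continuous_at_imp_continuous_on)
  then have "ou_pot \<in> borel_measurable borel" by (rule borel_measurable_continuous_onI)
  then have "integrable gauss ou_pot"
    by (rule integrable_gauss_bound_poly[where k = 1]) (use lin[of ou_pot] ou_pot_lipschitz[OF f0] in simp)
  then show "(\<integral>x. ou_solution x \<partial>gauss) = 0"
    unfolding ou_solution_def using gauss.prob_space[where 'd = 'd] by simp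
qed

end

section \<open>Smooth functions\<close>

lemma Ck_SucD: "Ck (Suc k) u \<Longrightarrow> Ck k u"
proof (induction k arbitrary: u)
  case 0
  then show ?case
    by (auto intro!: continuous_at_imp_continuous_on differentiable_imp_continuous_within)
next
  case (Suc k)
  then show ?case by (metis Ck.simps(2))
qed

lemma Ck_continuous: "Ck k u \<Longrightarrow> continuous_on UNIV u"
  by (induction k) (use Ck_SucD in auto)

lemma Ck_measurable: "Ck k u \<Longrightarrow> u \<in> borel_measurable borel"
  by (rule borel_measurable_continuous_onI[OF Ck_continuous])

lemma partialI:
  assumes "(u has_derivative u') (at x)" shows "partial i u x = u' (axis i 1)"
  using frechet_derivative_at[OF assms] by (simp add: partial_def)

lemma partial_const [simp]: "partial i (\<lambda>_. c) = (\<lambda>_. 0)"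
  by (rule ext, subst partialI[OF has_derivative_const]) simp

lemma partial_add:
  assumes "u differentiable (at x)" "v differentiable (at x)"
  shows "partial i (\<lambda>x. u x + v x) x = partial i u x + partial i v x"
  using partialI[OF has_derivative_add[OF has_derivative_grad[OF assms(1)] has_derivative_grad[OF assms(2)]]]
  by (simp add: inner_axis grad_def)

lemma partial_mult:
  fixes u v :: "real ^ 'd::finite \<Rightarrow> real"
  assumes "u differentiable (at x)" "v differentiable (at x)"
  shows "partial i (\<lambda>x. u x * v x) x = u x * partial i v x + partial i u x * v x"
  using partialI[OF has_derivative_mult[OF has_derivative_grad[OF assms(1)] has_derivative_grad[OF assms(2)]]]
  by (simp add: inner_axis grad_def)

lemma partial_coord: "partial i (\<lambda>x :: real ^ 'd::finite. x $ j) = (\<lambda>x. if i = j then 1 else 0)"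
proof
  fix x :: "real ^ 'd"
  have "((\<lambda>x::real ^ 'd. x $ j) has_derivative (\<lambda>h. h $ j)) (at x)"
    by (rule bounded_linear.has_derivative[OF bounded_linear_vec_nth]) (rule has_derivative_ident)
  from partialI[OF this, of i] show "partial i (\<lambda>x::real ^ 'd. x $ j) x = (if i = j then 1 else 0)"
    by (simp add: axis_def)
qed

lemma partial_chain:
  fixes u :: "real ^ 'd::finite \<Rightarrow> real"
  assumes "(h has_real_derivative h') (at (u x))" "u differentiable (at x)"
  shows "partial i (\<lambda>x. h (u x)) x = h' * partial i u x"
proof -
  have "((\<lambda>x. h (u x)) has_derivative (\<lambda>k. h' * (grad u x \<bullet> k))) (at x)"
    using has_derivative_compose[OF has_derivative_grad[OF assms(2)] has_field_derivative_imp_has_derivative[OF assms(1)]]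
    by simp
  from partialI[OF this, of i] show ?thesis by (simp add: inner_axis grad_def)
qed

lemma Ck_const: "Ck k (\<lambda>_. c)"
  by (induction k arbitrary: c) auto

lemma Ck_add: "Ck k u \<Longrightarrow> Ck k v \<Longrightarrow> Ck k (\<lambda>x. u x + v x)"
proof (induction k arbitrary: u v)
  case (Suc k)
  then have "partial i (\<lambda>x. u x + v x) = (\<lambda>x. partial i u x + partial i v x)" for i
    by (auto simp: partial_add)
  with Suc show ?case by simp
qed (auto intro: continuous_intros)

lemma Ck_mult: "Ck k u \<Longrightarrow> Ck k v \<Longrightarrow> Ck k (\<lambda>x. u x * v x)"
proof (induction k arbitrary: u v)
  case (Suc k)
  have "partial i (\<lambda>x. u x * v x) = (\<lambda>x. u x * partial i v x + partial i u x * v x)" for i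
    using Suc.prems by (auto simp: partial_mult)
  moreover have "Ck k (\<lambda>x. u x * partial i v x + partial i u x * v x)" for i
    using Suc.prems Ck_SucD[OF Suc.prems(1)] Ck_SucD[OF Suc.prems(2)] by (intro Ck_add Suc.IH) auto
  ultimately show ?case using Suc.prems by simp
qed (auto intro: continuous_intros)

lemma Ck_coord: "Ck k (\<lambda>x :: real ^ 'd::finite. x $ j)"
proof (cases k)
  case 0
  then show ?thesis by (auto intro: continuous_intros)
next
  case (Suc l)
  have "(\<lambda>x. x $ j) differentiable (at x)" for x :: "real ^ 'd"
    by (rule bounded_linear_imp_differentiable[OF bounded_linear_vec_nth])
  then show ?thesis unfolding Suc by (simp add: partial_coord Ck_const)
qed

lemma Ck_sum: "finite A \<Longrightarrow> (\<And>a. a \<in> A \<Longrightarrow> Ck k (u a)) \<Longrightarrow> Ck k (\<lambda>x. \<Sum>a\<in>A. u a x)"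
  by (induction A rule: finite_induct) (auto intro: Ck_const Ck_add)

lemma Ck_prod: "finite A \<Longrightarrow> (\<And>a. a \<in> A \<Longrightarrow> Ck k (u a)) \<Longrightarrow> Ck k (\<lambda>x. \<Prod>a\<in>A. u a x)"
  by (induction A rule: finite_induct) (auto intro: Ck_const Ck_mult)

text \<open>A set of functions closed under differentiation encodes that \<open>h\<close> is smooth
  together with a description of all its derivatives; below it is \<open>{exp}\<close> or the range
  of \<open>flat\<close>.\<close>

lemma Ck_compose:
  fixes S :: "(real \<Rightarrow> real) set" and u :: "real ^ 'd::finite \<Rightarrow> real"
  assumes S: "\<And>h. h \<in> S \<Longrightarrow> \<exists>h'\<in>S. \<forall>x. (h has_real_derivative h' x) (at x)"
    and u: "\<And>k. Ck k u" and h: "h \<in> S"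
  shows "Ck k (\<lambda>x. h (u x))"
  using h
proof (induction k arbitrary: h)
  case 0
  then obtain h' where "\<And>x. (h has_real_derivative h' x) (at x)" using S by blast
  then have "continuous_on UNIV h"
    by (intro continuous_at_imp_continuous_on ballI) (rule DERIV_isCont)
  then show ?case using u[of 0] by (auto intro: continuous_on_compose2)
next
  case (Suc k)
  then obtain h' where h': "h' \<in> S" "\<And>x. (h has_real_derivative h' x) (at x)" using S by blast
  have u1: "u differentiable (at x)" for x using u[of 1] by simp
  have "(\<lambda>x. h (u x)) differentiable (at x)" for x
    using has_derivative_compose[OF has_derivative_grad[OF u1] has_field_derivative_imp_has_derivative[OF h'(2)]]
    by (auto simp: differentiable_def)
  moreover have "partial i (\<lambda>x. h (u x)) = (\<lambda>x. h' (u x) * partial i u x)" for i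
    using partial_chain[OF h'(2) u1] by auto
  moreover have "Ck k (\<lambda>x. h' (u x) * partial i u x)" for i
    using Suc.IH[OF h'(1)] u[of "Suc k"] by (intro Ck_mult) auto
  ultimately show ?case by simp
qed

definition smooth :: "(real ^ 'd::finite \<Rightarrow> real) \<Rightarrow> bool" where "smooth u \<longleftrightarrow> (\<forall>k. Ck k u)"

lemma smooth_partial: "smooth u \<Longrightarrow> smooth (partial i u)"
  unfolding smooth_def using Ck.simps(2) by blast

lemma smooth_differentiable: "smooth u \<Longrightarrow> u differentiable (at x)"
  unfolding smooth_def using Ck.simps(2)[of 0 u] by blast

lemma smooth_continuous: "smooth u \<Longrightarrow> continuous_on A u"
  unfolding smooth_def using Ck_continuous continuous_on_subset by blast

lemma smooth_measurable [measurable_dest]: "smooth u \<Longrightarrow> u \<in> borel_measurable borel"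
  unfolding smooth_def using Ck_measurable by blast

lemma smooth_const: "smooth (\<lambda>_. c)"
  unfolding smooth_def by (intro allI Ck_const)

lemma smooth_add: "smooth u \<Longrightarrow> smooth v \<Longrightarrow> smooth (\<lambda>x. u x + v x)"
  unfolding smooth_def by (intro allI) (rule Ck_add, erule spec, erule spec)

lemma smooth_mult: "smooth u \<Longrightarrow> smooth v \<Longrightarrow> smooth (\<lambda>x. u x * v x)"
  unfolding smooth_def by (intro allI) (rule Ck_mult, erule spec, erule spec)

lemma smooth_coord: "smooth (\<lambda>x. x $ j)"
  unfolding smooth_def by (intro allI Ck_coord)

lemma smooth_sum: "finite A \<Longrightarrow> (\<And>a. a \<in> A \<Longrightarrow> smooth (w a)) \<Longrightarrow> smooth (\<lambda>x. \<Sum>a\<in>A. w a x)"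
  unfolding smooth_def by (intro allI Ck_sum) blast+

lemma smooth_prod: "finite A \<Longrightarrow> (\<And>a. a \<in> A \<Longrightarrow> smooth (w a)) \<Longrightarrow> smooth (\<lambda>x. \<Prod>a\<in>A. w a x)"
  unfolding smooth_def by (intro allI Ck_prod) blast+

lemma smooth_exp: "smooth u \<Longrightarrow> smooth (\<lambda>x. exp (u x))"
  unfolding smooth_def
  by (intro allI, rule Ck_compose[where S = "{exp}" and h = exp]) (auto intro: DERIV_exp)

lemma smooth_norm_sq: "smooth (\<lambda>x :: real ^ 'd::finite. (norm x)\<^sup>2)"
proof -
  have eq: "(\<lambda>x :: real ^ 'd. (norm x)\<^sup>2) = (\<lambda>x. \<Sum>i\<in>UNIV. x $ i * x $ i)"
    by (simp add: fun_eq_iff power2_norm_eq_inner inner_vec_def)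
  show ?thesis unfolding eq by (intro smooth_sum smooth_mult smooth_coord finite)
qed

text \<open>The derivatives of \<open>exp (- 1 / x)\<close>, extended by 0, are again of this form.\<close>

definition flat :: "real poly \<Rightarrow> real \<Rightarrow> real" where
  "flat p x = (if x > 0 then poly p (1 / x) * exp (- (1 / x)) else 0)"

lemma poly_div_exp_at_top: "((\<lambda>y. poly p y * exp (- y)) \<longlongrightarrow> 0) at_top" for p :: "real poly"
proof -
  have "((\<lambda>y. \<Sum>i\<le>degree p. coeff p i * (y ^ i / exp y)) \<longlongrightarrow> (\<Sum>i\<le>degree p. coeff p i * 0)) at_top"
    by (intro tendsto_sum tendsto_mult_left tendsto_power_div_exp_0)
  then show ?thesis
    by (simp add: poly_altdef sum_distrib_right exp_minus divide_inverse mult.assoc)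
qed

lemma flat_tendsto_0: "(flat p \<longlongrightarrow> 0) (at 0)"
proof (rule filterlim_split_at)
  show "(flat p \<longlongrightarrow> 0) (at_left 0)"
  proof (rule tendsto_eventually)
    show "\<forall>\<^sub>F x in at_left 0. flat p x = 0"
      by (auto simp: eventually_at_filter flat_def)
  qed
  have "((\<lambda>x. poly p (1 / x) * exp (- (1 / x))) \<longlongrightarrow> 0) (at_right 0)"
    using filterlim_compose[OF poly_div_exp_at_top filterlim_inverse_at_top_right]
    by (simp add: divide_inverse)
  then show "(flat p \<longlongrightarrow> 0) (at_right 0)"
    by (rule Lim_transform_eventually) (auto simp: eventually_at_filter flat_def)
qed

text \<open>In terms of y = 1 / x the derivative with respect to x is - y^2 d/dy, which maps p(y)
  exp (- y) to y^2 (p - p')(y) exp (- y); the polynomial \<open>[:0, 0, 1:]\<close> is y^2.\<close>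

lemma flat_has_derivative:
  "(flat p has_real_derivative flat ([:0, 0, 1:] * (p - pderiv p)) x) (at x)"
proof -
  consider "x < 0" | "x = 0" | "x > 0" by linarith
  then show ?thesis
  proof cases
    case 1
    have "((\<lambda>_. 0) has_real_derivative 0) (at x)" by simp
    then have "(flat p has_real_derivative 0) (at x)"
      by (rule has_field_derivative_transform_within_open[where S = "{..<0}"]) (use 1 in \<open>auto simp: flat_def\<close>)
    then show ?thesis using 1 by (simp add: flat_def)
  next
    case 2
    \<comment> \<open>At 0 the difference quotient is again a flat function: division by
      \<open>h\<close> multiplies the polynomial by its variable.\<close>
    have "(\<lambda>h. (flat p (0 + h) - flat p 0) / h) \<midarrow>0\<rightarrow> 0"
    proof (rule Lim_transform_eventually[OF flat_tendsto_0[of "pCons 0 p"]])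
      show "\<forall>\<^sub>F h in at 0. flat (pCons 0 p) h = (flat p (0 + h) - flat p 0) / h"
        by (auto simp: eventually_at_filter flat_def)
    qed
    then show ?thesis using 2 by (simp add: DERIV_def flat_def)
  next
    case 3
    have "((\<lambda>x. poly p (1 / x) * exp (- (1 / x))) has_real_derivative
        flat ([:0, 0, 1:] * (p - pderiv p)) x) (at x)"
      using 3 by (auto intro!: derivative_eq_intros poly_DERIV[THEN DERIV_chain2]
          simp: flat_def field_simps power2_eq_square)
    then show ?thesis
      by (rule has_field_derivative_transform_within_open[where S = "{0<..}"]) (use 3 in \<open>auto simp: flat_def\<close>)
  qed
qed

lemma smooth_flat: "smooth u \<Longrightarrow> smooth (\<lambda>x. flat p (u x))"
  unfolding smooth_def
  by (intro allI, rule Ck_compose[where S = "range flat" and h = "flat p"]) (auto intro: flat_has_derivative)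

text \<open>Arguments up to 1 are those occurring in the cutoff functions. For negative ones
  \<open>flat\<close> vanishes, so compactness of the unit interval suffices.\<close>

lemma flat_bounded: "\<exists>B. \<forall>x\<le>1. \<bar>flat p x\<bar> \<le> B"
proof -
  have "continuous_on {0..1} (flat p)"
    by (intro continuous_at_imp_continuous_on ballI DERIV_isCont[OF flat_has_derivative])
  then have "bounded (flat p ` {0..1})"
    by (intro compact_imp_bounded compact_continuous_image) auto
  then obtain B where B: "\<And>x. x \<in> {0..1} \<Longrightarrow> \<bar>flat p x\<bar> \<le> B"
    unfolding bounded_iff by (metis image_eqI real_norm_def)
  have "\<bar>flat p x\<bar> \<le> B" if "x \<le> 1" for x
    using B[of x] B[of 0] that by (cases "x \<ge> 0") (auto simp: flat_def)
  then show ?thesis by blast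
qed

section \<open>Test functions and integration by parts\<close>

lemma test_functionI:
  assumes "smooth u" "\<And>x. norm x > R \<Longrightarrow> u x = 0" shows "test_function u"
proof -
  have "closure {x. u x \<noteq> 0} \<subseteq> cball 0 R"
    using assms(2) by (intro closure_minimal) (auto simp: not_less[symmetric])
  then have "compact (closure {x. u x \<noteq> 0})"
    by (meson bounded_cball bounded_subset compact_eq_bounded_closed closed_closure)
  with assms(1) show ?thesis by (simp add: test_function_def smooth_def)
qed

lemma test_functionE:
  assumes "test_function u"
  obtains R where "smooth u" "R > 0" "\<And>x. norm x > R \<Longrightarrow> u x = 0"
proof -
  have "bounded (closure {x. u x \<noteq> 0})"
    using assms by (auto simp: test_function_def compact_imp_bounded)
  then obtain R where "R > 0" "\<And>x. x \<in> closure {x. u x \<noteq> 0} \<Longrightarrow> norm x \<le> R"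
    by (auto simp: bounded_pos)
  then show thesis using that[of R] assms closure_subset[of "{x. u x \<noteq> 0}"]
    by (force simp: test_function_def smooth_def)
qed

lemma test_function_mult:
  assumes "test_function u" "smooth v" shows "test_function (\<lambda>x. u x * v x)"
  using assms(1)
proof (rule test_functionE)
  fix R assume "smooth u" "\<And>x. norm x > R \<Longrightarrow> u x = 0"
  then show ?thesis using assms(2) by (intro test_functionI[of _ R] smooth_mult) auto
qed

lemma partial_outside:
  assumes "\<And>x. norm x > R \<Longrightarrow> u x = 0" "norm x > R" shows "partial i u x = 0"
proof -
  have "((\<lambda>_. 0) has_derivative (\<lambda>_. 0)) (at x)" by simp
  moreover have "open {x. R < norm (x :: real ^ 'a)}" by (intro open_Collect_less continuous_intros)
  ultimately have "(u has_derivative (\<lambda>_. 0)) (at x)"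
    by (rule has_derivative_transform_within_open) (use assms in auto)
  from partialI[OF this, of i] show ?thesis .
qed

lemma test_function_partial:
  assumes "test_function u" shows "test_function (partial i u)"
  using assms
proof (rule test_functionE)
  fix R assume "smooth u" "\<And>x. norm x > R \<Longrightarrow> u x = 0"
  then show ?thesis by (intro test_functionI[of _ R] smooth_partial partial_outside) auto
qed

lemma test_function_smooth: "test_function u \<Longrightarrow> smooth u"
  by (auto elim: test_functionE)

lemma continuous_support_bound:
  fixes u :: "real ^ 'd::finite \<Rightarrow> real"
  assumes "continuous_on UNIV u" "\<And>x. norm x > R \<Longrightarrow> u x = 0"
  obtains B where "B \<ge> 0" "\<And>x. \<bar>u x\<bar> \<le> B * indicator (cball 0 R) x"
proof -
  have "bounded (u ` cball 0 R)"
    using assms(1) by (intro compact_imp_bounded compact_continuous_image) (auto intro: continuous_on_subset)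
  then obtain B where B: "\<And>x. x \<in> cball 0 R \<Longrightarrow> \<bar>u x\<bar> \<le> B"
    unfolding bounded_iff by (metis image_eqI real_norm_def)
  have "\<bar>u x\<bar> \<le> \<bar>B\<bar> * indicator (cball 0 R) x" for x
    using B[of x] assms(2)[of x] by (cases "x \<in> cball 0 R") (auto simp: indicator_def)
  then show thesis using that[of "\<bar>B\<bar>"] by simp
qed

lemma integrable_indicator_cball:
  "integrable lborel (\<lambda>x. B * indicator (cball (0::real ^ 'd::finite) R) x :: real)"
  using emeasure_lborel_cball_finite[of 0 R]
  by (intro integrable_mult_right integrable_real_indicator) auto

lemma integrable_continuous_support:
  fixes u :: "real ^ 'd::finite \<Rightarrow> real"
  assumes "continuous_on UNIV u" "\<And>x. norm x > R \<Longrightarrow> u x = 0"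
  shows "integrable lborel u"
proof -
  obtain B where "\<And>x. \<bar>u x\<bar> \<le> B * indicator (cball 0 R) x" "B \<ge> 0"
    using continuous_support_bound[OF assms] by blast
  then show ?thesis
    using borel_measurable_continuous_onI[OF assms(1)]
    by (intro Bochner_Integration.integrable_bound[OF integrable_indicator_cball[of B R]] AE_I2)
       (auto intro: order_trans[OF _ abs_ge_self])
qed

text \<open>Translation invariance makes the integrals of all difference quotients vanish.\<close>

lemma integral_partial_eq_0:
  fixes u :: "real ^ 'd::finite \<Rightarrow> real"
  assumes d: "\<And>x. u differentiable (at x)" and c: "continuous_on UNIV (partial i u)"
    and s: "\<And>x. norm x > R \<Longrightarrow> u x = 0"
  shows "(\<integral>x. partial i u x \<partial>lborel) = 0"
proof -
  have cu: "continuous_on UNIV u"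
    using d by (auto intro!: continuous_at_imp_continuous_on differentiable_imp_continuous_within)
  have [measurable]: "u \<in> borel_measurable borel" "partial i u \<in> borel_measurable borel"
    using cu c by (auto intro: borel_measurable_continuous_onI)
  obtain B where B: "\<And>x. \<bar>partial i u x\<bar> \<le> B * indicator (cball 0 R) x" "B \<ge> 0"
    by (rule continuous_support_bound[OF c, of R]) (use partial_outside[of R u _ i, OF s] in blast)+
  define e where "e n = inverse (real (Suc n))" for n
  have e: "e n > 0" "e n \<le> 1" for n by (auto simp: e_def divide_simps)
  have elim: "e \<longlonglongrightarrow> 0" unfolding e_def[abs_def] by (rule LIMSEQ_inverse_real_of_nat)
  let ?q = "\<lambda>n x. (u (e n *\<^sub>R axis i 1 + x) - u x) / e n"
  have "(\<lambda>n. \<integral>x. ?q n x \<partial>lborel) \<longlonglongrightarrow> (\<integral>x. partial i u x \<partial>lborel)"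
  \<comment> \<open>The steps \<open>e n\<close> are at most 1, so by the mean value theorem each
    quotient is a value of the partial derivative at distance at most 1 and vanishes outside the
    ball of radius \<open>R + 1\<close>.\<close>
  proof (rule integral_dominated_convergence[where w = "\<lambda>x. B * indicator (cball 0 (R + 1)) x"])
    show "AE x in lborel. (\<lambda>n. ?q n x) \<longlonglongrightarrow> partial i u x"
    proof (rule AE_I2)
      fix x
      have "((\<lambda>t. u (t *\<^sub>R axis i 1 + x)) has_derivative (\<lambda>k. grad u x \<bullet> (k *\<^sub>R axis i 1))) (at 0)"
        by (rule has_derivative_compose[where g = u])
           (use has_derivative_grad[OF d, of x] in \<open>auto intro!: derivative_eq_intros\<close>)
      then have "((\<lambda>t. u (t *\<^sub>R axis i 1 + x)) has_real_derivative partial i u x) (at 0)"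
        by (simp add: has_field_derivative_def inner_axis grad_def mult_commute_abs)
      then have "((\<lambda>h. (u (h *\<^sub>R axis i 1 + x) - u x) / h) \<longlongrightarrow> partial i u x) (at 0)"
        by (simp add: DERIV_def)
      then show "(\<lambda>n. ?q n x) \<longlonglongrightarrow> partial i u x"
        unfolding tendsto_at_iff_sequentially comp_def using elim
        by (elim allE[of _ e] impE) (use e(1) in \<open>auto simp: less_imp_neq[THEN not_sym]\<close>)
    qed
    show "AE x in lborel. norm (?q n x) \<le> B * indicator (cball 0 (R + 1)) x" for n
    proof (rule AE_I2)
      fix x :: "real ^ 'd"
      obtain t where t: "0 < t" "t < 1" "u (x + e n *\<^sub>R axis i 1) - u x = grad u (x + t *\<^sub>R (e n *\<^sub>R axis i 1)) \<bullet> (e n *\<^sub>R axis i 1)"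
        using gradient_mean_value[OF has_derivative_grad[OF d]] by blast
      define y where "y = x + t *\<^sub>R (e n *\<^sub>R axis i 1)"
      have "?q n x = partial i u y"
        using t(3) e(1)[of n] by (simp add: y_def inner_axis grad_def add.commute)
      moreover have "y \<in> cball 0 R \<Longrightarrow> x \<in> cball 0 (R + 1)"
      proof -
        assume "y \<in> cball 0 R"
        moreover have "norm (t *\<^sub>R (e n *\<^sub>R (axis i 1 :: real ^ 'd))) \<le> 1"
          using t e[of n] by (simp add: norm_axis_1 mult_le_one)
        moreover have "x = y - t *\<^sub>R (e n *\<^sub>R axis i 1)" by (simp add: y_def)
        ultimately show ?thesis
          using norm_triangle_ineq4[of y "t *\<^sub>R (e n *\<^sub>R axis i 1)"] by simp
      qed
      ultimately have q: "\<bar>?q n x\<bar> \<le> B * indicator (cball 0 R) y" and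
        i: "indicator (cball 0 R) y \<le> (indicator (cball 0 (R + 1)) x :: real)"
        using B(1)[of y] by (simp_all only: indicator_def split: if_split) auto
      show "norm (?q n x) \<le> B * indicator (cball 0 (R + 1)) x"
        using order_trans[OF q mult_left_mono[OF i B(2)]] by simp
    qed
  qed (use integrable_indicator_cball in auto)
  moreover have "(\<integral>x. ?q n x \<partial>lborel) = 0" for n
  proof -
    have iu: "integrable lborel u" by (rule integrable_continuous_support[OF cu s])
    have l: "lborel = distr lborel borel ((+) (e n *\<^sub>R axis i 1 :: real ^ 'd))"
      by (rule lborel_distr_plus[symmetric])
    have "integrable lborel (\<lambda>x. u (e n *\<^sub>R axis i 1 + x))"
      using iu by (subst (asm) l, subst (asm) integrable_distr_eq) auto
    moreover have "(\<integral>x. u (e n *\<^sub>R axis i 1 + x) \<partial>lborel) = (\<integral>x. u x \<partial>lborel)"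
      by (subst (2) l, subst integral_distr) auto
    ultimately show ?thesis using iu by simp
  qed
  ultimately have "(\<lambda>n :: nat. 0 :: real) \<longlonglongrightarrow> (\<integral>x. partial i u x \<partial>lborel)" by (simp only:)
  then show ?thesis by (simp add: LIMSEQ_const_iff)
qed

lemma Lp_loc_continuous:
  assumes "continuous_on UNIV u" "p > 0" shows "Lp_loc p u"
  unfolding Lp_loc_def
proof (intro conjI allI impI)
  show "u \<in> borel_measurable borel" using assms(1) by (rule borel_measurable_continuous_onI)
  fix K :: "(real ^ 'a) set" assume "compact K"
  then show "set_integrable lborel K (\<lambda>x. \<bar>u x\<bar> powr p)"
    using assms by (intro borel_integrable_compact[unfolded set_integrable_def[symmetric]] continuous_on_powr' continuous_intros)
      (auto intro: continuous_on_subset)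
qed

text \<open>The product with a test function has compact support, so the integral of its partial
  derivative vanishes; the product rule splits this into the two sides.\<close>

lemma weak_partial_Ck:
  assumes "Ck 1 u" shows "weak_partial i u (partial i u)"
  unfolding weak_partial_def
proof (intro conjI allI impI)
  have u: "\<And>x. u differentiable (at x)" "continuous_on UNIV u" "continuous_on UNIV (partial i u)"
    using assms Ck_continuous[OF assms] by auto
  then show "Lp_loc 1 u" "Lp_loc 1 (partial i u)" by (auto intro: Lp_loc_continuous)
  fix \<eta> :: "real ^ 'a \<Rightarrow> real" assume t: "test_function \<eta>"
  obtain R where R: "smooth \<eta>" "R > 0" "\<And>x. norm x > R \<Longrightarrow> \<eta> x = 0"
    using test_functionE[OF t] by blast
  have \<eta>: "\<And>x. \<eta> differentiable (at x)" "continuous_on UNIV \<eta>" "continuous_on UNIV (partial i \<eta>)"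
    using R(1) by (auto intro: smooth_differentiable smooth_continuous smooth_partial)
  have eq: "partial i (\<lambda>x. u x * \<eta> x) = (\<lambda>x. u x * partial i \<eta> x + partial i u x * \<eta> x)"
    using partial_mult[OF u(1) \<eta>(1)] by auto
  have "(\<integral>x. partial i (\<lambda>x. u x * \<eta> x) x \<partial>lborel) = 0"
    by (rule integral_partial_eq_0[where R = R])
       (use u \<eta> R(3) in \<open>auto simp: eq intro!: continuous_intros differentiable_mult\<close>)
  moreover have "integrable lborel (\<lambda>x. u x * partial i \<eta> x)"
    by (rule integrable_continuous_support[where R = R])
       (use u \<eta> R(3) partial_outside[of R \<eta>, OF R(3)] in \<open>auto intro!: continuous_intros\<close>)
  moreover have "integrable lborel (\<lambda>x. partial i u x * \<eta> x)"
    by (rule integrable_continuous_support[where R = R])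
       (use u \<eta> R(3) in \<open>auto intro!: continuous_intros\<close>)
  ultimately show "(\<integral>x. u x * partial i \<eta> x \<partial>lborel) = - (\<integral>x. partial i u x * \<eta> x \<partial>lborel)"
    by (simp add: eq)
qed

lemma W2_loc_derivs_Ck:
  assumes u: "Ck 2 u" and p: "p > 1"
  shows "W2_loc_derivs p u (\<lambda>i. partial i u) (\<lambda>i j. partial j (partial i u))"
proof -
  have u1: "Ck 1 u" "Ck 1 (partial i u)" "Ck 0 (partial j (partial i u))" for i j
    using u Ck_SucD[of 1 u] by (auto simp: numeral_2_eq_2)
  have "Lp_loc p u" "Lp_loc p (partial i u)" "Lp_loc p (partial j (partial i u))" for i j
    using p u1[THEN Ck_continuous] by (auto intro!: Lp_loc_continuous)
  then show ?thesis unfolding W2_loc_derivs_def using u1 by (auto intro: weak_partial_Ck)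
qed

lemma classical_imp_strong:
  assumes "classical_poisson_solution f u" "p > 1"
  shows "strong_poisson_solution p f u"
  unfolding strong_poisson_solution_def
proof (intro conjI exI)
  show "W2_loc_derivs p u (\<lambda>i. partial i u) (\<lambda>i j. partial j (partial i u))"
    using assms W2_loc_derivs_Ck by (auto simp: classical_poisson_solution_def)
  show "AE x in lborel. (\<Sum>i\<in>UNIV. partial i (partial i u) x) / 2 - (\<Sum>i\<in>UNIV. x $ i * partial i u x) / 2 = f x"
    using assms by (intro AE_I2) (auto simp: classical_poisson_solution_def laplacian_def grad_def inner_vec_def)
  have "\<exists>K. \<forall>x. \<bar>u x\<bar> \<le> K * (1 + norm x)" using assms by (simp add: classical_poisson_solution_def)
  then show "AE x in lborel. \<bar>u x\<bar> \<le> (SOME K. \<forall>x. \<bar>u x\<bar> \<le> K * (1 + norm x)) * (1 + norm x)"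
    by (intro AE_I2) (rule someI_ex[THEN spec])
  show "(\<integral>x. u x \<partial>gauss) = 0" using assms by (simp add: classical_poisson_solution_def)
qed

section \<open>Uniqueness\<close>

lemma partial_sub:
  fixes u v :: "real ^ 'd::finite \<Rightarrow> real"
  assumes "u differentiable (at x)" "v differentiable (at x)"
  shows "partial i (\<lambda>x. u x - v x) x = partial i u x - partial i v x"
  using partialI[OF has_derivative_diff[OF has_derivative_grad[OF assms(1)] has_derivative_grad[OF assms(2)]], of i]
  by (simp add: inner_axis grad_def)

lemma norm_gradient_le:
  fixes u :: "real ^ 'd::finite \<Rightarrow> real"
  assumes "\<And>x y. \<bar>u x - u y\<bar> \<le> M * norm (x - y)" and der: "(u has_derivative (\<lambda>h. D \<bullet> h)) (at x)"
  shows "norm D \<le> M"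
proof (cases "D = 0")
  case True
  \<comment> \<open>Two points at distance 1 show that \<open>M\<close> is nonnegative, which
    settles the case of a zero gradient.\<close>
  have "0 \<le> M * norm (axis undefined 1 - (0 :: real ^ 'd))" by (rule order_trans[OF abs_ge_zero assms(1)])
  then show ?thesis using True by (simp add: norm_axis_1)
next
  case False
  \<comment> \<open>In the direction of \<open>D\<close> itself the derivative is the squared norm
    of \<open>D\<close>, while the difference quotients are at most
    \<open>M * norm D\<close>.\<close>
  have "((\<lambda>t. u (x + t *\<^sub>R D)) has_derivative (\<lambda>k. D \<bullet> (k *\<^sub>R D))) (at 0)"
    by (rule has_derivative_compose[where g = u]) (use der in \<open>auto intro!: derivative_eq_intros\<close>)
  then have "((\<lambda>t. u (x + t *\<^sub>R D)) has_real_derivative D \<bullet> D) (at 0)"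
    by (simp add: has_field_derivative_def mult_commute_abs)
  then have "((\<lambda>h. (u (x + h *\<^sub>R D) - u x) / h) \<longlongrightarrow> D \<bullet> D) (at 0)"
    by (simp add: DERIV_def)
  moreover have "\<forall>\<^sub>F h in at 0. (u (x + h *\<^sub>R D) - u x) / h \<le> M * norm D"
  proof (rule eventually_at_filter[THEN iffD2, OF always_eventually], intro allI impI)
    fix h :: real assume h: "h \<noteq> 0"
    have "(u (x + h *\<^sub>R D) - u x) / h \<le> \<bar>u (x + h *\<^sub>R D) - u x\<bar> / \<bar>h\<bar>"
      using abs_ge_self[of "(u (x + h *\<^sub>R D) - u x) / h"] by (simp add: abs_divide)
    also have "\<dots> \<le> (M * (\<bar>h\<bar> * norm D)) / \<bar>h\<bar>"
      using assms(1)[of "x + h *\<^sub>R D" x] by (intro divide_right_mono) auto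
    finally show "(u (x + h *\<^sub>R D) - u x) / h \<le> M * norm D" using h by simp
  qed
  ultimately have "D \<bullet> D \<le> M * norm D" by (intro tendsto_upperbound) auto
  then show ?thesis using False by (simp add: power2_norm_eq_inner[symmetric] power2_eq_square)
qed

lemma integrable_Lp_loc_mult:
  assumes u: "Lp_loc 1 u" and g: "continuous_on UNIV g" "\<And>x. norm x > R \<Longrightarrow> g x = 0"
  shows "integrable lborel (\<lambda>x. u x * g x)"
proof -
  obtain B where B: "B \<ge> 0" "\<And>x. \<bar>g x\<bar> \<le> B * indicator (cball 0 R) x"
    using continuous_support_bound[OF g] by blast
  have m: "u \<in> borel_measurable borel" using u by (simp add: Lp_loc_def)
  have [measurable]: "g \<in> borel_measurable borel" using g(1) by (rule borel_measurable_continuous_onI)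
  have "set_integrable lborel (cball 0 R) (\<lambda>x. \<bar>u x\<bar> powr 1)"
    using u by (simp add: Lp_loc_def)
  then have "integrable lborel (\<lambda>x. B * (indicator (cball 0 R) x *\<^sub>R \<bar>u x\<bar>))"
    by (intro integrable_mult_right) (simp add: set_integrable_def)
  then show ?thesis
  proof (rule Bochner_Integration.integrable_bound)
    show "AE x in lborel. norm (u x * g x) \<le> norm (B * (indicator (cball 0 R) x *\<^sub>R \<bar>u x\<bar>))"
    proof (rule AE_I2)
      fix x
      have "norm (u x * g x) \<le> \<bar>u x\<bar> * (B * indicator (cball 0 R) x)"
        using mult_left_mono[OF B(2)[of x], of "\<bar>u x\<bar>"] by (simp add: abs_mult)
      also have "\<dots> = B * (indicator (cball 0 R) x *\<^sub>R \<bar>u x\<bar>)" by simp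
      also have "\<dots> \<le> norm \<dots>" by simp
      finally show "norm (u x * g x) \<le> norm (B * (indicator (cball 0 R) x *\<^sub>R \<bar>u x\<bar>))" .
    qed
  qed (use m in measurable)
qed

lemma integrable_Lp_loc_test:
  assumes "Lp_loc 1 u" "test_function \<eta>" shows "integrable lborel (\<lambda>x. u x * \<eta> x)"
  using assms(2)
proof (rule test_functionE)
  fix R assume "smooth \<eta>" "\<And>x. R < norm x \<Longrightarrow> \<eta> x = 0"
  then show ?thesis using assms(1) by (intro integrable_Lp_loc_mult[of u \<eta> R] smooth_continuous)
qed

text \<open>Integration by parts moves all derivatives to \<eta>, so that only \<psi> itself
  remains. Two solutions can then be subtracted whatever their weak derivatives are.\<close>

lemma strong_solution_weak_form:
  fixes f \<psi> \<eta> :: "real ^ 'd::finite \<Rightarrow> real"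
  assumes sol: "strong_poisson_solution p f \<psi>" and f: "f \<in> borel_measurable borel" and \<eta>: "test_function \<eta>"
  shows "integrable lborel (\<lambda>x. \<psi> x * (\<Sum>i\<in>UNIV. partial i (partial i \<eta>) x + partial i (\<lambda>x. \<eta> x * x $ i) x))"
    and "(\<integral>x. \<psi> x * (\<Sum>i\<in>UNIV. partial i (partial i \<eta>) x + partial i (\<lambda>x. \<eta> x * x $ i) x) \<partial>lborel) = 2 * (\<integral>x. f x * \<eta> x \<partial>lborel)"
proof -
  obtain D H where DH: "W2_loc_derivs p \<psi> D H"
    and ae: "AE x in lborel. (\<Sum>i\<in>UNIV. H i i x) / 2 - (\<Sum>i\<in>UNIV. x $ i * D i x) / 2 = f x"
    using sol by (auto simp: strong_poisson_solution_def)
  have w: "weak_partial i \<psi> (D i)" "weak_partial i (D i) (H i i)" for i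
    using DH by (auto simp: W2_loc_derivs_def)
  have l: "Lp_loc 1 \<psi>" "Lp_loc 1 (D i)" "Lp_loc 1 (H i i)" for i
    using w by (auto simp: weak_partial_def)
  have t: "test_function (partial i \<eta>)" "test_function (partial i (partial i \<eta>))"
    "test_function (\<lambda>x. \<eta> x * x $ i)" "test_function (partial i (\<lambda>x. \<eta> x * x $ i))" for i
    using test_function_partial[OF \<eta>] test_function_partial[OF test_function_partial[OF \<eta>]]
      test_function_mult[OF \<eta> smooth_coord] test_function_partial[OF test_function_mult[OF \<eta> smooth_coord]] by auto
  have 1: "(\<integral>x. H i i x * \<eta> x \<partial>lborel) = (\<integral>x. \<psi> x * partial i (partial i \<eta>) x \<partial>lborel)" for i
    using w[of i] \<eta> t[of i] by (auto simp: weak_partial_def)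
  have 2: "(\<integral>x. D i x * (\<eta> x * x $ i) \<partial>lborel) = - (\<integral>x. \<psi> x * partial i (\<lambda>x. \<eta> x * x $ i) x \<partial>lborel)" for i
    using w[of i] t[of i] by (auto simp: weak_partial_def)
  have i\<psi>: "integrable lborel (\<lambda>x. \<psi> x * partial i (partial i \<eta>) x)"
     "integrable lborel (\<lambda>x. \<psi> x * partial i (\<lambda>x. \<eta> x * x $ i) x)"
     "integrable lborel (\<lambda>x. H i i x * \<eta> x)" "integrable lborel (\<lambda>x. D i x * (\<eta> x * x $ i))" for i
    using t \<eta> l by (auto intro: integrable_Lp_loc_test)
  have eq: "\<psi> x * (\<Sum>i\<in>UNIV. partial i (partial i \<eta>) x + partial i (\<lambda>x. \<eta> x * x $ i) x) =
     (\<Sum>i\<in>UNIV. \<psi> x * partial i (partial i \<eta>) x + \<psi> x * partial i (\<lambda>x. \<eta> x * x $ i) x)" for x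
    by (simp add: sum_distrib_left distrib_left)
  show "integrable lborel (\<lambda>x. \<psi> x * (\<Sum>i\<in>UNIV. partial i (partial i \<eta>) x + partial i (\<lambda>x. \<eta> x * x $ i) x))"
    unfolding eq by (intro Bochner_Integration.integrable_sum Bochner_Integration.integrable_add i\<psi>)
  have "(\<integral>x. \<psi> x * (\<Sum>i\<in>UNIV. partial i (partial i \<eta>) x + partial i (\<lambda>x. \<eta> x * x $ i) x) \<partial>lborel) =
     (\<Sum>i\<in>UNIV. (\<integral>x. \<psi> x * partial i (partial i \<eta>) x \<partial>lborel) + (\<integral>x. \<psi> x * partial i (\<lambda>x. \<eta> x * x $ i) x \<partial>lborel))"
    unfolding eq by (simp add: i\<psi>)
  also have "\<dots> = (\<Sum>i\<in>UNIV. (\<integral>x. H i i x * \<eta> x \<partial>lborel) - (\<integral>x. D i x * (\<eta> x * x $ i) \<partial>lborel))"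
    by (simp add: 1 2)
  also have "\<dots> = (\<integral>x. (\<Sum>i\<in>UNIV. H i i x * \<eta> x - D i x * (\<eta> x * x $ i)) \<partial>lborel)"
    by (simp add: i\<psi>)
  also have "\<dots> = (\<integral>x. 2 * (f x * \<eta> x) \<partial>lborel)"
  proof (rule integral_cong_AE)
    show "AE x in lborel. (\<Sum>i\<in>UNIV. H i i x * \<eta> x - D i x * (\<eta> x * x $ i)) = 2 * (f x * \<eta> x)"
      using ae
    proof eventually_elim
      case (elim x)
      have "(\<Sum>i\<in>UNIV. H i i x * \<eta> x - D i x * (\<eta> x * x $ i)) = ((\<Sum>i\<in>UNIV. H i i x) - (\<Sum>i\<in>UNIV. x $ i * D i x)) * \<eta> x"
        unfolding left_diff_distrib sum_distrib_right sum_subtractf by (simp add: mult_ac)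
      also have "(\<Sum>i\<in>UNIV. H i i x) - (\<Sum>i\<in>UNIV. x $ i * D i x) = 2 * f x" using elim by linarith
      finally show ?case by simp
    qed
    have [measurable]: "H i i \<in> borel_measurable borel" "D i \<in> borel_measurable borel" for i
      using l by (auto simp: Lp_loc_def)
    have [measurable]: "\<eta> \<in> borel_measurable borel" using \<eta> by (intro smooth_measurable test_function_smooth)
    show "(\<lambda>x. \<Sum>i\<in>UNIV. H i i x * \<eta> x - D i x * (\<eta> x * x $ i)) \<in> borel_measurable lborel"
      by measurable
    show "(\<lambda>x. 2 * (f x * \<eta> x)) \<in> borel_measurable lborel" using f by measurable
  qed
  finally show "(\<integral>x. \<psi> x * (\<Sum>i\<in>UNIV. partial i (partial i \<eta>) x + partial i (\<lambda>x. \<eta> x * x $ i) x) \<partial>lborel) = 2 * (\<integral>x. f x * \<eta> x \<partial>lborel)"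
    by simp
qed

section \<open>The generator, its adjoint and cutoff functions\<close>

definition ou_op :: "(real ^ 'd::finite \<Rightarrow> real) \<Rightarrow> real ^ 'd \<Rightarrow> real" where
  "ou_op u x = laplacian u x / 2 - (x \<bullet> grad u x) / 2"

lemma ou_op_sum: "2 * ou_op u x = (\<Sum>i\<in>UNIV. partial i (partial i u) x - x $ i * partial i u x)"
  by (simp add: ou_op_def laplacian_def grad_def inner_vec_def sum_subtractf)

lemma smooth_gauss_density: "smooth (gauss_density :: real ^ 'd::finite \<Rightarrow> real)"
proof -
  have eq: "gauss_density = (\<lambda>z :: real ^ 'd. exp ((- 1 / 2) * (norm z)\<^sup>2) * (1 / (2 * pi) powr (real CARD('d) / 2)))"
    by (auto simp: gauss_density_def)
  show ?thesis unfolding eq by (intro smooth_mult smooth_exp smooth_const smooth_norm_sq)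
qed

lemma partial_norm_sq: "partial i (\<lambda>x. (norm x)\<^sup>2) x = 2 * x $ i"
proof -
  have "((\<lambda>x. (norm x)\<^sup>2) has_derivative (\<lambda>h. (2 *\<^sub>R x) \<bullet> h)) (at x)"
    unfolding power2_norm_eq_inner by (auto intro!: derivative_eq_intros simp: inner_commute)
  from partial_eq[OF this, of i] show ?thesis by simp
qed

lemma partial_gauss_density: "partial i gauss_density x = - x $ i * gauss_density x"
proof -
  let ?h = "\<lambda>t. exp (- t / 2) / (2 * pi) powr (real CARD('a) / 2)"
  have "(?h has_real_derivative - (1 / 2) * ?h ((norm x)\<^sup>2)) (at ((norm x)\<^sup>2))"
    by (auto intro!: derivative_eq_intros)
  from partial_chain[OF this smooth_differentiable[OF smooth_norm_sq], of i]
  show ?thesis by (simp add: gauss_density_def[abs_def] partial_norm_sq)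
qed

text \<open>Multiplication with the Gaussian density turns \<open>ou_op\<close> into the formal adjoint.\<close>

lemma adjoint_gauss_density:
  assumes u: "smooth u"
  shows "(\<Sum>i\<in>UNIV. partial i (partial i (\<lambda>x. u x * gauss_density x)) x + partial i (\<lambda>x. (u x * gauss_density x) * x $ i) x) =
    gauss_density x * (2 * ou_op u x)"
proof -
  let ?g = gauss_density
  have d: "partial i (\<lambda>x. u x * ?g x) = (\<lambda>x. (partial i u x - x $ i * u x) * ?g x)" for i
    by (rule ext, subst partial_mult)
       (auto intro!: smooth_differentiable u smooth_gauss_density simp: partial_gauss_density algebra_simps)
  have "partial i (partial i (\<lambda>x. u x * ?g x)) x + partial i (\<lambda>x. (u x * ?g x) * x $ i) x =
      ?g x * (partial i (partial i u) x - x $ i * partial i u x)" for i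
  proof -
    have s: "smooth (\<lambda>x. x $ i * u x)" "smooth (partial i u)" "smooth (\<lambda>x. - (x $ i * u x))"
      using u smooth_mult[OF smooth_const[of "- 1"] smooth_mult[OF smooth_coord u]]
      by (auto intro: smooth_mult smooth_coord smooth_partial)
    have s2: "smooth (\<lambda>x. partial i u x - x $ i * u x)"
      using smooth_add[OF s(2) s(3)] by simp
    have "partial i (partial i (\<lambda>x. u x * ?g x)) x =
       (partial i u x - x $ i * u x) * (- x $ i * ?g x) + partial i (\<lambda>x. partial i u x - x $ i * u x) x * ?g x"
      unfolding d by (subst partial_mult) (auto intro!: smooth_differentiable s2 smooth_gauss_density simp: partial_gauss_density)
    also have "partial i (\<lambda>x. partial i u x - x $ i * u x) x = partial i (partial i u) x - (x $ i * partial i u x + u x)"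
      by (subst partial_sub; (intro smooth_differentiable s)?)
         (subst partial_mult, auto intro!: smooth_differentiable u smooth_coord simp: partial_coord)
    finally have 1: "partial i (partial i (\<lambda>x. u x * ?g x)) x =
       (partial i u x - x $ i * u x) * (- x $ i * ?g x) + (partial i (partial i u) x - (x $ i * partial i u x + u x)) * ?g x" .
    have 2: "partial i (\<lambda>x. (u x * ?g x) * x $ i) x = u x * ?g x + (partial i u x - x $ i * u x) * ?g x * x $ i"
      by (subst partial_mult) (auto intro!: smooth_differentiable smooth_mult u smooth_gauss_density smooth_coord simp: partial_coord d)
    show ?thesis unfolding 1 2 by (simp add: algebra_simps)
  qed
  then show ?thesis by (simp add: ou_op_sum sum_distrib_left)
qed

text \<open>The weak form is tested with \<open>u\<close> times the Gaussian density, and the terms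
  with \<open>f\<close> cancel in the difference.\<close>

lemma strong_solution_difference:
  fixes f \<psi> \<phi> u :: "real ^ 'd::finite \<Rightarrow> real"
  assumes "strong_poisson_solution p f \<psi>" "strong_poisson_solution q f \<phi>"
    and "f \<in> borel_measurable borel" and u: "test_function u"
  shows "(\<integral>x. (\<psi> x - \<phi> x) * ou_op u x \<partial>gauss) = 0"
proof -
  let ?\<eta> = "\<lambda>x. u x * gauss_density x"
  have t: "test_function ?\<eta>" by (intro test_function_mult u smooth_gauss_density)
  note a = adjoint_gauss_density[OF test_function_smooth[OF u]]
  note w1 = strong_solution_weak_form[OF assms(1) assms(3) t, unfolded a]
  note w2 = strong_solution_weak_form[OF assms(2) assms(3) t, unfolded a]
  have [measurable]: "\<psi> \<in> borel_measurable borel" "\<phi> \<in> borel_measurable borel"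
    using assms(1,2) by (auto simp: strong_poisson_solution_def W2_loc_derivs_def Lp_loc_def)
  have s: "smooth (partial i u)" "smooth (partial i (partial i u))" for i
    using test_function_smooth[OF u] by (auto intro: smooth_partial)
  have [measurable]: "partial i u \<in> borel_measurable borel" "partial i (partial i u) \<in> borel_measurable borel" for i
    using s by (auto intro: smooth_measurable)
  have m: "(\<lambda>x. 2 * ou_op u x) \<in> borel_measurable borel" unfolding ou_op_sum by measurable
  have [measurable]: "ou_op u \<in> borel_measurable borel"
    using borel_measurable_times[OF borel_measurable_const[of "1 / 2"] m] by simp
  have "(\<integral>x. (\<psi> x - \<phi> x) * ou_op u x \<partial>gauss) = (\<integral>x. gauss_density x *\<^sub>R ((\<psi> x - \<phi> x) * ou_op u x) \<partial>lborel)"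
    by (rule integral_gauss) measurable
  also have "\<dots> = (\<integral>x. (1 / 2) * (\<psi> x * (gauss_density x * (2 * ou_op u x)) - \<phi> x * (gauss_density x * (2 * ou_op u x))) \<partial>lborel)"
    by (rule Bochner_Integration.integral_cong) (simp_all add: algebra_simps)
  also have "\<dots> = (1 / 2) * ((\<integral>x. \<psi> x * (gauss_density x * (2 * ou_op u x)) \<partial>lborel) - (\<integral>x. \<phi> x * (gauss_density x * (2 * ou_op u x)) \<partial>lborel))"
    by (subst Bochner_Integration.integral_diff[OF w1(1) w2(1), symmetric]) (rule integral_mult_right_zero)
  also have "\<dots> = 0" unfolding w1(2) w2(2) by simp
  finally show ?thesis .
qed

text \<open>The last sum is the carre du champ of the generator. With a cutoff as the first factor,
  all terms except \<open>u x * ou_op v x\<close> become small.\<close>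

lemma ou_op_mult:
  assumes u: "smooth u" and v: "smooth v"
  shows "ou_op (\<lambda>x. u x * v x) x = u x * ou_op v x + v x * ou_op u x + (\<Sum>i\<in>UNIV. partial i u x * partial i v x)"
proof -
  have d: "partial i (\<lambda>x. u x * v x) = (\<lambda>x. u x * partial i v x + partial i u x * v x)" for i
    using u v by (auto simp: partial_mult smooth_differentiable)
  have dd: "partial i (partial i (\<lambda>x. u x * v x)) x =
     u x * partial i (partial i v) x + 2 * (partial i u x * partial i v x) + v x * partial i (partial i u) x" for i
    unfolding d
    by (subst partial_add; (intro smooth_differentiable smooth_mult smooth_partial u v)?)
       (simp add: partial_mult smooth_differentiable smooth_partial u v)
  have "2 * ou_op (\<lambda>x. u x * v x) x = u x * (2 * ou_op v x) + v x * (2 * ou_op u x) + 2 * (\<Sum>i\<in>UNIV. partial i u x * partial i v x)"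
    unfolding ou_op_sum dd unfolding d sum_distrib_left sum.distrib[symmetric]
    by (rule sum.cong) (simp_all add: algebra_simps)
  then show ?thesis by simp
qed

text \<open>A smooth bump supported in the ball of radius \<open>sqrt (1 / \<epsilon>)\<close>; the
  factor \<open>exp 1\<close> normalizes its value at the origin to 1.\<close>

definition cutoff :: "real \<Rightarrow> real ^ 'd::finite \<Rightarrow> real" where
  "cutoff \<epsilon> x = exp 1 * flat 1 (1 - \<epsilon> * (norm x)\<^sup>2)"

lemma smooth_cutoff_arg: "smooth (\<lambda>x :: real ^ 'd::finite. 1 - \<epsilon> * (norm x)\<^sup>2)"
  using smooth_add[OF smooth_const[of 1] smooth_mult[OF smooth_const[of "- \<epsilon>"] smooth_norm_sq]] by simp

lemma partial_cutoff_arg: "partial i (\<lambda>x. 1 - \<epsilon> * (norm x)\<^sup>2) x = - 2 * \<epsilon> * x $ i"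
proof -
  have "((\<lambda>t. 1 - \<epsilon> * t) has_real_derivative - \<epsilon>) (at ((norm x)\<^sup>2))"
    by (auto intro!: derivative_eq_intros)
  from partial_chain[OF this smooth_differentiable[OF smooth_norm_sq], of i]
  show ?thesis by (simp add: partial_norm_sq)
qed

lemma test_function_cutoff:
  assumes "\<epsilon> > 0" shows "test_function (cutoff \<epsilon>)"
proof (rule test_functionI)
  show "smooth (cutoff \<epsilon>)" unfolding cutoff_def[abs_def]
    by (intro smooth_mult smooth_const smooth_flat smooth_cutoff_arg)
  fix x :: "real ^ 'a" assume "norm x > sqrt (1 / \<epsilon>)"
  then have "(sqrt (1 / \<epsilon>))\<^sup>2 < (norm x)\<^sup>2" using assms by (intro power_strict_mono) auto
  then have "1 / \<epsilon> < (norm x)\<^sup>2" using assms by simp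
  then show "cutoff \<epsilon> x = 0" using assms by (simp add: cutoff_def flat_def divide_simps mult.commute)
qed

text \<open>The inner function has partial derivatives \<open>- 2 * \<epsilon> * x $ i\<close>, so
  every derivative of the cutoff is of order \<epsilon>. The constant does not depend on \<epsilon>,
  and the quadratic growth in \<open>x\<close> is harmless under \<open>gauss\<close>.\<close>

lemma cutoff_derivative_bounds:
  obtains C where "\<And>\<epsilon> i (x :: real ^ 'd::finite). 0 < \<epsilon> \<Longrightarrow> \<epsilon> \<le> 1 \<Longrightarrow>
    \<bar>partial i (cutoff \<epsilon>) x\<bar> \<le> C * \<epsilon> * (1 + norm x)\<^sup>2 \<and> \<bar>ou_op (cutoff \<epsilon>) x\<bar> \<le> C * \<epsilon> * (1 + norm x)\<^sup>2 \<and>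
    \<bar>cutoff \<epsilon> x\<bar> \<le> C" "C \<ge> 0"
proof -
  define p1 where "p1 = [:0, 0, 1:] * ((1 :: real poly) - pderiv 1)"
  define p2 where "p2 = [:0, 0, 1:] * (p1 - pderiv p1)"
  obtain B0 where B0: "\<And>x. x \<le> 1 \<Longrightarrow> \<bar>flat 1 x\<bar> \<le> B0" using flat_bounded by blast
  obtain B1 where B1: "\<And>x. x \<le> 1 \<Longrightarrow> \<bar>flat p1 x\<bar> \<le> B1" using flat_bounded by blast
  obtain B2 where B2: "\<And>x. x \<le> 1 \<Longrightarrow> \<bar>flat p2 x\<bar> \<le> B2" using flat_bounded by blast
  define B where "B = \<bar>B0\<bar> + \<bar>B1\<bar> + \<bar>B2\<bar>"
  have B: "B \<ge> 0" "\<And>x. x \<le> 1 \<Longrightarrow> \<bar>flat 1 x\<bar> \<le> B" "\<And>x. x \<le> 1 \<Longrightarrow> \<bar>flat p1 x\<bar> \<le> B" "\<And>x. x \<le> 1 \<Longrightarrow> \<bar>flat p2 x\<bar> \<le> B"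
    unfolding B_def using B0 B1 B2 by fastforce+
  define E where "E = exp 1 * B"
  have E: "E \<ge> 0" using B by (simp add: E_def)
  \<comment> \<open>One summand each for the cutoff itself, for its partial derivatives and for the
    generator; 8 is 6 from a second derivative plus 2 from the drift.\<close>
  define C where "C = E + 2 * E + real CARD('d) * (8 * E)"
  show thesis
  proof (rule that[of C])
    show "C \<ge> 0" using E by (simp add: C_def)
    fix \<epsilon> :: real and i and x :: "real ^ 'd"
    assume \<epsilon>: "0 < \<epsilon>" "\<epsilon> \<le> 1"
    let ?q = "\<lambda>x :: real ^ 'd. 1 - \<epsilon> * (norm x)\<^sup>2"
    have q1: "?q x \<le> 1" for x using \<epsilon> by simp
    have sd: "?q differentiable (at x)" for x by (rule smooth_differentiable[OF smooth_cutoff_arg])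
    have pflat: "partial i (\<lambda>x. flat p (?q x)) x = flat ([:0, 0, 1:] * (p - pderiv p)) (?q x) * (- 2 * \<epsilon> * x $ i)" for p i x
      using partial_chain[OF flat_has_derivative sd, of i] by (simp only: partial_cutoff_arg)
    have sf: "smooth (\<lambda>x. flat p (?q x))" for p by (intro smooth_flat smooth_cutoff_arg)
    have d: "partial i (cutoff \<epsilon>) = (\<lambda>x. (- 2 * exp 1 * \<epsilon>) * (flat p1 (?q x) * x $ i))" for i
      unfolding cutoff_def[abs_def]
      by (rule ext, subst partial_mult) (auto intro!: smooth_differentiable smooth_const sf simp: pflat p1_def)
    have dd: "partial i (partial i (cutoff \<epsilon>)) x = (- 2 * exp 1 * \<epsilon>) * (flat p1 (?q x) + flat p2 (?q x) * (- 2 * \<epsilon> * x $ i) * x $ i)" for i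
    proof -
      have "partial i (\<lambda>x. flat p1 (?q x) * x $ i) x = flat p1 (?q x) + flat p2 (?q x) * (- 2 * \<epsilon> * x $ i) * x $ i"
        by (subst partial_mult) (auto intro!: smooth_differentiable sf smooth_coord simp: pflat[of _ p1, folded p2_def] partial_coord)
      then show ?thesis unfolding d
        by (subst partial_mult) (auto intro!: smooth_differentiable smooth_mult smooth_const sf smooth_coord)
    qed
    define n where "n = 1 + norm x"
    have n: "1 \<le> n" "norm x \<le> n" "n \<le> n\<^sup>2" "1 \<le> n\<^sup>2" by (auto simp: n_def power2_eq_square algebra_simps)
    have xi: "\<bar>x $ i\<bar> \<le> n" for i using component_le_norm_cart[of x i] n by linarith
    have xi2: "\<bar>x $ i * x $ i\<bar> \<le> n\<^sup>2" for i unfolding abs_mult power2_eq_square using xi n by (intro mult_mono) auto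
    have b1: "\<bar>partial i (cutoff \<epsilon>) x\<bar> \<le> 2 * E * \<epsilon> * n" for i
    proof -
      have "\<bar>partial i (cutoff \<epsilon>) x\<bar> = (2 * exp 1 * \<epsilon>) * (\<bar>flat p1 (?q x)\<bar> * \<bar>x $ i\<bar>)"
        unfolding d abs_mult using \<epsilon> by simp
      also have "\<dots> \<le> (2 * exp 1 * \<epsilon>) * (B * n)"
        using \<epsilon> B q1 xi by (intro mult_left_mono mult_mono) auto
      finally show ?thesis by (simp add: E_def mult_ac)
    qed
    have b2: "\<bar>partial i (partial i (cutoff \<epsilon>)) x\<bar> \<le> 6 * E * \<epsilon> * n\<^sup>2" for i
    proof -
      have "\<bar>flat p2 (?q x) * (- 2 * \<epsilon> * x $ i) * x $ i\<bar> = (\<bar>flat p2 (?q x)\<bar> * (2 * \<epsilon>)) * \<bar>x $ i * x $ i\<bar>"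
        using \<epsilon> by (simp add: abs_mult mult_ac)
      also have "\<dots> \<le> (B * 2) * n\<^sup>2"
        using \<epsilon> B q1 xi2 by (intro mult_mono) auto
      finally have "\<bar>flat p1 (?q x) + flat p2 (?q x) * (- 2 * \<epsilon> * x $ i) * x $ i\<bar> \<le> B + (B * 2) * n\<^sup>2"
        using B(3)[OF q1[of x]] by linarith
      also have "\<dots> \<le> 3 * B * n\<^sup>2" using mult_left_mono[OF n(4) B(1)] by simp
      finally have "(2 * exp 1 * \<epsilon>) * \<bar>flat p1 (?q x) + flat p2 (?q x) * (- 2 * \<epsilon> * x $ i) * x $ i\<bar> \<le> (2 * exp 1 * \<epsilon>) * (3 * B * n\<^sup>2)"
        using \<epsilon> by (intro mult_left_mono) auto
      then show ?thesis unfolding dd abs_mult[of "- 2 * exp 1 * \<epsilon>"] using \<epsilon> by (simp add: E_def mult_ac abs_mult)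
    qed
    have tm: "\<bar>partial i (partial i (cutoff \<epsilon>)) x - x $ i * partial i (cutoff \<epsilon>) x\<bar> \<le> 8 * E * \<epsilon> * n\<^sup>2" for i
    proof -
      have "\<bar>x $ i * partial i (cutoff \<epsilon>) x\<bar> \<le> n * (2 * E * \<epsilon> * n)"
        unfolding abs_mult using xi b1 n by (intro mult_mono) auto
      also have "\<dots> = 2 * E * \<epsilon> * n\<^sup>2" by (simp add: power2_eq_square)
      finally show ?thesis using b2[of i] by linarith
    qed
    have "\<bar>2 * ou_op (cutoff \<epsilon>) x\<bar> \<le> (\<Sum>i\<in>(UNIV :: 'd set). 8 * E * \<epsilon> * n\<^sup>2)"
      unfolding ou_op_sum by (rule order_trans[OF sum_abs sum_mono]) (rule tm)
    then have o: "\<bar>ou_op (cutoff \<epsilon>) x\<bar> \<le> (real CARD('d) * (8 * E)) * (\<epsilon> * n\<^sup>2)"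
      by (simp add: abs_mult mult_ac)
    have en: "0 \<le> \<epsilon> * n\<^sup>2" using \<epsilon> by simp
    have "(real CARD('d) * (8 * E)) * (\<epsilon> * n\<^sup>2) \<le> C * (\<epsilon> * n\<^sup>2)"
      using E by (intro mult_right_mono en) (simp add: C_def)
    moreover have "2 * E * \<epsilon> * n \<le> (2 * E) * (\<epsilon> * n\<^sup>2)"
      using E \<epsilon> n unfolding mult.assoc by (intro mult_left_mono) auto
    moreover have "(2 * E) * (\<epsilon> * n\<^sup>2) \<le> C * (\<epsilon> * n\<^sup>2)"
      using E by (intro mult_right_mono en) (simp add: C_def)
    moreover have "\<bar>cutoff \<epsilon> x\<bar> \<le> C"
    proof -
      have "\<bar>cutoff \<epsilon> x\<bar> \<le> E" unfolding cutoff_def E_def abs_mult using B(2)[OF q1] by simp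
      also have "E \<le> C" using E by (simp add: C_def)
      finally show ?thesis .
    qed
    ultimately show "\<bar>partial i (cutoff \<epsilon>) x\<bar> \<le> C * \<epsilon> * (1 + norm x)\<^sup>2 \<and> \<bar>ou_op (cutoff \<epsilon>) x\<bar> \<le> C * \<epsilon> * (1 + norm x)\<^sup>2 \<and>
      \<bar>cutoff \<epsilon> x\<bar> \<le> C"
      using b1[of i] o unfolding n_def[symmetric] mult.assoc by linarith
  qed
qed

lemma cutoff_tendsto:
  assumes "\<epsilon> \<longlonglongrightarrow> 0" shows "(\<lambda>n. cutoff (\<epsilon> n) x) \<longlonglongrightarrow> 1"
proof -
  have "isCont (flat 1) 1" by (rule DERIV_isCont[OF flat_has_derivative])
  then have "(\<lambda>n. exp 1 * flat 1 (1 - \<epsilon> n * (norm x)\<^sup>2)) \<longlonglongrightarrow> exp 1 * flat 1 (1 - 0 * (norm x)\<^sup>2)"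
    by (intro tendsto_mult_left isCont_tendsto_compose[of _ "flat 1"] tendsto_diff tendsto_const tendsto_mult_right assms) auto
  then show ?thesis by (simp add: cutoff_def flat_def flip: exp_add)
qed

text \<open>Potentials are not compactly supported, so orthogonality must be extended beyond test
  functions. Cutting off \<open>u\<close> turns its generator into
  \<open>cutoff (e n) x * ou_op u x\<close> plus a term of order \<open>e n\<close> with cubic
  growth, and dominated convergence applies because polynomials are integrable under
  \<open>gauss\<close>.\<close>

lemma ou_op_orthogonal_smooth:
  fixes w u :: "real ^ 'd::finite \<Rightarrow> real"
  assumes w[measurable]: "w \<in> borel_measurable borel" and wb: "AE x in gauss. \<bar>w x\<bar> \<le> K * (1 + norm x)"
    and orth: "\<And>u. test_function u \<Longrightarrow> (\<integral>x. w x * ou_op u x \<partial>gauss) = 0"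
    and u: "smooth u" and b: "\<And>x. \<bar>u x\<bar> \<le> A * (1 + norm x)" "\<And>i x. \<bar>partial i u x\<bar> \<le> A * (1 + norm x)"
      "\<And>x. \<bar>ou_op u x\<bar> \<le> A * (1 + norm x)"
  shows "(\<integral>x. w x * ou_op u x \<partial>gauss) = 0"
proof -
  define e where "e n = inverse (real (Suc n))" for n
  have e: "e n > 0" "e n \<le> 1" for n by (auto simp: e_def divide_simps)
  have elim: "e \<longlonglongrightarrow> 0" unfolding e_def[abs_def] by (rule LIMSEQ_inverse_real_of_nat)
  obtain C where C: "\<And>n i (x :: real ^ 'd). \<bar>partial i (cutoff (e n)) x\<bar> \<le> C * e n * (1 + norm x)\<^sup>2 \<and>
      \<bar>ou_op (cutoff (e n)) x\<bar> \<le> C * e n * (1 + norm x)\<^sup>2 \<and> \<bar>cutoff (e n) x\<bar> \<le> C" "C \<ge> 0"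
    using cutoff_derivative_bounds[where 'd = 'd] e by metis
  have A: "A \<ge> 0" using b(1)[of 0] by simp
  let ?u = "\<lambda>n x. cutoff (e n) x * u x"
  have su: "smooth (cutoff (e n) :: real ^ 'd \<Rightarrow> real)" for n by (intro test_function_smooth test_function_cutoff e)
  have t: "test_function (?u n)" for n by (intro test_function_mult test_function_cutoff u e)
  define r where "r n x = u x * ou_op (cutoff (e n)) x + (\<Sum>i\<in>UNIV. partial i (cutoff (e n)) x * partial i u x)" for n x
  have op: "ou_op (?u n) x = cutoff (e n) x * ou_op u x + r n x" for n x
    unfolding ou_op_mult[OF su u] r_def by simp
  define R where "R = A * C * (1 + real CARD('d))"
  have r: "\<bar>r n x\<bar> \<le> e n * (R * (1 + norm x) ^ 3)" for n x
  proof -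
    have "\<bar>u x * ou_op (cutoff (e n)) x\<bar> \<le> (A * (1 + norm x)) * (C * e n * (1 + norm x)\<^sup>2)"
      unfolding abs_mult using b(1) C(1)[of _ n x] A by (intro mult_mono) auto
    moreover have "\<bar>\<Sum>i\<in>UNIV. partial i (cutoff (e n)) x * partial i u x\<bar> \<le> (\<Sum>i\<in>(UNIV :: 'd set). (C * e n * (1 + norm x)\<^sup>2) * (A * (1 + norm x)))"
    proof (rule order_trans[OF sum_abs sum_mono])
      fix i show "\<bar>partial i (cutoff (e n)) x * partial i u x\<bar> \<le> (C * e n * (1 + norm x)\<^sup>2) * (A * (1 + norm x))"
        unfolding abs_mult using b(2)[of i x] C(1)[of i n x] C(2) e(1)[of n] by (intro mult_mono) auto
    qed
    ultimately have "\<bar>r n x\<bar> \<le> (A * (1 + norm x)) * (C * e n * (1 + norm x)\<^sup>2) + (\<Sum>i\<in>(UNIV :: 'd set). (C * e n * (1 + norm x)\<^sup>2) * (A * (1 + norm x)))"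
      unfolding r_def by linarith
    also have "\<dots> = e n * (R * (1 + norm x) ^ 3)"
      by (simp add: R_def power2_eq_square power3_eq_cube algebra_simps)
    finally show ?thesis .
  qed
  have R: "R \<ge> 0" using A C(2) by (simp add: R_def)
  define B where "B x = (C * A + R) * (1 + norm x) ^ 3" for x :: "real ^ 'd"
  have opB: "\<bar>ou_op (?u n) x\<bar> \<le> B x" for n x
  proof -
    have "\<bar>cutoff (e n) x * ou_op u x\<bar> \<le> C * (A * (1 + norm x))"
      unfolding abs_mult using b(3) C(1)[of _ n x] C(2) by (intro mult_mono) auto
    also have "\<dots> \<le> C * (A * (1 + norm x) ^ 3)"
      using C(2) A self_le_power[of "1 + norm x" 3] by (intro mult_left_mono) auto
    finally have "\<bar>cutoff (e n) x * ou_op u x\<bar> \<le> C * (A * (1 + norm x) ^ 3)" .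
    moreover have "e n * (R * (1 + norm x) ^ 3) \<le> 1 * (R * (1 + norm x) ^ 3)"
      using e R by (intro mult_right_mono) auto
    ultimately show ?thesis unfolding op B_def using r[of n x] by (simp add: distrib_right mult.assoc)
  qed
  have meas: "ou_op v \<in> borel_measurable borel" if v: "smooth v" for v :: "real ^ 'd \<Rightarrow> real"
  proof -
    have [measurable]: "partial i v \<in> borel_measurable borel" "partial i (partial i v) \<in> borel_measurable borel" for i
      using v by (auto intro: smooth_measurable smooth_partial)
    have m: "(\<lambda>x. 2 * ou_op v x) \<in> borel_measurable borel" unfolding ou_op_sum by measurable
    show ?thesis using borel_measurable_times[OF borel_measurable_const[of "1 / 2"] m] by simp
  qed
  have [measurable]: "ou_op u \<in> borel_measurable borel" "ou_op (?u n) \<in> borel_measurable borel" for n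
    using meas u test_function_smooth[OF t] by auto
  have "(\<lambda>n. \<integral>x. w x * ou_op (?u n) x \<partial>gauss) \<longlonglongrightarrow> (\<integral>x. w x * ou_op u x \<partial>gauss)"
  proof (rule integral_dominated_convergence[where w = "\<lambda>x. \<bar>K\<bar> * (1 + norm x) * B x"])
    show "integrable gauss (\<lambda>x. \<bar>K\<bar> * (1 + norm x) * B x)"
      by (rule integrable_gauss_bound_poly[where C = "\<bar>K\<bar> * (C * A + R)" and k = 4])
         (use R A C(2) in \<open>simp_all add: B_def abs_mult power_numeral_reduce mult_ac\<close>)
    show "AE x in gauss. (\<lambda>n. w x * ou_op (?u n) x) \<longlonglongrightarrow> w x * ou_op u x"
    proof (rule AE_I2)
      fix x :: "real ^ 'd"
      have "(\<lambda>n. e n * (R * (1 + norm x) ^ 3)) \<longlonglongrightarrow> 0 * (R * (1 + norm x) ^ 3)"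
        by (intro tendsto_mult_right elim)
      then have "(\<lambda>n. e n * (R * (1 + norm x) ^ 3)) \<longlonglongrightarrow> 0" by simp
      then have "(\<lambda>n. r n x) \<longlonglongrightarrow> 0"
        by (rule Lim_null_comparison[rotated]) (use r in simp)
      then have "(\<lambda>n. w x * (cutoff (e n) x * ou_op u x + r n x)) \<longlonglongrightarrow> w x * (1 * ou_op u x + 0)"
        by (intro tendsto_intros cutoff_tendsto elim)
      then show "(\<lambda>n. w x * ou_op (?u n) x) \<longlonglongrightarrow> w x * ou_op u x" by (simp add: op)
    qed
    fix n
    show "AE x in gauss. norm (w x * ou_op (?u n) x) \<le> \<bar>K\<bar> * (1 + norm x) * B x"
      using wb
    proof eventually_elim
      case (elim x)
      have "\<bar>w x\<bar> \<le> \<bar>K\<bar> * (1 + norm x)" by (rule order_trans[OF elim]) (simp add: mult_right_mono)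
      then show ?case unfolding real_norm_def abs_mult using opB[of n x] by (intro mult_mono) auto
    qed
  qed measurable
  then have "(\<lambda>n :: nat. 0 :: real) \<longlonglongrightarrow> (\<integral>x. w x * ou_op u x \<partial>gauss)"
    by (simp only: orth[OF t])
  then show ?thesis by (simp add: LIMSEQ_const_iff)
qed

section \<open>Uniform bounds for test functions and smoothness of their potentials\<close>

lemma test_function_bounded:
  assumes "test_function u" obtains B where "B \<ge> 0" "\<And>x. \<bar>u x\<bar> \<le> B"
proof (rule test_functionE[OF assms])
  fix R assume R: "smooth u" "\<And>x. R < norm x \<Longrightarrow> u x = 0"
  obtain B where B: "B \<ge> 0" "\<And>x. \<bar>u x\<bar> \<le> B * indicator (cball 0 R) x"
    using continuous_support_bound[OF smooth_continuous[OF R(1)] R(2)] by blast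
  have "B * indicator (cball 0 R) x \<le> B" for x using B(1) by (auto simp: indicator_def)
  then show thesis using that[OF B(1)] B(2) order_trans by blast
qed

lemma test_function_gradient_bounded:
  fixes u :: "real ^ 'd::finite \<Rightarrow> real"
  assumes "test_function u" obtains B where "B \<ge> 0" "\<And>x. norm (grad u x) \<le> B"
proof -
  have "\<forall>i. \<exists>B. 0 \<le> B \<and> (\<forall>x. \<bar>partial i u x\<bar> \<le> B)"
    using test_function_bounded[OF test_function_partial[OF assms]] by blast
  from choice[OF this] obtain B where B: "\<And>i. B i \<ge> 0" "\<And>i x. \<bar>partial i u x\<bar> \<le> B i" by blast
  have "norm (grad u x) \<le> (\<Sum>i\<in>UNIV. B i)" for x
    by (rule order_trans[OF norm_le_l1_cart sum_mono]) (use B(2) in \<open>simp add: grad_def\<close>)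
  then show thesis using that[of "\<Sum>i\<in>UNIV. B i"] B(1) by (simp add: sum_nonneg)
qed

lemma test_function_lipschitz:
  fixes u :: "real ^ 'd::finite \<Rightarrow> real"
  assumes "test_function u" obtains L where "L \<ge> 0" "\<And>x y. \<bar>u x - u y\<bar> \<le> L * norm (x - y)"
proof -
  obtain B where B: "B \<ge> 0" "\<And>x. norm (grad u x) \<le> B"
    using test_function_gradient_bounded[OF assms] by blast
  have "\<bar>u x - u y\<bar> \<le> B * norm (x - y)" for x y
  proof -
    obtain t where "u (y + (x - y)) - u y = grad u (y + t *\<^sub>R (x - y)) \<bullet> (x - y)"
      using gradient_mean_value[OF has_derivative_grad[OF smooth_differentiable[OF test_function_smooth[OF assms]]]] by blast
    then have "\<bar>u x - u y\<bar> \<le> norm (grad u (y + t *\<^sub>R (x - y))) * norm (x - y)"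
      using Cauchy_Schwarz_ineq2[of "grad u (y + t *\<^sub>R (x - y))" "x - y"] by simp
    also have "\<dots> \<le> B * norm (x - y)" using B by (intro mult_right_mono) auto
    finally show ?thesis .
  qed
  then show thesis using that B(1) by blast
qed

text \<open>A partial derivative of a test function is bounded and Lipschitz; the geometric mean of
  the two bounds has the form required by \<open>has_derivative_param_integral\<close>.\<close>

lemma test_function_gradient_Hoelder:
  fixes u :: "real ^ 'd::finite \<Rightarrow> real"
  assumes "test_function u" obtains k where "k \<ge> 0" "\<And>x y. norm (grad u x - grad u y) \<le> k * sqrt (norm (x - y))"
proof -
  have "\<forall>i. \<exists>k. 0 \<le> k \<and> (\<forall>x y. \<bar>partial i u x - partial i u y\<bar> \<le> k * sqrt (norm (x - y)))"
  proof
    fix i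
    obtain B where B: "B \<ge> 0" "\<And>x. \<bar>partial i u x\<bar> \<le> B"
      using test_function_bounded[OF test_function_partial[OF assms, of i]] by blast
    obtain L where L: "L \<ge> 0" "\<And>x y. \<bar>partial i u x - partial i u y\<bar> \<le> L * norm (x - y)"
      using test_function_lipschitz[OF test_function_partial[OF assms, of i]] by blast
    have "\<bar>partial i u x - partial i u y\<bar> \<le> sqrt (2 * B * L) * sqrt (norm (x - y))" for x y
    proof -
      have "\<bar>partial i u x - partial i u y\<bar> \<le> sqrt ((2 * B) * (L * norm (x - y)))"
        by (rule interpolate_bounds) (use B(2)[of x] B(2)[of y] L(2)[of x y] in auto)
      then show ?thesis by (simp add: mult.assoc flip: real_sqrt_mult)
    qed
    then show "\<exists>k. 0 \<le> k \<and> (\<forall>x y. \<bar>partial i u x - partial i u y\<bar> \<le> k * sqrt (norm (x - y)))"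
      using B(1) L(1) by (intro exI[of _ "sqrt (2 * B * L)"]) auto
  qed
  from choice[OF this] obtain k where k: "\<And>i. k i \<ge> 0"
    "\<And>i x y. \<bar>partial i u x - partial i u y\<bar> \<le> k i * sqrt (norm (x - y))" by blast
  have "norm (grad u x - grad u y) \<le> (\<Sum>i\<in>UNIV. k i) * sqrt (norm (x - y))" for x y
    unfolding sum_distrib_right
    by (rule order_trans[OF norm_le_l1_cart sum_mono]) (use k(2) in \<open>simp add: grad_def\<close>)
  then show thesis using that[of "\<Sum>i\<in>UNIV. k i"] k(1) by (simp add: sum_nonneg)
qed

lemma grad_measurable:
  fixes u :: "real ^ 'd::finite \<Rightarrow> real"
  assumes "test_function u" shows "grad u \<in> borel_measurable borel"
proof (rule borel_measurable_continuous_onI)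
  show "continuous_on UNIV (grad u)"
    unfolding grad_def[abs_def] using assms
    by (intro continuous_on_vec_lambda smooth_continuous smooth_partial test_function_smooth)
qed

abbreviation "ival_gauss \<equiv> unit_ival \<Otimes>\<^sub>M (gauss :: (real ^ 'd::finite) measure)"

lemma finite_measure_ival_gauss: "finite_measure (ival_gauss :: (real \<times> (real ^ 'd::finite)) measure)"
  by (rule finite_measure_pair_measure) (rule gauss.finite_measure_axioms, rule finite_measure_unit_ival)

lemma measurable_ival_gauss [measurable]:
  "fst \<in> borel_measurable (ival_gauss :: (real \<times> (real ^ 'd::finite)) measure)"
  "snd \<in> borel_measurable (ival_gauss :: (real \<times> (real ^ 'd::finite)) measure)"
  using measurable_compose[OF measurable_fst measurable_unit_ival[OF measurable_ident]]
    measurable_compose[OF measurable_snd, of "\<lambda>x. x" gauss borel] by auto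

lemma space_ival_gauss: "z \<in> space (ival_gauss :: (real \<times> (real ^ 'd::finite)) measure) \<Longrightarrow> 0 < fst z \<and> fst z < 1"
  by (auto simp: space_pair_measure)

text \<open>For smooth data the derivatives of the potential fall on the data.\<close>

definition smooth_pot :: "nat \<Rightarrow> (real ^ 'd::finite \<Rightarrow> real) \<Rightarrow> real ^ 'd \<Rightarrow> real" where
  "smooth_pot m u x = (\<integral>z. fst z ^ m * u (fst z *\<^sub>R x + cosgn (fst z) *\<^sub>R snd z) \<partial>ival_gauss)"

lemma ival_gauss_integrable:
  fixes G :: "real ^ 'd::finite \<Rightarrow> 'b::{banach, second_countable_topology}"
  assumes [measurable]: "G \<in> borel_measurable borel" and B: "\<And>x. norm (G x) \<le> B"
  shows "integrable ival_gauss (\<lambda>z. fst z ^ m *\<^sub>R G (fst z *\<^sub>R x + cosgn (fst z) *\<^sub>R snd z))"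
proof -
  interpret N: finite_measure "ival_gauss :: (real \<times> (real ^ 'd)) measure" by (rule finite_measure_ival_gauss)
  show ?thesis
  proof (rule N.integrable_const_bound[where B = B])
    show "AE z in ival_gauss. norm (fst z ^ m *\<^sub>R G (fst z *\<^sub>R x + cosgn (fst z) *\<^sub>R snd z)) \<le> B"
    proof (rule AE_I2)
      fix z :: "real \<times> (real ^ 'd)" assume "z \<in> space ival_gauss"
      then have z: "0 < fst z \<and> fst z < 1" by (rule space_ival_gauss)
      have "norm (fst z ^ m *\<^sub>R G (fst z *\<^sub>R x + cosgn (fst z) *\<^sub>R snd z)) \<le> 1 * norm (G (fst z *\<^sub>R x + cosgn (fst z) *\<^sub>R snd z))"
        unfolding norm_scaleR using z by (intro mult_right_mono) (auto simp: power_le_one)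
      then show "norm (fst z ^ m *\<^sub>R G (fst z *\<^sub>R x + cosgn (fst z) *\<^sub>R snd z)) \<le> B" using B[of "fst z *\<^sub>R x + cosgn (fst z) *\<^sub>R snd z"] by simp
    qed
  qed measurable
qed

text \<open>The inner map contributes one factor \<open>fst z\<close> per derivative, so the
  functions \<open>smooth_pot m u\<close> form a family closed under partial derivatives; this is
  the reason for the parameter \<open>m\<close>.\<close>

lemma smooth_pot_deriv:
  assumes u: "test_function u"
  shows "(smooth_pot m u has_derivative (\<lambda>h. (\<chi> i. smooth_pot (Suc m) (partial i u) x) \<bullet> h)) (at x)"
proof -
  obtain k where k: "k \<ge> 0" "\<And>x y. norm (grad u x - grad u y) \<le> k * sqrt (norm (x - y))"
    using test_function_gradient_Hoelder[OF u] by blast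
  obtain B where B: "\<And>x. norm (u x) \<le> B" using test_function_bounded[OF u] unfolding real_norm_def by blast
  obtain B' where B': "\<And>x. norm (grad u x) \<le> B'" using test_function_gradient_bounded[OF u] by blast
  have mu: "u \<in> borel_measurable borel" by (intro smooth_measurable test_function_smooth u)
  note mg = grad_measurable[OF u]
  interpret N: finite_measure "ival_gauss :: (real \<times> (real ^ 'a)) measure" by (rule finite_measure_ival_gauss)
  have ig: "integrable ival_gauss (\<lambda>z. fst z ^ Suc m *\<^sub>R grad u (fst z *\<^sub>R x + cosgn (fst z) *\<^sub>R snd z))" for x
    by (rule ival_gauss_integrable[OF mg B'])
  have "((\<lambda>x. \<integral>z. fst z ^ m * u (fst z *\<^sub>R x + cosgn (fst z) *\<^sub>R snd z) \<partial>ival_gauss) has_derivative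
     (\<lambda>h. (\<integral>z. fst z ^ Suc m *\<^sub>R grad u (fst z *\<^sub>R x + cosgn (fst z) *\<^sub>R snd z) \<partial>ival_gauss) \<bullet> h)) (at x)"
  proof (rule has_derivative_param_integral[where \<kappa> = "\<lambda>_. k"])
    fix z :: "real \<times> (real ^ 'a)" and x y
    assume "z \<in> space ival_gauss"
    from space_ival_gauss[OF this] have z: "0 < fst z" "fst z < 1" by auto
    have du: "(u has_derivative (\<lambda>h. grad u y \<bullet> h)) (at y)" for y
      by (intro has_derivative_grad smooth_differentiable test_function_smooth u)
    have "((\<lambda>x. u (fst z *\<^sub>R x + cosgn (fst z) *\<^sub>R snd z)) has_derivative
       (\<lambda>h. grad u (fst z *\<^sub>R x + cosgn (fst z) *\<^sub>R snd z) \<bullet> (fst z *\<^sub>R h))) (at x)"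
      by (rule has_derivative_compose[OF _ du]) (auto intro!: derivative_eq_intros)
    from has_derivative_mult_right[OF this, of "fst z ^ m"]
    show "((\<lambda>x. fst z ^ m * u (fst z *\<^sub>R x + cosgn (fst z) *\<^sub>R snd z)) has_derivative
       (\<lambda>h. (fst z ^ Suc m *\<^sub>R grad u (fst z *\<^sub>R x + cosgn (fst z) *\<^sub>R snd z)) \<bullet> h)) (at x)"
      by (simp add: mult_ac)
    have "norm (fst z ^ Suc m *\<^sub>R grad u (fst z *\<^sub>R x + cosgn (fst z) *\<^sub>R snd z) - fst z ^ Suc m *\<^sub>R grad u (fst z *\<^sub>R y + cosgn (fst z) *\<^sub>R snd z))
      \<le> 1 * (k * sqrt (norm ((fst z *\<^sub>R x + cosgn (fst z) *\<^sub>R snd z) - (fst z *\<^sub>R y + cosgn (fst z) *\<^sub>R snd z))))"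
      unfolding scaleR_diff_right[symmetric] norm_scaleR using z
      by (intro mult_mono k(2)) (auto simp: power_le_one mult_le_one)
    also have "\<dots> = k * sqrt (fst z * norm (x - y))" using z by (simp flip: scaleR_diff_right)
    also have "\<dots> \<le> k * sqrt (norm (x - y))"
      using z k(1) by (intro mult_left_mono real_sqrt_le_mono) (auto intro: mult_left_le_one_le)
    finally show "norm (fst z ^ Suc m *\<^sub>R grad u (fst z *\<^sub>R x + cosgn (fst z) *\<^sub>R snd z) - fst z ^ Suc m *\<^sub>R grad u (fst z *\<^sub>R y + cosgn (fst z) *\<^sub>R snd z))
      \<le> k * sqrt (norm (x - y))" .
  qed (use k(1) ival_gauss_integrable[OF mu B] ig in auto)
  also have "(\<integral>z. fst z ^ Suc m *\<^sub>R grad u (fst z *\<^sub>R x + cosgn (fst z) *\<^sub>R snd z) \<partial>ival_gauss) = (\<chi> i. smooth_pot (Suc m) (partial i u) x)"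
    using integral_bounded_linear[OF bounded_linear_vec_nth ig[of x]]
    by (simp add: vec_eq_iff smooth_pot_def grad_def)
  finally show ?thesis unfolding smooth_pot_def[abs_def] .
qed

lemma Ck_smooth_pot: "test_function u \<Longrightarrow> Ck k (smooth_pot m u)"
proof (induction k arbitrary: m u)
  case 0
  then show ?case using smooth_pot_deriv[OF 0]
    by (auto intro!: continuous_at_imp_continuous_on has_derivative_continuous)
next
  case (Suc k)
  have "partial i (smooth_pot m u) = smooth_pot (Suc m) (partial i u)" for i
    using partial_eq[OF smooth_pot_deriv[OF Suc.prems]] by auto
  moreover have "smooth_pot m u differentiable (at x)" for x
    using smooth_pot_deriv[OF Suc.prems] by (auto simp: differentiable_def)
  ultimately show ?case using Suc.IH[OF test_function_partial[OF Suc.prems]] by simp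
qed

text \<open>The potential itself contains the singular factor 1 / s, so smoothness is proved for its
  first derivatives. For smooth data these are averages of \<open>grad g\<close> by Gaussian
  integration by parts, which is obtained here by differentiating the same average in two
  ways.\<close>

lemma smooth_ou_solution:
  fixes g :: "real ^ 'd::finite \<Rightarrow> real"
  assumes g: "test_function g" and lf: "lipschitz_fun (\<lambda>x. g x - c) L" and mean: "(\<integral>x. g x - c \<partial>gauss) = 0"
  shows "smooth (lipschitz_fun.ou_solution (\<lambda>x. g x - c))"
proof -
  interpret lipschitz_fun "\<lambda>x. g x - c" L by (rule lf)
  obtain k where k: "k \<ge> 0" "\<And>x y. norm (grad g x - grad g y) \<le> k * sqrt (norm (x - y))"
    using test_function_gradient_Hoelder[OF g] by blast
  obtain B' where B': "\<And>x. norm (grad g x) \<le> B'" using test_function_gradient_bounded[OF g] by blast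
  note [measurable] = grad_measurable[OF g]
  interpret N: pair_sigma_finite unit_ival "gauss :: (real ^ 'd) measure" ..
  have key: "(1 / \<sigma>) *\<^sub>R (\<integral>z. (g (y + \<sigma> *\<^sub>R z) - c) *\<^sub>R z \<partial>gauss) = (\<integral>z. grad g (y + \<sigma> *\<^sub>R z) \<partial>gauss)"
    if \<sigma>: "\<sigma> > 0" for \<sigma> y
  proof -
    let ?V = "(1 / \<sigma>) *\<^sub>R (\<integral>z. (g (y + \<sigma> *\<^sub>R z) - c) *\<^sub>R z \<partial>gauss)"
    let ?W = "\<integral>z. grad g (y + \<sigma> *\<^sub>R z) \<partial>gauss"
    have dg: "(g has_derivative (\<lambda>h. grad g y \<bullet> h)) (at y)" for y
      by (intro has_derivative_grad smooth_differentiable test_function_smooth g)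
    have 1: "((\<lambda>y. \<integral>z. g (y + \<sigma> *\<^sub>R z) - c \<partial>gauss) has_derivative (\<lambda>h. ?V \<bullet> h)) (at y)"
      using has_derivative_gauss_average[OF \<sigma>, of 1 0 y] by simp
    have 2: "((\<lambda>y. \<integral>z. g (y + \<sigma> *\<^sub>R z) - c \<partial>gauss) has_derivative (\<lambda>h. ?W \<bullet> h)) (at y)"
    proof (rule has_derivative_param_integral[where \<kappa> = "\<lambda>_. k"])
      fix z x :: "real ^ 'd"
      have "((\<lambda>x. g (x + \<sigma> *\<^sub>R z)) has_derivative (\<lambda>h. grad g (x + \<sigma> *\<^sub>R z) \<bullet> h)) (at x)"
        by (rule has_derivative_compose[OF _ dg]) (auto intro!: derivative_eq_intros)
      from has_derivative_diff[OF this has_derivative_const[of c]]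
      show "((\<lambda>x. g (x + \<sigma> *\<^sub>R z) - c) has_derivative (\<lambda>h. grad g (x + \<sigma> *\<^sub>R z) \<bullet> h)) (at x)" by simp
      show "integrable gauss (\<lambda>z. grad g (x + \<sigma> *\<^sub>R z))"
        by (rule gauss.integrable_const_bound[where B = B']) (use B' in auto)
    next
      fix z x y :: "real ^ 'd"
      show "norm (grad g (x + \<sigma> *\<^sub>R z) - grad g (y + \<sigma> *\<^sub>R z)) \<le> k * sqrt (norm (x - y))"
        using k(2)[of "x + \<sigma> *\<^sub>R z" "y + \<sigma> *\<^sub>R z"] by simp
    qed (use k integrable_plain in auto)
    have "(\<lambda>h. ?V \<bullet> h) = (\<lambda>h. ?W \<bullet> h)" by (rule has_derivative_unique[OF 1 2])
    then have "?V \<bullet> (?V - ?W) = ?W \<bullet> (?V - ?W)" by metis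
    then have "(?V - ?W) \<bullet> (?V - ?W) = 0" by (simp add: inner_diff_left)
    then show ?thesis by simp
  qed
  have part: "partial i ou_solution = (\<lambda>x. - 2 * smooth_pot 0 (partial i g) x)" for i
  proof
    fix x
    have ig: "integrable ival_gauss (\<lambda>z. fst z ^ 0 *\<^sub>R grad g (fst z *\<^sub>R x + cosgn (fst z) *\<^sub>R snd z))"
      by (rule ival_gauss_integrable[OF _ B']) measurable
    have "ou_grad x = - 2 *\<^sub>R (\<integral>s. (\<integral>z. grad g (s *\<^sub>R x + cosgn s *\<^sub>R z) \<partial>gauss) \<partial>unit_ival)"
      unfolding ou_grad_def by (intro arg_cong[where f = "\<lambda>v. - 2 *\<^sub>R v"] Bochner_Integration.integral_cong refl key)
        (auto intro: cosgn_bounds)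
    also have "(\<integral>s. (\<integral>z. grad g (s *\<^sub>R x + cosgn s *\<^sub>R z) \<partial>gauss) \<partial>unit_ival) =
        (\<integral>z. grad g (fst z *\<^sub>R x + cosgn (fst z) *\<^sub>R snd z) \<partial>ival_gauss)"
      using N.integral_fst'[of "\<lambda>z. grad g (fst z *\<^sub>R x + cosgn (fst z) *\<^sub>R snd z)"] ig by simp
    finally have "ou_grad x $ i = - 2 * (\<integral>z. grad g (fst z *\<^sub>R x + cosgn (fst z) *\<^sub>R snd z) \<partial>ival_gauss) $ i" by simp
    also have "(\<integral>z. grad g (fst z *\<^sub>R x + cosgn (fst z) *\<^sub>R snd z) \<partial>ival_gauss) $ i = smooth_pot 0 (partial i g) x"
      using integral_bounded_linear[OF bounded_linear_vec_nth ig, of i] by (simp add: smooth_pot_def grad_def)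
    finally show "partial i ou_solution x = - 2 * smooth_pot 0 (partial i g) x"
      by (simp add: partial_ou_solution[OF mean])
  qed
  have d: "ou_solution differentiable (at x)" for x
    using ou_solution_deriv[OF mean] by (auto simp: differentiable_def)
  have "Ck (Suc k) ou_solution" for k
    using d Ck_mult[OF Ck_const Ck_smooth_pot[OF test_function_partial[OF g]], of k "- 2"] by (simp add: part)
  then show ?thesis unfolding smooth_def using Ck_SucD by blast
qed

text \<open>Indicators of boxes are limits of test functions, and boxes are stable under
  intersection and generate the Borel sets. The mean condition covers complements. In the end the
  sets where \<open>w\<close> is positive or negative are inserted.\<close>

lemma AE_eq_0_of_test_functions:
  fixes w :: "real ^ 'd::finite \<Rightarrow> real"
  assumes iw: "integrable gauss w" and mean: "(\<integral>x. w x \<partial>gauss) = 0"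
    and orth: "\<And>g. test_function g \<Longrightarrow> (\<integral>x. w x * g x \<partial>gauss) = 0"
  shows "AE x in lborel. w x = 0"
proof -
  have [measurable]: "w \<in> borel_measurable borel" using iw by (auto dest: borel_measurable_integrable)
  have iwA: "integrable gauss (\<lambda>x. indicator A x * w x)" if "A \<in> sets borel" for A
    using integrable_mult_indicator[OF _ iw, of A] that by simp
  have box: "(\<integral>x. indicator (box a b) x * w x \<partial>gauss) = 0" for a b :: "real ^ 'd"
  proof -
    define q where "q x = (\<Prod>i\<in>UNIV. flat 1 (x $ i - a $ i) * flat 1 (b $ i - x $ i))" for x
    have "smooth (\<lambda>x :: real ^ 'd. x $ i - c)" "smooth (\<lambda>x :: real ^ 'd. c - x $ i)" for i c
      using smooth_add[OF smooth_coord smooth_const[of "- c"], of i]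
        smooth_add[OF smooth_const[of c] smooth_mult[OF smooth_const[of "- 1"] smooth_coord[of i]]] by simp_all
    then have sq: "smooth q" unfolding q_def[abs_def] by (intro smooth_prod smooth_mult smooth_flat) auto
    have fl: "flat 1 t \<ge> 0" "flat 1 t > 0 \<longleftrightarrow> t > 0" for t by (auto simp: flat_def)
    have q0: "q x \<ge> 0" for x unfolding q_def using fl by (intro prod_nonneg) auto
    have qout: "q x = 0" if "x \<notin> box a b" for x
    proof -
      have "\<exists>i. x $ i \<le> a $ i \<or> b $ i \<le> x $ i"
        using that unfolding mem_box_cart by (meson not_less)
      then obtain i where "x $ i \<le> a $ i \<or> b $ i \<le> x $ i" by blast
      then have "flat 1 (x $ i - a $ i) * flat 1 (b $ i - x $ i) = 0" by (auto simp: flat_def)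
      then show ?thesis unfolding q_def by (intro prod_zero) auto
    qed
    have qin: "q x > 0" if "x \<in> box a b" for x
      unfolding q_def using that fl by (intro prod_pos) (auto simp: mem_box_cart)
    obtain R where R: "\<And>x. x \<in> box a b \<Longrightarrow> norm x \<le> R"
      using bounded_box[of a b] by (auto simp: bounded_iff)
    \<comment> \<open>As \<open>q\<close> is positive exactly on the box, these functions vanish
      outside it and increase to its indicator.\<close>
    let ?g = "\<lambda>n x. 1 - exp (- real n * q x)"
    have t: "test_function (?g n)" for n
    proof (rule test_functionI[of _ R])
      have "smooth (\<lambda>x. 1 + (- 1) * exp ((- real n) * q x))"
        by (intro smooth_add smooth_mult smooth_const smooth_exp sq)
      then show "smooth (?g n)" by simp
      show "?g n x = 0" if "R < norm x" for x using qout[of x] R[of x] that by fastforce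
    qed
    have "(\<lambda>n. \<integral>x. w x * ?g n x \<partial>gauss) \<longlonglongrightarrow> (\<integral>x. indicator (box a b) x * w x \<partial>gauss)"
    proof (rule integral_dominated_convergence[where w = "\<lambda>x. \<bar>w x\<bar>"])
      have [measurable]: "q \<in> borel_measurable borel" using sq by (rule smooth_measurable)
      show "(\<lambda>x. w x * ?g n x) \<in> borel_measurable gauss" for n by measurable
      show "AE x in gauss. norm (w x * ?g n x) \<le> \<bar>w x\<bar>" for n
      proof (rule AE_I2)
        fix x
        have "exp (- real n * q x) \<le> 1" "exp (- real n * q x) > 0" using q0[of x] by auto
        then have "\<bar>?g n x\<bar> \<le> 1" by linarith
        then show "norm (w x * ?g n x) \<le> \<bar>w x\<bar>" by (simp add: abs_mult mult_left_le)
      qed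
      show "AE x in gauss. (\<lambda>n. w x * ?g n x) \<longlonglongrightarrow> indicator (box a b) x * w x"
      proof (rule AE_I2)
        fix x
        show "(\<lambda>n. w x * ?g n x) \<longlonglongrightarrow> indicator (box a b) x * w x"
        proof (cases "x \<in> box a b")
          case True
          have lim: "(\<lambda>n. exp (- q x) ^ n) \<longlonglongrightarrow> 0" using qin[OF True] by (intro LIMSEQ_realpow_zero) auto
          then have "(\<lambda>n. w x * (1 - exp (- q x) ^ n)) \<longlonglongrightarrow> w x * (1 - 0)"
            by (intro tendsto_mult_left tendsto_diff tendsto_const lim)
          then show ?thesis using True by (simp add: exp_of_nat_mult[symmetric])
        next
          case False
          then show ?thesis using qout[OF False] by simp
        qed
      qed
    qed (use iw in auto)
    then have "(\<lambda>n :: nat. 0 :: real) \<longlonglongrightarrow> (\<integral>x. indicator (box a b) x * w x \<partial>gauss)"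
      by (simp only: orth[OF t])
    then show ?thesis by (simp add: LIMSEQ_const_iff)
  qed
  have all: "(\<integral>x. indicator A x * w x \<partial>gauss) = 0" if "A \<in> sets borel" for A
  proof -
    let ?G = "range (\<lambda>(a, b). box a b :: (real ^ 'd) set)"
    have G: "sets borel = sigma_sets UNIV ?G"
      by (subst borel_eq_box) (simp add: sets_measure_of)
    have "Int_stable ?G"
    proof (rule Int_stableI)
      fix A B assume "A \<in> ?G" "B \<in> ?G"
      then obtain a b a' b' :: "real ^ 'd" where "A = box a b" "B = box a' b'" by auto
      then have "\<exists>c c'. A \<inter> B = box c c'" by (auto simp: box_Int_box)
      then show "A \<inter> B \<in> ?G" by auto
    qed
    moreover have "?G \<subseteq> Pow UNIV" by simp
    moreover have "A \<in> sigma_sets UNIV ?G" using that G by simp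
    ultimately show ?thesis
    proof (induction rule: sigma_sets_induct_disjoint)
      case (basic A)
      then show ?case using box by auto
    next
      case empty
      then show ?case by simp
    next
      case (compl A)
      then have A: "A \<in> sets borel" using G by simp
      have "(\<integral>x. indicator (UNIV - A) x * w x \<partial>gauss) = (\<integral>x. w x - indicator A x * w x \<partial>gauss)"
        by (rule Bochner_Integration.integral_cong) (auto simp: indicator_def)
      also have "\<dots> = 0" using compl mean iw iwA[OF A] by simp
      finally show ?case .
    next
      case (union A)
      then have A: "A i \<in> sets borel" for i using G by auto
      then have U: "(\<Union>i. A i) \<in> sets borel" by auto
      have "(LINT x:(\<Union>i. A i)|gauss. w x) = (\<Sum>i. (LINT x:(A i)|gauss. w x))"
        by (rule lebesgue_integral_countable_add)
           (use A union(1) iwA[OF U] in \<open>auto simp: disjoint_family_on_def set_integrable_def\<close>)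
      then show ?case using union by (simp add: set_lebesgue_integral_def)
    qed
  qed
  have "AE x in gauss. w x = 0"
  proof -
    \<comment> \<open>With \<open>s = 1\<close> and \<open>s = - 1\<close> this removes the positive
      and the negative part of \<open>w\<close>.\<close>
    have P: "AE x in gauss. indicator {x. s * w x > 0} x * (s * w x) = 0" for s :: real
    proof (rule integral_nonneg_eq_0_iff_AE[THEN iffD1])
      have S: "{x. s * w x > 0} \<in> sets borel" by measurable
      have eq: "(\<lambda>x. indicator {x. s * w x > 0} x * (s * w x)) = (\<lambda>x. s * (indicator {x. s * w x > 0} x * w x))"
        by auto
      show "integrable gauss (\<lambda>x. indicator {x. s * w x > 0} x * (s * w x))"
        unfolding eq using iwA[OF S] by (rule integrable_mult_right)
      show "(\<integral>x. indicator {x. s * w x > 0} x * (s * w x) \<partial>gauss) = 0"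
        unfolding eq using all[OF S] by simp
    qed (auto simp: indicator_def)
    show ?thesis using P[of 1] P[of "- 1"]
    proof eventually_elim
      case (elim x)
      then show ?case by (auto simp: indicator_def split: if_splits)
    qed
  qed
  then show ?thesis
    unfolding gauss_eq_density by (subst (asm) AE_density) (auto simp: gauss_density_pos)
qed

lemma integrable_gauss_AE_linear:
  fixes u :: "real ^ 'd::finite \<Rightarrow> real"
  assumes "u \<in> borel_measurable borel" "AE x in gauss. \<bar>u x\<bar> \<le> K * (1 + norm x)"
  shows "integrable gauss u"
proof (rule Bochner_Integration.integrable_bound)
  show "integrable gauss (\<lambda>x :: real ^ 'd. K * (1 + norm x))"
    by (rule integrable_gauss_bound_poly[where k = 1 and C = "\<bar>K\<bar>"]) (auto simp: abs_mult)
  show "AE x in gauss. norm (u x) \<le> norm (K * (1 + norm x))" using assms(2) by eventually_elim auto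
qed (use assms in simp)

text \<open>For a test function \<open>g\<close> with Gaussian mean \<open>c\<close>, the function
  \<open>g - c\<close> is the image under the generator of a smooth function of linear growth. Hence
  the difference \<open>w\<close> of two solutions is orthogonal to \<open>g - c\<close>, and also
  to \<open>g\<close> because \<open>w\<close> itself has mean 0.\<close>

lemma strong_solution_unique:
  fixes f \<psi> \<phi> :: "real ^ 'd::finite \<Rightarrow> real"
  assumes sol: "strong_poisson_solution p f \<psi>" "strong_poisson_solution q f \<phi>"
    and f: "f \<in> borel_measurable borel"
  shows "AE x in lborel. \<psi> x = \<phi> x"
proof -
  have m[measurable]: "\<psi> \<in> borel_measurable borel" "\<phi> \<in> borel_measurable borel"
    using sol by (auto simp: strong_poisson_solution_def W2_loc_derivs_def Lp_loc_def)
  obtain K1 where K1: "AE x in gauss. \<bar>\<psi> x\<bar> \<le> K1 * (1 + norm x)"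
    using sol(1) by (auto simp: strong_poisson_solution_def intro: AE_gauss_iff)
  obtain K2 where K2: "AE x in gauss. \<bar>\<phi> x\<bar> \<le> K2 * (1 + norm x)"
    using sol(2) by (auto simp: strong_poisson_solution_def intro: AE_gauss_iff)
  define w where "w x = \<psi> x - \<phi> x" for x
  have [measurable]: "w \<in> borel_measurable borel" unfolding w_def[abs_def] by measurable
  have wb: "AE x in gauss. \<bar>w x\<bar> \<le> (K1 + K2) * (1 + norm x)"
    using K1 K2 by eventually_elim (auto simp: w_def distrib_right)
  have iw: "integrable gauss w" by (rule integrable_gauss_AE_linear[OF _ wb]) measurable
  have mean: "(\<integral>x. w x \<partial>gauss) = 0"
    using sol integrable_gauss_AE_linear[OF m(1) K1] integrable_gauss_AE_linear[OF m(2) K2]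
    by (simp add: w_def strong_poisson_solution_def)
  have orth: "(\<integral>x. w x * ou_op u x \<partial>gauss) = 0" if "test_function u" for u
    unfolding w_def by (rule strong_solution_difference[OF sol f that])
  have "AE x in lborel. w x = 0"
  proof (rule AE_eq_0_of_test_functions[OF iw mean])
    fix g :: "real ^ 'd \<Rightarrow> real" assume g: "test_function g"
    obtain B where B: "B \<ge> 0" "\<And>x. \<bar>g x\<bar> \<le> B" using test_function_bounded[OF g] by blast
    obtain L where L: "L \<ge> 0" "\<And>x y. \<bar>g x - g y\<bar> \<le> L * norm (x - y)" using test_function_lipschitz[OF g] by blast
    have [measurable]: "g \<in> borel_measurable borel" by (intro smooth_measurable test_function_smooth g)
    have ig: "integrable gauss g" by (rule gauss.integrable_const_bound[where B = B]) (use B in auto)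
    define c where "c = (\<integral>x. g x \<partial>gauss)"
    have m0: "(\<integral>x. g x - c \<partial>gauss) = 0" using ig gauss.prob_space[where 'd = 'd] by (simp add: c_def)
    have lf: "lipschitz_fun (\<lambda>x. g x - c) L"
      by standard (intro lipschitz_onI, use L in \<open>auto simp: dist_norm\<close>)
    interpret lipschitz_fun "\<lambda>x. g x - c" L by (rule lf)
    note cl = classical_ou_solution[OF m0, unfolded classical_poisson_solution_def]
    have op: "ou_op ou_solution x = g x - c" for x using cl by (simp add: ou_op_def)
    obtain K where K: "\<And>x. \<bar>ou_solution x\<bar> \<le> K * (1 + norm x)" using cl by blast
    define A where "A = \<bar>K\<bar> + 2 * L + B + \<bar>c\<bar>"
    have lin: "a * 1 \<le> A * (1 + norm x)" if "a \<le> A" "0 \<le> a" for a and x :: "real ^ 'd"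
      using that by (intro mult_mono) auto
    have "(\<integral>x. w x * ou_op ou_solution x \<partial>gauss) = 0"
    proof (rule ou_op_orthogonal_smooth[OF _ wb orth, where A = A])
      show "smooth ou_solution" by (rule smooth_ou_solution[OF g lf m0])
      show "\<bar>ou_solution x\<bar> \<le> A * (1 + norm x)" for x
        by (rule order_trans[OF K mult_right_mono]) (use L B in \<open>auto simp: A_def\<close>)
      show "\<bar>partial i ou_solution x\<bar> \<le> A * (1 + norm x)" for i x
      proof -
        have "\<bar>partial i ou_solution x\<bar> \<le> norm (ou_grad x)"
          using component_le_norm_cart[of "ou_grad x" i] by (simp add: partial_ou_solution[OF m0])
        also have "\<dots> \<le> 2 * L"
          by (rule norm_gradient_le[OF ou_solution_lipschitz[OF m0] ou_solution_deriv[OF m0]])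
        finally show ?thesis using lin[of "2 * L" x] L B by (simp add: A_def)
      qed
      show "\<bar>ou_op ou_solution x\<bar> \<le> A * (1 + norm x)" for x
        unfolding op using lin[of "B + \<bar>c\<bar>" x] B(2)[of x] B(1) L(1) by (simp add: A_def)
    qed measurable
    then have "(\<integral>x. w x * (g x - c) \<partial>gauss) = 0" by (simp add: op)
    moreover have "integrable gauss (\<lambda>x. w x * g x)"
      by (rule Bochner_Integration.integrable_bound[OF integrable_mult_right[OF iw, of B]])
         (use B in \<open>auto simp: abs_mult mult.commute intro!: AE_I2 mult_right_mono\<close>)
    ultimately show "(\<integral>x. w x * g x \<partial>gauss) = 0"
      using iw mean by (simp add: right_diff_distrib)
  qed
  then show ?thesis by (simp add: w_def)
qed

text \<open>Two continuous functions that agree almost everywhere are equal, since the set where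
  they differ is open and null. The exponent 2 is an arbitrary choice above 1.\<close>

lemma classical_solution_unique:
  fixes f \<psi> \<phi> :: "real ^ 'd::finite \<Rightarrow> real"
  assumes sol: "classical_poisson_solution f \<psi>" "classical_poisson_solution f \<phi>"
    and f: "f \<in> borel_measurable borel"
  shows "\<psi> = \<phi>"
proof -
  have "AE x in lborel. \<psi> x = \<phi> x"
    using strong_solution_unique[OF classical_imp_strong[OF sol(1), of 2] classical_imp_strong[OF sol(2), of 2] f] by simp
  have c: "continuous_on UNIV \<psi>" "continuous_on UNIV \<phi>"
    using sol by (auto simp: classical_poisson_solution_def intro: Ck_continuous)
  define N where "N = {x. \<psi> x \<noteq> \<phi> x}"
  have o: "open N" unfolding N_def by (intro open_Collect_neq c)
  have "N \<in> null_sets lborel"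
    using AE_iff_null_sets[of N lborel] \<open>AE x in lborel. \<psi> x = \<phi> x\<close> borel_open[OF o] by (auto simp: N_def)
  then have "negligible N" by (simp add: negligible_iff_null_sets null_sets_completionI)
  then have "N = {}" using open_not_negligible[OF o] by blast
  then show ?thesis by (auto simp: N_def)
qed

section \<open>Deviations of normalized sums\<close>

lemma ennreal_mult_add:
  assumes "0 \<le> c" "0 \<le> a" "0 \<le> b"
  shows "ennreal (c * (a + b)) = ennreal c * (ennreal a + ennreal b)"
  using assms by (metis add_nonneg_nonneg ennreal_mult ennreal_plus)

locale gc_sequence = prob_space M for M :: "'a measure" +
  fixes U :: "nat \<Rightarrow> 'a \<Rightarrow> real ^ 'd::finite"
  assumes indep: "indep_vars (\<lambda>_. borel) U {1..}"
    and ident: "\<forall>n\<ge>1. distr M borel (U n) = distr M borel (U 1)"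
    and gc: "GC M (U 1)"
begin

definition law :: "(real ^ 'd) measure" where "law = distr M borel (U 1)"

lemma U_measurable [measurable]: "k \<ge> 1 \<Longrightarrow> U k \<in> borel_measurable M"
  using indep by (auto simp: indep_vars_def)

lemma sets_law [simp, measurable_cong]: "sets law = sets borel"
  by (simp add: law_def)

lemma space_law [simp]: "space law = UNIV"
  by (simp add: law_def)

lemma prob_space_law: "prob_space law"
  unfolding law_def by (rule prob_space_distr, rule U_measurable) simp

sublocale law: prob_space law by (rule prob_space_law)

lemma law_eq: "k \<ge> 1 \<Longrightarrow> distr M borel (U k) = law"
  unfolding law_def using ident by blast

lemma integrable_law:
  fixes g :: "real ^ 'd \<Rightarrow> 'b::{banach, second_countable_topology}"
  assumes "g \<in> borel_measurable borel"
  shows "integrable law g \<longleftrightarrow> integrable M (\<lambda>\<omega>. g (U 1 \<omega>))"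
  unfolding law_def using assms by (intro integrable_distr_eq) auto

lemma integral_law:
  fixes g :: "real ^ 'd \<Rightarrow> 'b::{banach, second_countable_topology}"
  assumes "g \<in> borel_measurable borel"
  shows "(\<integral>u. g u \<partial>law) = (\<integral>\<omega>. g (U 1 \<omega>) \<partial>M)"
  unfolding law_def using assms by (intro integral_distr) auto

lemma law_mean: "integrable law (\<lambda>u. u)" "(\<integral>u. u \<partial>law) = 0"
  using gc by (auto simp: GC_def integrable_law integral_law)

lemma law_cov: "integrable law (\<lambda>u. u $ i * u $ j)" "(\<integral>u. u $ i * u $ j \<partial>law) = (if i = j then 1 else 0)"
  using gc by (auto simp: GC_def integrable_law integral_law)

lemma law_exp_lipschitz:
  assumes "\<And>x y. \<bar>g x - g y\<bar> \<le> norm (x - y)" "l > 0"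
  shows "integrable law (\<lambda>u. exp (l * g u))"
    and "(\<integral>u. exp (l * g u) \<partial>law) \<le> exp (l * (\<integral>u. g u \<partial>law) + l\<^sup>2 / 2)"
proof -
  have l: "1-lipschitz_on UNIV g" using assms(1) by (auto intro!: lipschitz_onI simp: dist_norm)
  then have [measurable]: "g \<in> borel_measurable borel"
    by (intro borel_measurable_continuous_onI lipschitz_on_continuous_on)
  show "integrable law (\<lambda>u. exp (l * g u))" "(\<integral>u. exp (l * g u) \<partial>law) \<le> exp (l * (\<integral>u. g u \<partial>law) + l\<^sup>2 / 2)"
    using gc l assms(2) by (auto simp: GC_def integrable_law integral_law)
qed

text \<open>The norm is 1-Lipschitz, so (GC) provides exponential moments of every order.\<close>

lemma integrable_law_exp_bound:
  fixes g :: "real ^ 'd \<Rightarrow> 'b::{banach, second_countable_topology}"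
  assumes "g \<in> borel_measurable borel" "\<And>u. norm (g u) \<le> C * exp (c * norm u)" "c > 0"
  shows "integrable law g"
proof (rule Bochner_Integration.integrable_bound)
  show "integrable law (\<lambda>u. C * exp (c * norm u))"
    by (intro integrable_mult_right law_exp_lipschitz(1) norm_triangle_ineq3 assms(3))
  show "AE u in law. norm (g u) \<le> norm (C * exp (c * norm u))"
    using assms(2) by (intro AE_I2) (auto intro: order_trans[OF _ abs_ge_self])
qed (use assms in simp)

lemma lipschitz_measurable:
  fixes g :: "real ^ 'd \<Rightarrow> real"
  assumes "\<And>x y. \<bar>g x - g y\<bar> \<le> K * norm (x - y)" "K \<ge> 0"
  shows "g \<in> borel_measurable borel"
proof -
  have "K-lipschitz_on UNIV g" using assms by (auto intro!: lipschitz_onI simp: dist_norm)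
  then show ?thesis by (intro borel_measurable_continuous_onI lipschitz_on_continuous_on)
qed

lemma integrable_law_lipschitz:
  fixes g :: "real ^ 'd \<Rightarrow> real"
  assumes g: "\<And>x y. \<bar>g x - g y\<bar> \<le> K * norm (x - y)" "K \<ge> 0"
  shows "integrable law g"
proof (rule integrable_law_exp_bound[where c = 1 and C = "\<bar>g 0\<bar> + K"])
  show "g \<in> borel_measurable borel" by (rule lipschitz_measurable[OF g])
  fix u
  have "\<bar>g u\<bar> \<le> \<bar>g 0\<bar> * 1 + K * norm u" using g(1)[of u 0] by simp
  also have "\<dots> \<le> \<bar>g 0\<bar> * exp (norm u) + K * exp (norm u)"
    using g(2) exp_ge_add_one_self[of "norm u"] norm_ge_zero[of u] by (intro add_mono mult_left_mono) linarith+
  finally show "norm (g u) \<le> (\<bar>g 0\<bar> + K) * exp (1 * norm u)" by (simp add: distrib_right)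
qed simp

text \<open>This is (GC) for the 1-Lipschitz function \<open>g u / K\<close> and the parameter
  \<open>l * K\<close>. The nonnegative integral lets the bound be iterated without integrability
  side conditions.\<close>

lemma law_concentration:
  fixes g :: "real ^ 'd \<Rightarrow> real"
  assumes g: "\<And>x y. \<bar>g x - g y\<bar> \<le> K * norm (x - y)" "K > 0" and l: "l > 0"
  shows "(\<integral>\<^sup>+u. ennreal (exp (l * (g u - (\<integral>u. g u \<partial>law)))) \<partial>law) \<le> ennreal (exp (l\<^sup>2 * K\<^sup>2 / 2))"
proof -
  have "\<bar>g x / K - g y / K\<bar> \<le> norm (x - y)" for x y
    using g(1)[of x y] g(2) by (simp add: diff_divide_distrib[symmetric] abs_divide divide_simps mult.commute)
  note e = law_exp_lipschitz[of "\<lambda>u. g u / K" "l * K", OF this mult_pos_pos[OF l g(2)]]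
  define m where "m = (\<integral>u. g u \<partial>law)"
  have i: "integrable law (\<lambda>u. exp (l * g u))" using e(1) g(2) by simp
  have le: "(\<integral>u. exp (l * g u) \<partial>law) \<le> exp (l * m + l\<^sup>2 * K\<^sup>2 / 2)"
    using e(2) g(2) by (simp add: m_def power_mult_distrib)
  have eq: "(\<lambda>u. exp (l * (g u - m))) = (\<lambda>u. exp (- l * m) * exp (l * g u))"
    by (simp add: fun_eq_iff right_diff_distrib flip: exp_add)
  have "(\<integral>\<^sup>+u. ennreal (exp (l * (g u - m))) \<partial>law) = ennreal (\<integral>u. exp (l * (g u - m)) \<partial>law)"
    by (rule nn_integral_eq_integral) (unfold eq, use i in auto)
  also have "(\<integral>u. exp (l * (g u - m)) \<partial>law) = exp (- l * m) * (\<integral>u. exp (l * g u) \<partial>law)"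
    unfolding eq by simp
  also have "ennreal \<dots> \<le> ennreal (exp (- l * m) * exp (l * m + l\<^sup>2 * K\<^sup>2 / 2))"
    by (intro ennreal_leI mult_left_mono le) simp
  also have "exp (- l * m) * exp (l * m + l\<^sup>2 * K\<^sup>2 / 2) = exp (l\<^sup>2 * K\<^sup>2 / 2)" by (simp flip: exp_add)
  finally show ?thesis by (simp add: m_def)
qed

lemma law_exp_inner: "(\<integral>\<^sup>+u. ennreal (exp (v \<bullet> u)) \<partial>law) \<le> ennreal (exp ((norm v)\<^sup>2 / 2))"
proof (cases "v = 0")
  case True
  then show ?thesis using law.emeasure_space_1 by simp
next
  case False
  have "\<bar>v \<bullet> x - v \<bullet> y\<bar> \<le> norm v * norm (x - y)" for x y
    using Cauchy_Schwarz_ineq2[of v "x - y"] by (simp add: inner_diff_right)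
  moreover have "(\<integral>u. v \<bullet> u \<partial>law) = 0"
    using law_mean by (subst integral_inner_right) auto
  ultimately show ?thesis using law_concentration[of "\<lambda>u. v \<bullet> u" "norm v" 1] False by simp
qed

text \<open>This takes the place of conditional expectation: the next variable is independent of the
  past, so by Fubini it is integrated first, with the past frozen.\<close>

lemma nn_integral_past:
  assumes F: "F \<in> borel_measurable (PiM {1..k} (\<lambda>_. borel) \<Otimes>\<^sub>M borel)"
  shows "(\<integral>\<^sup>+\<omega>. F (\<lambda>i\<in>{1..k}. U i \<omega>, U (Suc k) \<omega>) \<partial>M) =
    (\<integral>\<^sup>+\<omega>. (\<integral>\<^sup>+u. F (\<lambda>i\<in>{1..k}. U i \<omega>, u) \<partial>law) \<partial>M)"
proof -
  let ?P = "PiM {1..k} (\<lambda>_. borel :: (real ^ 'd) measure)"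
  let ?T = "\<lambda>\<omega>. \<lambda>i\<in>{1..k}. U i \<omega>"
  \<comment> \<open>The next variable is treated as a family indexed by a singleton, the form in
    which independence of disjoint blocks is available.\<close>
  let ?Q = "PiM {Suc k} (\<lambda>_. borel :: (real ^ 'd) measure)"
  let ?S = "\<lambda>\<omega>. \<lambda>i\<in>{Suc k}. U i \<omega>"
  have iv: "indep_var ?P ?T ?Q ?S"
    by (rule indep_var_restrict[OF indep]) auto
  then have rv: "?T \<in> measurable M ?P" "?S \<in> measurable M ?Q"
    and eq: "distr M ?P ?T \<Otimes>\<^sub>M distr M ?Q ?S = distr M (?P \<Otimes>\<^sub>M ?Q) (\<lambda>\<omega>. (?T \<omega>, ?S \<omega>))"
    using indep_var_distribution_eq[of ?P ?T ?Q ?S] by auto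
  interpret S: prob_space "distr M ?Q ?S" by (rule prob_space_distr[OF rv(2)])
  define G where "G p = F (fst p, snd p (Suc k))" for p
  have "(\<lambda>p. (fst p, snd p (Suc k))) \<in> measurable (?P \<Otimes>\<^sub>M ?Q) (?P \<Otimes>\<^sub>M borel)"
    by (intro measurable_Pair measurable_fst measurable_compose[OF measurable_snd measurable_component_singleton]) simp
  from measurable_compose[OF this F]
  have G: "G \<in> borel_measurable (?P \<Otimes>\<^sub>M ?Q)" by (simp add: G_def[abs_def])
  have Ft: "(\<lambda>u. F (t, u)) \<in> borel_measurable borel" if "t \<in> space ?P" for t
    using measurable_Pair2[OF F that] .
  have inner: "(\<integral>\<^sup>+s. G (t, s) \<partial>distr M ?Q ?S) = (\<integral>\<^sup>+u. F (t, u) \<partial>law)" if t: "t \<in> space ?P" for t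
  proof -
    have "(\<integral>\<^sup>+s. G (t, s) \<partial>distr M ?Q ?S) = (\<integral>\<^sup>+\<omega>. G (t, ?S \<omega>) \<partial>M)"
      by (rule nn_integral_distr[OF rv(2)]) (use measurable_Pair2[OF G t] in simp)
    also have "\<dots> = (\<integral>\<^sup>+\<omega>. F (t, U (Suc k) \<omega>) \<partial>M)" by (simp add: G_def)
    also have "\<dots> = (\<integral>\<^sup>+u. F (t, u) \<partial>distr M borel (U (Suc k)))"
      by (rule nn_integral_distr[symmetric]) (use Ft[OF t] in auto)
    finally show ?thesis by (simp add: law_eq)
  qed
  have "(\<integral>\<^sup>+\<omega>. F (?T \<omega>, U (Suc k) \<omega>) \<partial>M) = (\<integral>\<^sup>+\<omega>. G (?T \<omega>, ?S \<omega>) \<partial>M)" by (simp add: G_def)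
  also have "\<dots> = (\<integral>\<^sup>+p. G p \<partial>distr M (?P \<Otimes>\<^sub>M ?Q) (\<lambda>\<omega>. (?T \<omega>, ?S \<omega>)))"
    using G by (intro nn_integral_distr[symmetric] measurable_Pair rv) simp
  also have "\<dots> = (\<integral>\<^sup>+t. (\<integral>\<^sup>+s. G (t, s) \<partial>distr M ?Q ?S) \<partial>distr M ?P ?T)"
    unfolding eq[symmetric] by (rule S.nn_integral_fst[symmetric]) (use G in \<open>simp add: eq\<close>)
  also have "\<dots> = (\<integral>\<^sup>+\<omega>. (\<integral>\<^sup>+s. G (?T \<omega>, s) \<partial>distr M ?Q ?S) \<partial>M)"
  proof (rule nn_integral_distr[OF rv(1)])
    have "G \<in> borel_measurable (?P \<Otimes>\<^sub>M distr M ?Q ?S)"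
      using G by (simp cong: measurable_cong_sets sets_pair_measure_cong)
    from S.borel_measurable_nn_integral_fst[OF this]
    show "(\<lambda>t. \<integral>\<^sup>+s. G (t, s) \<partial>distr M ?Q ?S) \<in> borel_measurable (distr M ?P ?T)" by simp
  qed
  also have "\<dots> = (\<integral>\<^sup>+\<omega>. (\<integral>\<^sup>+u. F (?T \<omega>, u) \<partial>law) \<partial>M)"
    by (intro nn_integral_cong inner measurable_space[OF rv(1)])
  finally show ?thesis .
qed

lemma Zn_measurable [measurable]: "Zn U k \<in> borel_measurable M"
  unfolding Zn_def[abs_def] by (cases "k = 0") (auto intro!: borel_measurable_scaleR borel_measurable_sum)

text \<open>The coordinate projections \<open>\<lambda>i t. t i\<close> play the role of
  \<open>U\<close>, which exhibits \<open>Zn U j\<close> as a function of the first \<open>k\<close>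
  variables.\<close>

lemma Zn_past: "j \<le> k \<Longrightarrow> Zn (\<lambda>i t. t i) j (\<lambda>i\<in>{1..k}. U i \<omega>) = Zn U j \<omega>"
  unfolding Zn_def by (auto intro!: arg_cong[where f = "\<lambda>x. _ *\<^sub>R x"] sum.cong)

text \<open>An exponential supermartingale argument: given the past, the last factor has mean at
  most \<open>exp (c (Suc n))\<close>, uniformly in the state \<open>z\<close>, so the factors are
  peeled off one at a time.\<close>

lemma exp_sum_bound:
  assumes D: "\<And>k. (\<lambda>p. D k (fst p) (snd p)) \<in> borel_measurable (borel \<Otimes>\<^sub>M borel)"
    and b: "\<And>k z. k \<ge> 1 \<Longrightarrow> (\<integral>\<^sup>+u. ennreal (exp (D k z u)) \<partial>law) \<le> ennreal (exp (c k))"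
  shows "(\<integral>\<^sup>+\<omega>. ennreal (exp (\<Sum>k = 1..n. D k (Zn U (k - 1) \<omega>) (U k \<omega>))) \<partial>M) \<le> ennreal (exp (\<Sum>k = 1..n. c k))"
proof (induction n)
  case 0
  then show ?case using emeasure_space_1 by simp
next
  case (Suc n)
  let ?P = "PiM {1..n} (\<lambda>_. borel :: (real ^ 'd) measure)"
  let ?z = "Zn (\<lambda>i t. t i) :: nat \<Rightarrow> (nat \<Rightarrow> real ^ 'd) \<Rightarrow> real ^ 'd"
  let ?S = "\<lambda>t. \<Sum>k = 1..n. D k (?z (k - 1) t) (t k)"
  have z: "?z j \<in> borel_measurable ?P" if "j \<le> n" for j
    unfolding Zn_def[abs_def] using that
    by (cases "j = 0") (auto intro!: borel_measurable_scaleR borel_measurable_sum measurable_component_singleton)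
  have S[measurable]: "?S \<in> borel_measurable ?P"
  proof (intro borel_measurable_sum)
    fix k assume k: "k \<in> {1..n}"
    then have k1: "k - 1 \<le> n" by auto
    show "(\<lambda>t. D k (?z (k - 1) t) (t k)) \<in> borel_measurable ?P"
      using measurable_compose[OF measurable_Pair[OF z[OF k1] measurable_component_singleton[OF k]] D[of k]]
      by (simp only: fst_conv snd_conv)
  qed
  have D2[measurable]: "(\<lambda>p. D (Suc n) (?z n (fst p)) (snd p)) \<in> borel_measurable (?P \<Otimes>\<^sub>M borel)"
    using measurable_compose[OF measurable_Pair[OF measurable_compose[OF measurable_fst z[of n]] measurable_snd] D[of "Suc n"]]
    by simp
  define F where "F p = ennreal (exp (?S (fst p))) * ennreal (exp (D (Suc n) (?z n (fst p)) (snd p)))" for p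
  have F: "F \<in> borel_measurable (?P \<Otimes>\<^sub>M borel)" unfolding F_def[abs_def] by measurable
  have past: "?S (\<lambda>i\<in>{1..n}. U i \<omega>) = (\<Sum>k = 1..n. D k (Zn U (k - 1) \<omega>) (U k \<omega>))" for \<omega>
  proof (rule sum.cong)
    fix k assume k: "k \<in> {1..n}"
    then have "k - 1 \<le> n" by auto
    from Zn_past[OF this] show "D k (?z (k - 1) (\<lambda>i\<in>{1..n}. U i \<omega>)) ((\<lambda>i\<in>{1..n}. U i \<omega>) k) = D k (Zn U (k - 1) \<omega>) (U k \<omega>)"
      using k by simp
  qed simp
  have "(\<integral>\<^sup>+\<omega>. ennreal (exp (\<Sum>k = 1..Suc n. D k (Zn U (k - 1) \<omega>) (U k \<omega>))) \<partial>M) =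
     (\<integral>\<^sup>+\<omega>. F (\<lambda>i\<in>{1..n}. U i \<omega>, U (Suc n) \<omega>) \<partial>M)"
    unfolding F_def fst_conv snd_conv past Zn_past[OF order_refl] by (simp add: exp_add ennreal_mult)
  also have "\<dots> = (\<integral>\<^sup>+\<omega>. (\<integral>\<^sup>+u. F (\<lambda>i\<in>{1..n}. U i \<omega>, u) \<partial>law) \<partial>M)" by (rule nn_integral_past[OF F])
  also have "\<dots> \<le> (\<integral>\<^sup>+\<omega>. ennreal (exp (\<Sum>k = 1..n. D k (Zn U (k - 1) \<omega>) (U k \<omega>))) * ennreal (exp (c (Suc n))) \<partial>M)"
  proof (rule nn_integral_mono)
    fix \<omega>
    have m: "(\<lambda>u. D (Suc n) z u) \<in> borel_measurable law" for z
    proof -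
      have "(\<lambda>u. (z, u)) \<in> measurable law (borel \<Otimes>\<^sub>M borel)"
        by (rule measurable_Pair) (auto intro: measurable_ident_sets)
      from measurable_compose[OF this D[of "Suc n"]] show ?thesis by (simp only: fst_conv snd_conv)
    qed
    have "(\<integral>\<^sup>+u. F (\<lambda>i\<in>{1..n}. U i \<omega>, u) \<partial>law) =
       ennreal (exp (\<Sum>k = 1..n. D k (Zn U (k - 1) \<omega>) (U k \<omega>))) * (\<integral>\<^sup>+u. ennreal (exp (D (Suc n) (Zn U n \<omega>) u)) \<partial>law)"
      unfolding F_def fst_conv snd_conv past Zn_past[OF order_refl]
      by (rule nn_integral_cmult) (rule measurable_compose[OF m], measurable)
    also have "\<dots> \<le> ennreal (exp (\<Sum>k = 1..n. D k (Zn U (k - 1) \<omega>) (U k \<omega>))) * ennreal (exp (c (Suc n)))"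
      by (intro mult_left_mono b) auto
    finally show "(\<integral>\<^sup>+u. F (\<lambda>i\<in>{1..n}. U i \<omega>, u) \<partial>law) \<le>
      ennreal (exp (\<Sum>k = 1..n. D k (Zn U (k - 1) \<omega>) (U k \<omega>))) * ennreal (exp (c (Suc n)))" .
  qed
  also have "\<dots> = (\<integral>\<^sup>+\<omega>. ennreal (exp (\<Sum>k = 1..n. D k (Zn U (k - 1) \<omega>) (U k \<omega>))) \<partial>M) * ennreal (exp (c (Suc n)))"
  proof (rule nn_integral_multc)
    have "(\<lambda>\<omega>. D k (Zn U (k - 1) \<omega>) (U k \<omega>)) \<in> borel_measurable M" if "k \<in> {1..n}" for k
      using measurable_compose[OF measurable_Pair[OF Zn_measurable[of "k - 1"] U_measurable[of k]] D[of k]] that by simp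
    then show "(\<lambda>\<omega>. ennreal (exp (\<Sum>k = 1..n. D k (Zn U (k - 1) \<omega>) (U k \<omega>)))) \<in> borel_measurable M"
      by measurable
  qed
  also have "\<dots> \<le> ennreal (exp (\<Sum>k = 1..n. c k)) * ennreal (exp (c (Suc n)))"
    by (intro mult_right_mono Suc.IH) simp
  also have "\<dots> = ennreal (exp (\<Sum>k = 1..Suc n. c k))" by (simp add: exp_add ennreal_mult)
  finally show ?case .
qed

section \<open>Exponential moments of the normalized sums, uniformly in their index\<close>

lemma exp_inner_Zn: "(\<integral>\<^sup>+\<omega>. ennreal (exp (v \<bullet> Zn U n \<omega>)) \<partial>M) \<le> ennreal (exp ((norm v)\<^sup>2 / 2))"
proof (cases "n = 0")
  case True
  have "(\<integral>\<^sup>+\<omega>. ennreal (exp (v \<bullet> Zn U n \<omega>)) \<partial>M) = 1" using True emeasure_space_1 by (simp add: Zn_def)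
  also have "1 \<le> ennreal (exp ((norm v)\<^sup>2 / 2))" by (subst ennreal_1[symmetric], rule ennreal_leI) simp
  finally show ?thesis .
next
  case False
  let ?v = "(1 / sqrt (real n)) *\<^sub>R v"
  have "(\<integral>\<^sup>+\<omega>. ennreal (exp (\<Sum>k = 1..n. ?v \<bullet> U k \<omega>)) \<partial>M) \<le> ennreal (exp (\<Sum>k = 1..n. (norm ?v)\<^sup>2 / 2))"
    by (rule exp_sum_bound[where D = "\<lambda>_ _ u. ?v \<bullet> u" and c = "\<lambda>_. (norm ?v)\<^sup>2 / 2"]) (measurable, rule law_exp_inner)
  also have "(\<Sum>k = 1..n. (norm ?v)\<^sup>2 / 2) = (norm v)\<^sup>2 / 2"
    using False by (simp add: power_divide)
  also have "(\<lambda>\<omega>. ennreal (exp (\<Sum>k = 1..n. ?v \<bullet> U k \<omega>))) = (\<lambda>\<omega>. ennreal (exp (v \<bullet> Zn U n \<omega>)))"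
    using False by (simp add: Zn_def inner_sum_right sum_divide_distrib)
  finally show ?thesis .
qed

text \<open>With d the dimension, the norm is at most the sum of the |z_i|, which is the average of
  the d |z_i| with weights 1 / d. Convexity of exp reduces the claim to linear functionals, and exp
  |t| <= exp t + exp (- t) gives the factor 2.\<close>

lemma exp_norm_Zn:
  assumes "\<mu> \<ge> 0"
  shows "(\<integral>\<^sup>+\<omega>. ennreal (exp (\<mu> * norm (Zn U n \<omega>))) \<partial>M) \<le> ennreal (2 * exp ((\<mu> * real CARD('d))\<^sup>2 / 2))"
proof -
  define d where "d = real CARD('d)"
  have d: "d > 0" by (simp add: d_def)
  let ?e = "\<lambda>i. axis i (\<mu> * d) :: real ^ 'd"
  have nax: "(norm (axis i c :: real ^ 'd))\<^sup>2 = c\<^sup>2" for i c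
    unfolding power2_norm_eq_inner by (simp add: inner_axis_axis power2_eq_square)
  have pt: "exp (\<mu> * norm z) \<le> (\<Sum>i\<in>UNIV. (1 / d) * (exp (?e i \<bullet> z) + exp ((- ?e i) \<bullet> z)))" for z :: "real ^ 'd"
  proof -
    have "\<mu> * norm z \<le> \<mu> * (\<Sum>i\<in>UNIV. \<bar>z $ i\<bar>)" using assms norm_le_l1_cart by (intro mult_left_mono)
    also have "\<dots> = (\<Sum>i\<in>UNIV. (1 / d) *\<^sub>R (\<mu> * d * \<bar>z $ i\<bar>))" using d by (simp add: sum_distrib_left)
    finally have "exp (\<mu> * norm z) \<le> exp (\<Sum>i\<in>UNIV. (1 / d) *\<^sub>R (\<mu> * d * \<bar>z $ i\<bar>))" by simp
    also have "\<dots> \<le> (\<Sum>i\<in>UNIV. (1 / d) * exp (\<mu> * d * \<bar>z $ i\<bar>))"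
      using d by (intro convex_on_sum[OF _ _ exp_convex]) (auto simp: d_def)
    also have "\<dots> \<le> (\<Sum>i\<in>UNIV. (1 / d) * (exp (?e i \<bullet> z) + exp ((- ?e i) \<bullet> z)))"
    proof (intro sum_mono mult_left_mono)
      fix i
      show "exp (\<mu> * d * \<bar>z $ i\<bar>) \<le> exp (?e i \<bullet> z) + exp ((- ?e i) \<bullet> z)"
        by (cases "z $ i \<ge> 0") (simp_all add: inner_axis')
    qed (use d in auto)
    finally show ?thesis .
  qed
  have "(\<integral>\<^sup>+\<omega>. ennreal (exp (\<mu> * norm (Zn U n \<omega>))) \<partial>M) \<le>
      (\<integral>\<^sup>+\<omega>. (\<Sum>i\<in>UNIV. ennreal (1 / d) * (ennreal (exp (?e i \<bullet> Zn U n \<omega>)) + ennreal (exp ((- ?e i) \<bullet> Zn U n \<omega>)))) \<partial>M)"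
  proof (rule nn_integral_mono)
    fix \<omega>
    have "ennreal (exp (\<mu> * norm (Zn U n \<omega>))) \<le> ennreal (\<Sum>i\<in>UNIV. (1 / d) * (exp (?e i \<bullet> Zn U n \<omega>) + exp ((- ?e i) \<bullet> Zn U n \<omega>)))"
      by (rule ennreal_leI[OF pt])
    also have "\<dots> = (\<Sum>i\<in>UNIV. ennreal ((1 / d) * (exp (?e i \<bullet> Zn U n \<omega>) + exp ((- ?e i) \<bullet> Zn U n \<omega>))))"
      using d by (intro sum_ennreal[symmetric]) auto
    also have "\<dots> = (\<Sum>i\<in>UNIV. ennreal (1 / d) * (ennreal (exp (?e i \<bullet> Zn U n \<omega>)) + ennreal (exp ((- ?e i) \<bullet> Zn U n \<omega>))))"
      by (intro sum.cong refl ennreal_mult_add) (use d in auto)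
    finally show "ennreal (exp (\<mu> * norm (Zn U n \<omega>))) \<le>
      (\<Sum>i\<in>UNIV. ennreal (1 / d) * (ennreal (exp (?e i \<bullet> Zn U n \<omega>)) + ennreal (exp ((- ?e i) \<bullet> Zn U n \<omega>))))" .
  qed
  also have "\<dots> = (\<Sum>i\<in>UNIV. ennreal (1 / d) * ((\<integral>\<^sup>+\<omega>. ennreal (exp (?e i \<bullet> Zn U n \<omega>)) \<partial>M) + (\<integral>\<^sup>+\<omega>. ennreal (exp ((- ?e i) \<bullet> Zn U n \<omega>)) \<partial>M)))"
    by (simp add: nn_integral_sum nn_integral_cmult nn_integral_add)
  also have "\<dots> \<le> (\<Sum>i\<in>(UNIV :: 'd set). ennreal (1 / d) * (ennreal (exp ((\<mu> * d)\<^sup>2 / 2)) + ennreal (exp ((\<mu> * d)\<^sup>2 / 2))))"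
  proof (intro sum_mono mult_left_mono add_mono)
    fix i
    show "(\<integral>\<^sup>+\<omega>. ennreal (exp (?e i \<bullet> Zn U n \<omega>)) \<partial>M) \<le> ennreal (exp ((\<mu> * d)\<^sup>2 / 2))"
      using exp_inner_Zn[of "?e i" n] by (simp add: nax)
    show "(\<integral>\<^sup>+\<omega>. ennreal (exp ((- ?e i) \<bullet> Zn U n \<omega>)) \<partial>M) \<le> ennreal (exp ((\<mu> * d)\<^sup>2 / 2))"
      using exp_inner_Zn[of "- ?e i" n] by (simp add: nax)
  qed auto
  also have "\<dots> = (\<Sum>i\<in>(UNIV :: 'd set). ennreal ((1 / d) * (exp ((\<mu> * d)\<^sup>2 / 2) + exp ((\<mu> * d)\<^sup>2 / 2))))"
    by (intro sum.cong refl ennreal_mult_add[symmetric]) (use d in auto)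
  also have "\<dots> = ennreal (\<Sum>i\<in>(UNIV :: 'd set). (1 / d) * (exp ((\<mu> * d)\<^sup>2 / 2) + exp ((\<mu> * d)\<^sup>2 / 2)))"
    using d by (intro sum_ennreal) auto
  also have "(\<Sum>i\<in>(UNIV :: 'd set). (1 / d) * (exp ((\<mu> * d)\<^sup>2 / 2) + exp ((\<mu> * d)\<^sup>2 / 2))) = 2 * exp ((\<mu> * d)\<^sup>2 / 2)"
    using d by (simp add: d_def)
  finally show ?thesis by (simp add: d_def)
qed

text \<open>The variables \<open>Zn U k\<close> are dependent, so the exponential is not factorized;
  the sum is regarded as an average with weights \<open>p k / P\<close>, to which convexity of exp
  applies. Only the bound \<open>W\<close> on the total weight enters the result, which makes it
  uniform in \<open>n\<close>.\<close>

lemma exp_weighted_norm_Zn: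
  assumes p: "\<And>k. k \<le> n \<Longrightarrow> p k \<ge> 0" "(\<Sum>k\<le>n. p k) > 0" "(\<Sum>k\<le>n. p k) \<le> W" and \<mu>: "\<mu> \<ge> 0"
  shows "(\<integral>\<^sup>+\<omega>. ennreal (exp (\<mu> * (\<Sum>k\<le>n. p k * (1 + norm (Zn U k \<omega>))))) \<partial>M) \<le>
    ennreal (exp (\<mu> * W) * (2 * exp ((\<mu> * W * real CARD('d))\<^sup>2 / 2)))"
proof -
  define P where "P = (\<Sum>k\<le>n. p k)"
  define B where "B = 2 * exp ((\<mu> * W * real CARD('d))\<^sup>2 / 2)"
  have P: "P > 0" "P \<le> W" using p by (auto simp: P_def)
  have pt: "exp (\<mu> * (\<Sum>k\<le>n. p k * (1 + norm (Zn U k \<omega>)))) \<le> exp (\<mu> * W) * (\<Sum>k\<le>n. (p k / P) * exp ((\<mu> * W) * norm (Zn U k \<omega>)))" for \<omega>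
  proof -
    have "\<mu> * (\<Sum>k\<le>n. p k * (1 + norm (Zn U k \<omega>))) = \<mu> * P + (\<Sum>k\<le>n. (p k / P) *\<^sub>R ((\<mu> * P) * norm (Zn U k \<omega>)))"
      using P by (simp add: distrib_left sum.distrib sum_distrib_left P_def[symmetric] mult_ac)
    then have "exp (\<mu> * (\<Sum>k\<le>n. p k * (1 + norm (Zn U k \<omega>)))) = exp (\<mu> * P) * exp (\<Sum>k\<le>n. (p k / P) *\<^sub>R ((\<mu> * P) * norm (Zn U k \<omega>)))"
      by (simp only: exp_add)
    also have "\<dots> \<le> exp (\<mu> * W) * (\<Sum>k\<le>n. (p k / P) * exp ((\<mu> * P) * norm (Zn U k \<omega>)))"
    proof (intro mult_mono)
      show "exp (\<mu> * P) \<le> exp (\<mu> * W)" using P \<mu> by (simp add: mult_left_mono)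
      have "(\<Sum>k\<le>n. p k / P) = 1" using P by (simp add: P_def sum_divide_distrib[symmetric])
      then show "exp (\<Sum>k\<le>n. (p k / P) *\<^sub>R ((\<mu> * P) * norm (Zn U k \<omega>))) \<le> (\<Sum>k\<le>n. (p k / P) * exp ((\<mu> * P) * norm (Zn U k \<omega>)))"
        using p P by (intro convex_on_sum[OF _ _ exp_convex]) auto
    qed auto
    also have "\<dots> \<le> exp (\<mu> * W) * (\<Sum>k\<le>n. (p k / P) * exp ((\<mu> * W) * norm (Zn U k \<omega>)))"
    proof (intro mult_left_mono sum_mono)
      fix k assume "k \<in> {..n}"
      show "exp ((\<mu> * P) * norm (Zn U k \<omega>)) \<le> exp ((\<mu> * W) * norm (Zn U k \<omega>))"
        using P \<mu> by (simp add: mult_left_mono mult_right_mono)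
      show "0 \<le> p k / P" using \<open>k \<in> {..n}\<close> p P by simp
    qed simp
    finally show ?thesis .
  qed
  have pP: "0 \<le> p k / P" if "k \<le> n" for k using p P that by simp
  have "(\<integral>\<^sup>+\<omega>. ennreal (exp (\<mu> * (\<Sum>k\<le>n. p k * (1 + norm (Zn U k \<omega>))))) \<partial>M) \<le>
     (\<integral>\<^sup>+\<omega>. ennreal (exp (\<mu> * W)) * (\<Sum>k\<le>n. ennreal (p k / P) * ennreal (exp ((\<mu> * W) * norm (Zn U k \<omega>)))) \<partial>M)"
  proof (rule nn_integral_mono)
    fix \<omega>
    have "ennreal (exp (\<mu> * (\<Sum>k\<le>n. p k * (1 + norm (Zn U k \<omega>))))) \<le> ennreal (exp (\<mu> * W) * (\<Sum>k\<le>n. (p k / P) * exp ((\<mu> * W) * norm (Zn U k \<omega>))))"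
      by (rule ennreal_leI[OF pt])
    also have "\<dots> = ennreal (exp (\<mu> * W)) * ennreal (\<Sum>k\<le>n. (p k / P) * exp ((\<mu> * W) * norm (Zn U k \<omega>)))"
      using pP by (intro ennreal_mult sum_nonneg mult_nonneg_nonneg) auto
    also have "ennreal (\<Sum>k\<le>n. (p k / P) * exp ((\<mu> * W) * norm (Zn U k \<omega>))) = (\<Sum>k\<le>n. ennreal ((p k / P) * exp ((\<mu> * W) * norm (Zn U k \<omega>))))"
      using pP by (intro sum_ennreal[symmetric] mult_nonneg_nonneg) auto
    also have "\<dots> = (\<Sum>k\<le>n. ennreal (p k / P) * ennreal (exp ((\<mu> * W) * norm (Zn U k \<omega>))))"
      using pP by (intro sum.cong refl ennreal_mult) auto
    finally show "ennreal (exp (\<mu> * (\<Sum>k\<le>n. p k * (1 + norm (Zn U k \<omega>))))) \<le>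
       ennreal (exp (\<mu> * W)) * (\<Sum>k\<le>n. ennreal (p k / P) * ennreal (exp ((\<mu> * W) * norm (Zn U k \<omega>))))" .
  qed
  also have "\<dots> = ennreal (exp (\<mu> * W)) * (\<Sum>k\<le>n. ennreal (p k / P) * (\<integral>\<^sup>+\<omega>. ennreal (exp ((\<mu> * W) * norm (Zn U k \<omega>))) \<partial>M))"
    by (simp add: nn_integral_sum nn_integral_cmult)
  also have "\<dots> \<le> ennreal (exp (\<mu> * W)) * (\<Sum>k\<le>n. ennreal (p k / P) * ennreal B)"
    unfolding B_def using \<mu> P by (intro mult_left_mono sum_mono exp_norm_Zn) auto
  also have "(\<Sum>k\<le>n. ennreal (p k / P) * ennreal B) = (\<Sum>k\<le>n. ennreal (p k / P * B))"
    using pP by (intro sum.cong refl ennreal_mult[symmetric]) (auto simp: B_def)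
  also have "\<dots> = ennreal (\<Sum>k\<le>n. p k / P * B)"
    using pP by (intro sum_ennreal mult_nonneg_nonneg) (auto simp: B_def)
  also have "(\<Sum>k\<le>n. p k / P * B) = B"
    using P by (simp add: P_def[symmetric] flip: sum_distrib_right sum_divide_distrib)
  also have "ennreal (exp (\<mu> * W)) * ennreal B = ennreal (exp (\<mu> * W) * B)" by (simp add: B_def ennreal_mult)
  finally show ?thesis by (simp add: B_def)
qed

end

text \<open>The auxiliary function \<xi> is \<phi> along the segment minus its linear and quadratic
  terms. Its derivative is a sum of first-order remainders of the components of \<open>g\<close>,
  one for each dimension, whence the constant.\<close>

lemma second_order_remainder:
  fixes \<phi> :: "real ^ 'd::finite \<Rightarrow> real"
  assumes g: "\<And>x. (\<phi> has_derivative (\<lambda>h. g x \<bullet> h)) (at x)"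
    and H: "\<And>i x. ((\<lambda>x. g x $ i) has_derivative (\<lambda>h. H i x \<bullet> h)) (at x)"
    and Ho: "\<And>i x y. norm (H i x - H i y) \<le> \<kappa> * sqrt (norm (x - y))" and \<kappa>: "\<kappa> \<ge> 0"
  shows "\<bar>\<phi> (y + h) - \<phi> y - g y \<bullet> h - (\<Sum>i\<in>UNIV. h $ i * (H i y \<bullet> h)) / 2\<bar> \<le>
    real CARD('d) * \<kappa> * (sqrt (norm h) * (norm h)\<^sup>2)"
proof -
  let ?Q = "\<Sum>i\<in>UNIV. h $ i * (H i y \<bullet> h)"
  define \<xi> where "\<xi> t = \<phi> (y + t *\<^sub>R h) - t * (g y \<bullet> h) - ?Q * (t\<^sup>2 / 2)" for t
  have d: "(\<xi> has_real_derivative (g (y + t *\<^sub>R h) \<bullet> h - g y \<bullet> h - ?Q * t)) (at t)" for t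
  proof -
    have "((\<lambda>t. \<phi> (y + t *\<^sub>R h)) has_derivative (\<lambda>k. g (y + t *\<^sub>R h) \<bullet> (k *\<^sub>R h))) (at t)"
      by (rule has_derivative_compose[OF _ g]) (auto intro!: derivative_eq_intros)
    then have 1: "((\<lambda>t. \<phi> (y + t *\<^sub>R h)) has_real_derivative g (y + t *\<^sub>R h) \<bullet> h) (at t)"
      by (simp add: has_field_derivative_def mult_commute_abs)
    show ?thesis unfolding \<xi>_def[abs_def]
      by (auto intro!: derivative_eq_intros 1)
  qed
  have b: "\<bar>g (y + t *\<^sub>R h) \<bullet> h - g y \<bullet> h - ?Q * t\<bar> \<le> real CARD('d) * \<kappa> * (sqrt (norm h) * (norm h)\<^sup>2)"
    if t: "0 < t" "t < 1" for t
  proof -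
    have th: "norm (t *\<^sub>R h) \<le> norm h" using t by (simp add: mult_left_le_one_le)
    have "g (y + t *\<^sub>R h) \<bullet> h - g y \<bullet> h - ?Q * t =
        (\<Sum>i\<in>UNIV. h $ i * (g (y + t *\<^sub>R h) $ i - g y $ i - H i y \<bullet> (t *\<^sub>R h)))"
      by (simp add: inner_vec_def[of "g _"] right_diff_distrib sum_subtractf sum_distrib_left mult_ac)
    also have "\<bar>\<dots>\<bar> \<le> (\<Sum>i\<in>(UNIV :: 'd set). norm h * (\<kappa> * sqrt (norm h) * norm h))"
    proof (rule order_trans[OF sum_abs sum_mono])
      fix i
      have "\<bar>g (y + t *\<^sub>R h) $ i - g y $ i - H i y \<bullet> (t *\<^sub>R h)\<bar> \<le> \<kappa> * sqrt (norm (t *\<^sub>R h)) * norm (t *\<^sub>R h)"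
        by (rule gradient_Hoelder_remainder[OF H Ho \<kappa>])
      also have "\<dots> \<le> \<kappa> * sqrt (norm h) * norm h"
        using th \<kappa> by (intro mult_mono mult_left_mono real_sqrt_le_mono) auto
      finally show "\<bar>h $ i * (g (y + t *\<^sub>R h) $ i - g y $ i - H i y \<bullet> (t *\<^sub>R h))\<bar> \<le> norm h * (\<kappa> * sqrt (norm h) * norm h)"
        unfolding abs_mult using component_le_norm_cart[of h i] by (intro mult_mono) auto
    qed
    also have "\<dots> = real CARD('d) * \<kappa> * (sqrt (norm h) * (norm h)\<^sup>2)"
      by (simp add: power2_eq_square)
    finally show ?thesis .
  qed
  obtain t where t: "0 < t" "t < 1" "\<xi> 1 - \<xi> 0 = (1 - 0) * (g (y + t *\<^sub>R h) \<bullet> h - g y \<bullet> h - ?Q * t)"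
    using MVT2[of 0 1 \<xi>, OF _ d] by auto
  have "\<xi> 1 - \<xi> 0 = \<phi> (y + h) - \<phi> y - g y \<bullet> h - ?Q / 2" by (simp add: \<xi>_def)
  then show ?thesis using b[OF t(1,2)] t(3) by simp
qed

context gc_sequence
begin

text \<open>The moment of order 5/2: two from the second-order expansion and 1/2 from the Hoelder
  exponent of the Hessian.\<close>

definition law_moment :: real where "law_moment = (\<integral>u. sqrt (norm u) * (norm u)\<^sup>2 \<partial>law)"

lemma law_moment: "integrable law (\<lambda>u. sqrt (norm u) * (norm u)\<^sup>2)" "0 \<le> law_moment"
proof -
  show "integrable law (\<lambda>u. sqrt (norm u) * (norm u)\<^sup>2)"
  proof (rule integrable_law_exp_bound[where C = 1 and c = 3])
    fix u :: "real ^ 'd"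
    have "sqrt (norm u) \<le> 1 + norm u"
      using norm_ge_zero[of u] by (intro real_le_lsqrt) (simp_all add: power2_eq_square algebra_simps)
    then have "sqrt (norm u) * (norm u)\<^sup>2 \<le> (1 + norm u) * (1 + norm u)\<^sup>2"
      by (intro mult_mono power_mono) auto
    also have "\<dots> = (1 + norm u) ^ 3" by (simp add: power2_eq_square power3_eq_cube)
    also have "\<dots> \<le> exp (real 3 * norm u)" by (rule one_plus_power_le_exp) simp
    finally show "norm (sqrt (norm u) * (norm u)\<^sup>2) \<le> 1 * exp (3 * norm u)" by simp
  qed auto
  show "0 \<le> law_moment" unfolding law_moment_def by (intro Bochner_Integration.integral_nonneg) auto
qed

text \<open>The term \<open>x \<bullet> g x\<close> is Hoelder continuous by the Poisson equation although \<open>H\<close> is not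
  known to decay; hence the error grows only linearly in \<open>z\<close>.\<close>

lemma one_step_estimate:
  fixes \<phi> f :: "real ^ 'd \<Rightarrow> real"
  assumes g: "\<And>x. (\<phi> has_derivative (\<lambda>h. g x \<bullet> h)) (at x)"
    and H: "\<And>i x. ((\<lambda>x. g x $ i) has_derivative (\<lambda>h. H i x \<bullet> h)) (at x)"
    and Ho: "\<And>i x y. norm (H i x - H i y) \<le> \<kappa> * sqrt (norm (x - y))" and \<kappa>: "\<kappa> \<ge> 0"
    and G: "\<And>x. norm (g x) \<le> G"
    and eq: "\<And>x. (\<Sum>i\<in>UNIV. H i x $ i) / 2 - (x \<bullet> g x) / 2 = f x"
    and L: "\<And>x y. \<bar>f x - f y\<bar> \<le> L * norm (x - y)" "L \<ge> 0"
    and \<gamma>: "0 < \<gamma>" "\<gamma> \<le> 1"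
  shows "\<bar>(\<integral>u. \<phi> (sqrt (1 - \<gamma>) *\<^sub>R z + sqrt \<gamma> *\<^sub>R u) \<partial>law) - \<phi> z - \<gamma> * f z\<bar> \<le>
    (real CARD('d) * \<kappa> * (law_moment + 2) + 2 * L + 2 * G) * (\<gamma> powr (5 / 4) * (1 + norm z))"
proof -
  define d where "d = real CARD('d)"
  define \<rho> where "\<rho> = sqrt (1 - \<gamma>)"
  define y where "y = \<rho> *\<^sub>R z"
  define T where "T x = (\<Sum>i\<in>UNIV. H i x $ i)" for x
  define P where "P x = x \<bullet> g x" for x
  define n where "n = 1 + norm z"
  define e where "e = \<gamma> powr (5 / 4)"
  have n: "1 \<le> n" "norm z \<le> n" by (auto simp: n_def)
  have G0: "0 \<le> G" using G[of 0] norm_ge_zero order_trans by blast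
  have d0: "0 \<le> d" by (simp add: d_def)
  have \<rho>: "0 \<le> \<rho>" "\<rho> < 1" "\<rho>\<^sup>2 = 1 - \<gamma>" using \<gamma> by (auto simp: \<rho>_def)
  have r1: "0 \<le> 1 - \<rho>" "1 - \<rho> \<le> \<gamma>"
    using \<rho> mult_left_le[of \<rho> \<rho>] by (auto simp: power2_eq_square)
  \<comment> \<open>The contraction \<rho> reproduces the drift of the generator:
    \<open>1 - \<rho>\<close> is half of \<gamma> up to an error of second order.\<close>
  have r2: "\<bar>\<gamma> / 2 - (1 - \<rho>)\<bar> \<le> \<gamma> * \<gamma>"
  proof -
    have "\<gamma> = 1 - \<rho>\<^sup>2" using \<rho>(3) by simp
    then have "\<gamma> / 2 - (1 - \<rho>) = - ((1 - \<rho>)\<^sup>2 / 2)" by (simp add: power2_eq_square field_simps)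
    then have "\<bar>\<gamma> / 2 - (1 - \<rho>)\<bar> = (1 - \<rho>)\<^sup>2 / 2" by simp
    also have "\<dots> \<le> (1 - \<rho>)\<^sup>2" by simp
    also have "\<dots> \<le> \<gamma>\<^sup>2" using r1 by (intro power_mono) auto
    finally show ?thesis by (simp add: power2_eq_square)
  qed
  have e1: "\<gamma> * sqrt \<gamma> \<le> e" "\<gamma> * \<gamma> \<le> e"
  proof -
    have "\<gamma> * sqrt \<gamma> = \<gamma> powr 1 * \<gamma> powr (1 / 2)" using \<gamma> by (simp add: powr_half_sqrt)
    also have "\<dots> = \<gamma> powr (1 + 1 / 2)" by (simp only: powr_add)
    also have "\<dots> \<le> e" unfolding e_def using \<gamma> by (intro powr_mono') auto
    finally show "\<gamma> * sqrt \<gamma> \<le> e" .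
    have "\<gamma> * \<gamma> = \<gamma> powr 1 * \<gamma> powr 1" using \<gamma> by simp
    also have "\<dots> = \<gamma> powr (1 + 1)" by (simp only: powr_add)
    also have "\<dots> \<le> e" unfolding e_def using \<gamma> by (intro powr_mono') auto
    finally show "\<gamma> * \<gamma> \<le> e" .
  qed
  \<comment> \<open>The quarter power arises from the Hoelder factor evaluated at an increment of
    size \<open>sqrt \<gamma>\<close>.\<close>
  have e2: "sqrt (sqrt \<gamma>) * \<gamma> = e"
  proof -
    have "sqrt (sqrt \<gamma>) * \<gamma> = (\<gamma> powr (1 / 2)) powr (1 / 2) * \<gamma> powr 1" using \<gamma> by (simp add: powr_half_sqrt)
    also have "\<dots> = \<gamma> powr (1 / 2 * (1 / 2) + 1)" by (simp only: powr_powr powr_add)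
    finally show ?thesis by (simp add: e_def)
  qed
  have e0: "0 \<le> e" by (simp add: e_def)
  have T_Ho: "\<bar>T x - T x'\<bar> \<le> d * \<kappa> * sqrt (norm (x - x'))" for x x'
  proof -
    have "\<bar>T x - T x'\<bar> \<le> (\<Sum>i\<in>(UNIV :: 'd set). \<kappa> * sqrt (norm (x - x')))"
      unfolding T_def sum_subtractf[symmetric]
    proof (rule order_trans[OF sum_abs sum_mono])
      fix i show "\<bar>H i x $ i - H i x' $ i\<bar> \<le> \<kappa> * sqrt (norm (x - x'))"
        using component_le_norm_cart[of "H i x - H i x'" i] Ho[of i x x'] by simp
    qed
    then show ?thesis by (simp add: d_def)
  qed
  \<comment> \<open>By the Poisson equation the drift term is a Hoelder continuous trace minus a
    Lipschitz function, in spite of its unbounded factor \<open>x\<close>.\<close>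
  have P_eq: "P x = T x - 2 * f x" for x using eq[of x] by (simp add: P_def T_def)
  \<comment> \<open>Since \<open>n\<close> is at least 1, \<open>sqrt n\<close> may be replaced by
    \<open>n\<close>; with this the Hoelder and the Lipschitz increments share one bound.\<close>
  have near: "sqrt (norm (z - s *\<^sub>R z)) \<le> sqrt \<gamma> * n" "norm (z - s *\<^sub>R z) \<le> sqrt \<gamma> * n" if s: "\<rho> \<le> s" "s \<le> 1" for s
  proof -
    have "norm (z - s *\<^sub>R z) = norm ((1 - s) *\<^sub>R z)" by (simp add: scaleR_left_diff_distrib)
    also have "\<dots> = (1 - s) * norm z" using s by simp
    also have "\<dots> \<le> \<gamma> * n" using s r1 n by (intro mult_mono) auto
    finally have a: "norm (z - s *\<^sub>R z) \<le> \<gamma> * n" .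
    have "\<gamma> * \<gamma> \<le> \<gamma>" using \<gamma> by (simp add: mult_left_le)
    then have "\<gamma> \<le> sqrt \<gamma>" by (intro real_le_rsqrt) (simp add: power2_eq_square)
    then show "norm (z - s *\<^sub>R z) \<le> sqrt \<gamma> * n" using a n mult_right_mono[of \<gamma> "sqrt \<gamma>" n] by linarith
    have "sqrt (norm (z - s *\<^sub>R z)) \<le> sqrt (\<gamma> * n)" using a by (rule real_sqrt_le_mono)
    also have "\<dots> = sqrt \<gamma> * sqrt n" by (rule real_sqrt_mult)
    also have "\<dots> \<le> sqrt \<gamma> * n"
      using n \<gamma> by (intro mult_left_mono real_le_lsqrt) (auto simp: power2_eq_square)
    finally show "sqrt (norm (z - s *\<^sub>R z)) \<le> sqrt \<gamma> * n" .
  qed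
  \<comment> \<open>The increment has mean 0 and identity covariance, so the linear term of the
    Taylor expansion disappears and the quadratic one becomes the trace \<open>T y\<close>.\<close>
  have mean: "\<bar>(\<integral>u. \<phi> (y + sqrt \<gamma> *\<^sub>R u) \<partial>law) - \<phi> y - \<gamma> / 2 * T y\<bar> \<le> (d * \<kappa> * law_moment) * e"
  proof -
    let ?h = "\<lambda>u. sqrt \<gamma> *\<^sub>R u"
    let ?q = "\<lambda>u :: real ^ 'd. \<Sum>i\<in>UNIV. u $ i * (H i y \<bullet> u)"
    have q: "?q u = (\<Sum>i\<in>UNIV. \<Sum>j\<in>UNIV. H i y $ j * (u $ i * u $ j))" for u
      by (simp add: inner_vec_def sum_distrib_left mult_ac)
    have iq: "integrable law ?q" unfolding q
      by (intro Bochner_Integration.integrable_sum integrable_mult_right law_cov)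
    have Iq: "(\<integral>u. ?q u \<partial>law) = T y"
      unfolding q T_def by (simp add: law_cov if_distrib[of "\<lambda>c. _ * c"] sum.delta cong: if_cong)
    have ig: "integrable law (\<lambda>u. g y \<bullet> u)" using law_mean by auto
    have Ig: "(\<integral>u. g y \<bullet> u \<partial>law) = 0" using law_mean by (subst integral_inner_right) auto
    have i\<phi>: "integrable law (\<lambda>u. \<phi> (y + ?h u))"
    proof (rule integrable_law_lipschitz[where K = "sqrt \<gamma> * G"])
      fix u v
      obtain t where "\<phi> ((y + ?h v) + (?h u - ?h v)) - \<phi> (y + ?h v) = g ((y + ?h v) + t *\<^sub>R (?h u - ?h v)) \<bullet> (?h u - ?h v)"
        using gradient_mean_value[OF g] by blast
      then have "\<bar>\<phi> (y + ?h u) - \<phi> (y + ?h v)\<bar> \<le> norm (g ((y + ?h v) + t *\<^sub>R (?h u - ?h v))) * norm (?h u - ?h v)"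
        using Cauchy_Schwarz_ineq2[of "g ((y + ?h v) + t *\<^sub>R (?h u - ?h v))" "?h u - ?h v"] by simp
      also have "\<dots> \<le> G * norm (?h u - ?h v)" by (intro mult_right_mono G) simp
      also have "norm (?h u - ?h v) = sqrt \<gamma> * norm (u - v)" using \<gamma> by (simp flip: scaleR_diff_right)
      finally show "\<bar>\<phi> (y + ?h u) - \<phi> (y + ?h v)\<bar> \<le> sqrt \<gamma> * G * norm (u - v)" by (simp add: mult_ac)
    qed (use \<gamma> G0 in simp)
    have "norm (\<integral>u. \<phi> (y + ?h u) - \<phi> y - sqrt \<gamma> * (g y \<bullet> u) - \<gamma> / 2 * ?q u \<partial>law) \<le>
        (\<integral>u. (d * \<kappa> * e) * (sqrt (norm u) * (norm u)\<^sup>2) \<partial>law)"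
    proof (rule norm_integral_le)
      show "integrable law (\<lambda>u. (d * \<kappa> * e) * (sqrt (norm u) * (norm u)\<^sup>2))"
        using law_moment by (intro integrable_mult_right)
      fix u :: "real ^ 'd"
      have sg: "sqrt \<gamma> * sqrt \<gamma> = \<gamma>" using \<gamma> by simp
      have "(\<Sum>i\<in>UNIV. (r *\<^sub>R u) $ i * (H i y \<bullet> (r *\<^sub>R u))) = (r * r) * ?q u" for r
        by (simp add: sum_distrib_left mult_ac)
      from this[of "sqrt \<gamma>"] have "\<bar>\<phi> (y + ?h u) - \<phi> y - sqrt \<gamma> * (g y \<bullet> u) - \<gamma> / 2 * ?q u\<bar> \<le> d * \<kappa> * (sqrt (norm (?h u)) * (norm (?h u))\<^sup>2)"
        using second_order_remainder[OF g H Ho \<kappa>, of y "?h u"] sg by (simp add: d_def)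
      also have "sqrt (norm (?h u)) * (norm (?h u))\<^sup>2 = e * (sqrt (norm u) * (norm u)\<^sup>2)"
        unfolding e2[symmetric] using \<gamma> by (simp add: real_sqrt_mult power_mult_distrib)
      finally show "norm (\<phi> (y + ?h u) - \<phi> y - sqrt \<gamma> * (g y \<bullet> u) - \<gamma> / 2 * ?q u) \<le> (d * \<kappa> * e) * (sqrt (norm u) * (norm u)\<^sup>2)"
        by (simp add: mult_ac)
    qed
    also have "(\<integral>u. (d * \<kappa> * e) * (sqrt (norm u) * (norm u)\<^sup>2) \<partial>law) = (d * \<kappa> * law_moment) * e"
      by (simp add: law_moment_def)
    also have "(\<integral>u. \<phi> (y + ?h u) - \<phi> y - sqrt \<gamma> * (g y \<bullet> u) - \<gamma> / 2 * ?q u \<partial>law) =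
       (\<integral>u. \<phi> (y + ?h u) \<partial>law) - \<phi> y - \<gamma> / 2 * T y"
      using i\<phi> ig iq Iq Ig law.prob_space by simp
    finally show ?thesis by simp
  qed
  \<comment> \<open>The contraction moves \<open>z\<close> to \<open>y\<close> along its own ray, so
    the mean value point is a multiple \<open>s *\<^sub>R z\<close>, and there
    \<open>z \<bullet> g (s *\<^sub>R z)\<close> is almost the drift \<open>P\<close>.\<close>
  obtain t where t: "0 < t" "t < 1" "\<phi> (y + (z - y)) - \<phi> y = g (y + t *\<^sub>R (z - y)) \<bullet> (z - y)"
    using gradient_mean_value[OF g] by blast
  define s where "s = \<rho> + t * (1 - \<rho>)"
  have s: "\<rho> \<le> s" "s \<le> 1"
    using t r1 mult_left_le_one_le[of "1 - \<rho>" t] by (auto simp: s_def)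
  have sz: "y + t *\<^sub>R (z - y) = s *\<^sub>R z" by (simp add: y_def s_def algebra_simps)
  have zy: "z - y = (1 - \<rho>) *\<^sub>R z" by (simp add: y_def algebra_simps)
  have inc: "\<phi> z - \<phi> y = (1 - \<rho>) * (z \<bullet> g (s *\<^sub>R z))"
  proof -
    have "\<phi> z - \<phi> y = g (s *\<^sub>R z) \<bullet> (z - y)" using t(3) unfolding sz by simp
    then show ?thesis unfolding zy by (simp add: inner_commute)
  qed
  have zg: "\<bar>z \<bullet> g x\<bar> \<le> G * n" for x
  proof -
    have "\<bar>z \<bullet> g x\<bar> \<le> norm z * norm (g x)" by (rule Cauchy_Schwarz_ineq2)
    also have "\<dots> \<le> n * G" using G n by (intro mult_mono) auto
    finally show ?thesis by (simp add: mult.commute)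
  qed
  have Pz: "\<bar>P z - z \<bullet> g (s *\<^sub>R z)\<bar> \<le> ((d * \<kappa> + 2 * L) * sqrt \<gamma> + G * \<gamma>) * n"
  proof -
    have "P (s *\<^sub>R z) = z \<bullet> g (s *\<^sub>R z) - (1 - s) * (z \<bullet> g (s *\<^sub>R z))" by (simp add: P_def algebra_simps)
    moreover have "\<bar>(1 - s) * (z \<bullet> g (s *\<^sub>R z))\<bar> \<le> \<gamma> * (G * n)"
      unfolding abs_mult using zg s r1 by (intro mult_mono) auto
    moreover have "\<bar>P z - P (s *\<^sub>R z)\<bar> \<le> (d * \<kappa> + 2 * L) * (sqrt \<gamma> * n)"
    proof -
      have "\<bar>T z - T (s *\<^sub>R z)\<bar> \<le> d * \<kappa> * (sqrt \<gamma> * n)"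
        using d0 \<kappa> by (intro order_trans[OF T_Ho] mult_left_mono near s) auto
      moreover have "\<bar>f z - f (s *\<^sub>R z)\<bar> \<le> L * (sqrt \<gamma> * n)"
        by (intro order_trans[OF L(1)] mult_left_mono near s L)
      ultimately show ?thesis unfolding P_eq by (simp add: distrib_right)
    qed
    ultimately show ?thesis by (simp add: algebra_simps)
  qed
  have A: "\<bar>\<gamma> / 2 * T y - \<gamma> / 2 * T z\<bar> \<le> d * \<kappa> * (e * n)"
  proof -
    have "\<bar>T z - T y\<bar> \<le> d * \<kappa> * (sqrt \<gamma> * n)"
      unfolding y_def using d0 \<kappa> \<rho> by (intro order_trans[OF T_Ho] mult_left_mono near) auto
    then have "\<gamma> * \<bar>T z - T y\<bar> \<le> \<gamma> * (d * \<kappa> * (sqrt \<gamma> * n))" using \<gamma> by (intro mult_left_mono) auto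
    also have "\<dots> = (d * \<kappa> * n) * (\<gamma> * sqrt \<gamma>)" by simp
    also have "\<dots> \<le> (d * \<kappa> * n) * e" using d0 \<kappa> n e1 by (intro mult_left_mono) auto
    finally have 1: "\<gamma> * \<bar>T z - T y\<bar> \<le> (d * \<kappa> * n) * e" .
    have "\<bar>\<gamma> / 2 * T y - \<gamma> / 2 * T z\<bar> = \<bar>\<gamma> / 2\<bar> * \<bar>T y - T z\<bar>"
      by (simp only: right_diff_distrib[symmetric] abs_mult)
    also have "\<dots> \<le> \<gamma> * \<bar>T z - T y\<bar>"
      using \<gamma> by (simp add: abs_minus_commute mult_right_mono)
    finally show ?thesis using 1 by (simp add: mult_ac)
  qed
  have B: "\<bar>\<gamma> / 2 * P z - (1 - \<rho>) * (z \<bullet> g (s *\<^sub>R z))\<bar> \<le> (d * \<kappa> + 2 * L + 2 * G) * (e * n)"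
  proof -
    have "\<gamma> / 2 * P z - (1 - \<rho>) * (z \<bullet> g (s *\<^sub>R z)) =
        (\<gamma> / 2 - (1 - \<rho>)) * P z + (1 - \<rho>) * (P z - z \<bullet> g (s *\<^sub>R z))" by (simp add: algebra_simps)
    moreover have "\<bar>(\<gamma> / 2 - (1 - \<rho>)) * P z\<bar> \<le> e * (G * n)"
      unfolding abs_mult using r2 e1 zg[of z] e0 by (intro mult_mono) (auto simp: P_def)
    moreover have "\<bar>(1 - \<rho>) * (P z - z \<bullet> g (s *\<^sub>R z))\<bar> \<le> (d * \<kappa> + 2 * L + G) * (e * n)"
    proof -
      have "\<bar>(1 - \<rho>) * (P z - z \<bullet> g (s *\<^sub>R z))\<bar> \<le> \<gamma> * (((d * \<kappa> + 2 * L) * sqrt \<gamma> + G * \<gamma>) * n)"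
        unfolding abs_mult using r1 Pz \<gamma> by (intro mult_mono) auto
      also have "\<dots> = (d * \<kappa> + 2 * L) * n * (\<gamma> * sqrt \<gamma>) + G * n * (\<gamma> * \<gamma>)" by (simp add: algebra_simps)
      also have "\<dots> \<le> (d * \<kappa> + 2 * L) * n * e + G * n * e"
        using d0 \<kappa> L n G0 e1 by (intro add_mono mult_left_mono) auto
      finally show ?thesis by (simp add: algebra_simps)
    qed
    ultimately show ?thesis by (simp add: algebra_simps)
  qed
  have Tz: "\<gamma> / 2 * T z = \<gamma> / 2 * P z + \<gamma> * f z" unfolding P_eq by (simp add: algebra_simps)
  \<comment> \<open>Noise and contraction contribute \<open>\<gamma> / 2 * T y\<close> and,
    approximately, \<open>- (\<gamma> / 2 * P z)\<close>; after replacing \<open>y\<close> by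
    \<open>z\<close> in the trace, their sum is \<open>\<gamma> * f z\<close>.\<close>
  have "(\<integral>u. \<phi> (y + sqrt \<gamma> *\<^sub>R u) \<partial>law) - \<phi> z - \<gamma> * f z =
     ((\<integral>u. \<phi> (y + sqrt \<gamma> *\<^sub>R u) \<partial>law) - \<phi> y - \<gamma> / 2 * T y) + (\<gamma> / 2 * T y - \<gamma> / 2 * T z)
     + (\<gamma> / 2 * P z - (1 - \<rho>) * (z \<bullet> g (s *\<^sub>R z)))"
    using inc Tz by linarith
  moreover have "(d * \<kappa> * law_moment) * e \<le> (d * \<kappa> * law_moment) * (e * n)"
    using d0 \<kappa> law_moment(2) e0 n by (intro mult_left_mono) (auto simp: mult_le_cancel_left1)
  ultimately have "\<bar>(\<integral>u. \<phi> (y + sqrt \<gamma> *\<^sub>R u) \<partial>law) - \<phi> z - \<gamma> * f z\<bar> \<le>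
     (d * \<kappa> * law_moment) * (e * n) + d * \<kappa> * (e * n) + (d * \<kappa> + 2 * L + 2 * G) * (e * n)"
    using mean A B by linarith
  also have "\<dots> = (d * \<kappa> * (law_moment + 2) + 2 * L + 2 * G) * (e * n)" by (simp add: algebra_simps)
  finally show ?thesis unfolding y_def \<rho>_def d_def e_def n_def .
qed

section \<open>From one step to the weighted sum\<close>

lemma Zn_step:
  assumes "k \<ge> 1"
  shows "Zn U k \<omega> = sqrt (1 - step k) *\<^sub>R Zn U (k - 1) \<omega> + sqrt (step k) *\<^sub>R U k \<omega>"
proof -
  obtain j where j: "k = Suc j" using assms by (cases k) auto
  have "1 - step (Suc j) = real j / real (Suc j)" by (simp add: step_def field_simps)
  then have "sqrt (1 - step (Suc j)) = sqrt (real j) / sqrt (real (Suc j))" by (simp only: real_sqrt_divide)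
  moreover have "sqrt (step (Suc j)) = 1 / sqrt (real (Suc j))" by (simp add: step_def real_sqrt_divide)
  ultimately show ?thesis
    unfolding j by (simp add: Zn_def scaleR_add_right)
qed

text \<open>Indexed by the state from which a step starts: the error of step \<open>Suc k\<close> is
  measured by \<open>1 + norm (Zn U k \<omega>)\<close>, so \<open>weight k\<close> is
  \<open>step (Suc k)\<close> to the power 5/4.\<close>

definition weight :: "nat \<Rightarrow> real" where "weight k = (1 / (real k + 1)) powr (5 / 4)"

lemma weight_nonneg: "0 \<le> weight k"
  by (simp add: weight_def)

lemma summable_weight: "summable weight"
proof -
  have "weight = (\<lambda>k. real (Suc k) powr (- (5 / 4)))"
  proof
    fix k
    have "(1 / (real k + 1)) powr (5 / 4) = 1 powr (5 / 4) / (real k + 1) powr (5 / 4)" by (rule powr_divide)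
    also have "\<dots> = real (Suc k) powr (- (5 / 4))" by (simp only: powr_minus_divide powr_one_eq_one of_nat_Suc add.commute)
    finally show "weight k = real (Suc k) powr (- (5 / 4))" by (simp only: weight_def)
  qed
  moreover have "summable (\<lambda>k. real (Suc k) powr (- (5 / 4)))"
    unfolding summable_Suc_iff[of "\<lambda>k. real k powr (- (5 / 4))"] by (simp add: summable_real_powr_iff)
  ultimately show ?thesis by (simp only: )
qed

lemma step_weight: "k \<ge> 1 \<Longrightarrow> step k powr (5 / 4) = weight (k - 1)"
  by (cases k) (simp_all add: step_def weight_def add.commute)

text \<open>The difference is 1 / (k (k + 1)), and 1 / k is at most 2 / (k + 1). As the exponent 2
  exceeds 5/4, \<open>weight\<close> also dominates the terms from summation by parts.\<close>

lemma step_diff: "k \<ge> 1 \<Longrightarrow> 0 \<le> step k - step (Suc k) \<and> step k - step (Suc k) \<le> 2 * weight k"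
proof -
  assume k: "k \<ge> 1"
  define t where "t = 1 / (real k + 1)"
  have t: "0 < t" "t \<le> 1" using k by (auto simp: t_def)
  have "step k - step (Suc k) = t * (1 / real k)" using k by (simp add: step_def t_def field_simps)
  moreover have "1 / real k \<le> 2 * t" using k by (simp add: t_def field_simps)
  ultimately have "step k - step (Suc k) \<le> 2 * (t * t)" "0 \<le> step k - step (Suc k)"
    using t k mult_left_mono[of "1 / real k" "2 * t" t] by auto
  moreover have "t * t = t powr 1 * t powr 1" using t by simp
  moreover have "\<dots> = t powr (1 + 1)" by (simp only: powr_add)
  moreover have "\<dots> \<le> weight k" unfolding weight_def t_def[symmetric] using t by (intro powr_mono') auto
  ultimately show ?thesis by linarith
qed

text \<open>Summation by parts: the sum over \<open>f (Z k)\<close> is a sum of martingale increments up to a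
  remainder with summable coefficients.\<close>

lemma sum_decomposition:
  fixes \<phi> f :: "real ^ 'd \<Rightarrow> real"
  defines "m k z \<equiv> (\<integral>u. \<phi> (sqrt (1 - step k) *\<^sub>R z + sqrt (step k) *\<^sub>R u) \<partial>law)"
  shows "(\<Sum>k = 1..n. step k * f (Zn U k \<omega>)) =
    (\<Sum>k = 1..n. m k (Zn U (k - 1) \<omega>) - \<phi> (sqrt (1 - step k) *\<^sub>R Zn U (k - 1) \<omega> + sqrt (step k) *\<^sub>R U k \<omega>))
    - (\<Sum>k = 1..n. m k (Zn U (k - 1) \<omega>) - \<phi> (Zn U (k - 1) \<omega>) - step k * f (Zn U (k - 1) \<omega>))
    + (\<phi> (Zn U n \<omega>) - \<phi> 0) + (\<Sum>k = 1..n. (step k - step (Suc k)) * f (Zn U k \<omega>))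
    + step (Suc n) * f (Zn U n \<omega>) - f 0"
proof (induction n)
  case 0
  \<comment> \<open>For \<open>n = 0\<close> the last two terms cancel because
    \<open>Zn U 0 \<omega>\<close> is 0 and \<open>step 1\<close> is 1.\<close>
  then show ?case by (simp add: Zn_def step_def)
next
  case (Suc n)
  have z: "Zn U (Suc n) \<omega> = sqrt (1 - step (Suc n)) *\<^sub>R Zn U n \<omega> + sqrt (step (Suc n)) *\<^sub>R U (Suc n) \<omega>"
    using Zn_step[of "Suc n" \<omega>] by simp
  have ivl: "sum F {1..Suc n} = sum F {1..n} + F (Suc n)" for F :: "nat \<Rightarrow> real" by simp
  show ?case
    using Suc.IH unfolding ivl diff_Suc_1 z[symmetric] left_diff_distrib[of "step (Suc n)"] by linarith
qed

text \<open>The boundary terms at \<open>Zn U n \<omega>\<close> come without a summable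
  coefficient; the extra weight \<open>of_bool (k = n)\<close> collects them, and the total weight
  stays below \<open>1 + suminf weight\<close> for every \<open>n\<close>. The coefficient 2 of
  \<open>F\<close> serves for the differences of the steps and, at the end point, for the two
  remaining values of \<open>f\<close>.\<close>

lemma remainder_bound:
  fixes \<phi> f :: "real ^ 'd \<Rightarrow> real"
  defines "m k z \<equiv> (\<integral>u. \<phi> (sqrt (1 - step k) *\<^sub>R z + sqrt (step k) *\<^sub>R u) \<partial>law)"
  assumes \<phi>: "\<And>x y. \<bar>\<phi> x - \<phi> y\<bar> \<le> G * norm (x - y)" "0 \<le> G"
    and f: "\<And>x. \<bar>f x\<bar> \<le> F * (1 + norm x)"
    and one: "\<And>\<gamma> z. 0 < \<gamma> \<Longrightarrow> \<gamma> \<le> 1 \<Longrightarrow>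
      \<bar>(\<integral>u. \<phi> (sqrt (1 - \<gamma>) *\<^sub>R z + sqrt \<gamma> *\<^sub>R u) \<partial>law) - \<phi> z - \<gamma> * f z\<bar> \<le> R * (\<gamma> powr (5 / 4) * (1 + norm z))" "0 \<le> R"
  shows "(\<Sum>k = 1..n. step k * f (Zn U k \<omega>)) \<le>
    (\<Sum>k = 1..n. m k (Zn U (k - 1) \<omega>) - \<phi> (sqrt (1 - step k) *\<^sub>R Zn U (k - 1) \<omega> + sqrt (step k) *\<^sub>R U k \<omega>))
    + (G + R + 2 * F) * (\<Sum>k\<le>n. (weight k + of_bool (k = n)) * (1 + norm (Zn U k \<omega>)))"
proof -
  let ?z = "\<lambda>k. Zn U k \<omega>"
  let ?N = "\<lambda>k. 1 + norm (?z k)"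
  define Y where "Y = (\<Sum>k\<le>n. weight k * ?N k)"
  have F0: "0 \<le> F" using f[of 0] by simp
  have Y: "(\<Sum>k\<le>n. (weight k + of_bool (k = n)) * ?N k) = Y + ?N n"
  proof -
    have "(\<Sum>k\<le>n. of_bool (k = n) * ?N k) = (\<Sum>k\<le>n. if k = n then ?N k else 0)"
      by (intro sum.cong) auto
    then show ?thesis by (simp add: Y_def distrib_right[of "weight _"] sum.distrib)
  qed
  have Y0: "0 \<le> Y" unfolding Y_def by (intro sum_nonneg mult_nonneg_nonneg weight_nonneg) auto
  have 1: "\<bar>\<Sum>k = 1..n. m k (?z (k - 1)) - \<phi> (?z (k - 1)) - step k * f (?z (k - 1))\<bar> \<le> R * Y"
  proof -
    have "\<bar>\<Sum>k = 1..n. m k (?z (k - 1)) - \<phi> (?z (k - 1)) - step k * f (?z (k - 1))\<bar> \<le> (\<Sum>k = 1..n. R * (weight (k - 1) * ?N (k - 1)))"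
    proof (rule order_trans[OF sum_abs sum_mono])
      fix k assume "k \<in> {1..n}"
      then have k: "k \<ge> 1" "0 < step k" "step k \<le> 1" by (auto simp: step_def)
      show "\<bar>m k (?z (k - 1)) - \<phi> (?z (k - 1)) - step k * f (?z (k - 1))\<bar> \<le> R * (weight (k - 1) * ?N (k - 1))"
        using one(1)[OF k(2,3), of "?z (k - 1)"] unfolding m_def step_weight[OF k(1)] .
    qed
    also have "\<dots> = R * (\<Sum>k<n. weight k * ?N k)"
      unfolding sum_distrib_left by (rule sum.reindex_bij_witness[of _ Suc "\<lambda>k. k - 1"]) auto
    also have "\<dots> \<le> R * Y"
      unfolding Y_def by (intro mult_left_mono one sum_mono2) (auto intro!: mult_nonneg_nonneg weight_nonneg)
    finally show ?thesis .
  qed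
  have 2: "\<bar>\<Sum>k = 1..n. (step k - step (Suc k)) * f (?z k)\<bar> \<le> 2 * F * Y"
  proof -
    have "\<bar>\<Sum>k = 1..n. (step k - step (Suc k)) * f (?z k)\<bar> \<le> (\<Sum>k = 1..n. 2 * F * (weight k * ?N k))"
    proof (rule order_trans[OF sum_abs sum_mono])
      fix k assume "k \<in> {1..n}"
      then have k: "k \<ge> 1" by auto
      have "\<bar>(step k - step (Suc k)) * f (?z k)\<bar> \<le> (2 * weight k) * (F * ?N k)"
        unfolding abs_mult using step_diff[OF k] f weight_nonneg by (intro mult_mono) auto
      then show "\<bar>(step k - step (Suc k)) * f (?z k)\<bar> \<le> 2 * F * (weight k * ?N k)" by (simp add: mult_ac)
    qed
    also have "\<dots> = 2 * F * (\<Sum>k = 1..n. weight k * ?N k)" by (simp add: sum_distrib_left)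
    also have "\<dots> \<le> 2 * F * Y"
      unfolding Y_def using F0 by (intro mult_left_mono sum_mono2) (auto intro!: mult_nonneg_nonneg weight_nonneg)
    finally show ?thesis .
  qed
  have 3: "\<bar>\<phi> (?z n) - \<phi> 0\<bar> \<le> G * ?N n"
    using \<phi>(1)[of "?z n" 0] \<phi>(2) by (simp add: distrib_left)
  have 4: "\<bar>step (Suc n) * f (?z n)\<bar> \<le> F * ?N n"
  proof -
    have "\<bar>step (Suc n) * f (?z n)\<bar> \<le> 1 * (F * ?N n)"
      unfolding abs_mult using f by (intro mult_mono) (auto simp: step_def)
    then show ?thesis by simp
  qed
  have 5: "\<bar>f 0\<bar> \<le> F * ?N n" using f[of 0] F0 mult_left_mono[of 1 "?N n" F] by simp
  have "0 \<le> G * Y" "0 \<le> R * ?N n" using \<phi>(2) one(2) Y0 by auto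
  then have "R * Y + 2 * F * Y + G * ?N n + F * ?N n + F * ?N n \<le> (G + R + 2 * F) * (Y + ?N n)"
    by (simp add: algebra_simps)
  then show ?thesis
    unfolding Y sum_decomposition[where f = f and n = n and \<omega> = \<omega> and \<phi> = \<phi>, folded m_def] using 1 2 3 4 5 by linarith
qed

text \<open>The argument is \<open>1 / sqrt (step_sum n)\<close>. The factor
  \<open>1 + x\<^sup>2\<close> is the quotient of \<open>step_sum n + 1\<close> and
  \<open>step_sum n\<close>, \<open>1 + x\<close> is the Hoelder exponent of the martingale, and the
  \<kappa> term is the contribution of the remainder relative to the martingale variance, \<kappa>
  being the squared ratio of their constants.\<close>

definition rate :: "real \<Rightarrow> real \<Rightarrow> real" where
  "rate \<kappa> x = 1 / ((1 + x\<^sup>2) * (1 + x + \<kappa> * ((real CARD('d))\<^sup>2 * (x\<^sup>2 + x) + x)))"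

text \<open>The first summand is the logarithm of the factor 2 of \<open>exp_norm_Zn\<close> raised
  to the power \<open>1 / q\<close>, the second the loss from completing a square in
  \<open>one_sided_deviation\<close>.\<close>

definition prefactor :: "real \<Rightarrow> real" where
  "prefactor x = exp (ln 2 * (x / (1 + x)) + x / 2)"

text \<open>A pointwise form of Hoelder's inequality, by convexity of exp: if
  \<open>exp (p * A)\<close> and \<open>exp (q * B)\<close> have means at most
  \<open>exp (p * a)\<close> and \<open>exp (q * b)\<close>, then integration bounds the mean of
  \<open>exp (A + B)\<close> by \<open>exp (a + b)\<close>.\<close>

lemma exp_combination:
  fixes A B a b :: real
  assumes "p > 0" "q > 0" "1 / p + 1 / q = 1"
  shows "exp (A + B) \<le> exp (a + b) * ((1 / p) * (exp (p * A) * exp (- (p * a))) + (1 / q) * (exp (q * B) * exp (- (q * b))))"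
proof -
  have "exp ((1 / p) *\<^sub>R (p * (A - a)) + (1 / q) *\<^sub>R (q * (B - b))) \<le> (1 / p) * exp (p * (A - a)) + (1 / q) * exp (q * (B - b))"
  proof -
    have "exp (u *\<^sub>R s + v *\<^sub>R t) \<le> u * exp s + v * exp t" if "0 \<le> u" "0 \<le> v" "u + v = 1" for u v s t :: real
      using exp_convex that unfolding convex_on_def by blast
    from this[of "1 / p" "1 / q" "p * (A - a)" "q * (B - b)"] show ?thesis using assms by simp
  qed
  moreover have "(1 / p) *\<^sub>R (p * (A - a)) + (1 / q) *\<^sub>R (q * (B - b)) = A - a + (B - b)" using assms by simp
  ultimately have "exp (A - a + (B - b)) \<le> (1 / p) * exp (p * (A - a)) + (1 / q) * exp (q * (B - b))" by simp
  then have "exp (a + b) * exp (A - a + (B - b)) \<le> exp (a + b) * ((1 / p) * exp (p * (A - a)) + (1 / q) * exp (q * (B - b)))"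
    by (rule mult_left_mono) simp
  moreover have "exp (a + b) * exp (A - a + (B - b)) = exp (A + B)" by (simp flip: exp_add)
  ultimately show ?thesis by (simp add: right_diff_distrib exp_diff exp_minus divide_inverse)
qed

text \<open>Hoelder's inequality with exponents \<open>p \<rightarrow> 1\<close> and \<open>q \<rightarrow> \<infinity>\<close> separates the martingale from
  the remainder; only the martingale contributes to the variance asymptotically.\<close>

lemma one_sided_deviation:
  fixes \<phi> f :: "real ^ 'd \<Rightarrow> real"
  assumes \<phi>: "\<And>x y. \<bar>\<phi> x - \<phi> y\<bar> \<le> G * norm (x - y)" "0 < G"
    and fm: "f \<in> borel_measurable borel"
    and f: "\<And>x. \<bar>f x\<bar> \<le> F * (1 + norm x)"
    and one: "\<And>\<gamma> z. 0 < \<gamma> \<Longrightarrow> \<gamma> \<le> 1 \<Longrightarrow>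
      \<bar>(\<integral>u. \<phi> (sqrt (1 - \<gamma>) *\<^sub>R z + sqrt \<gamma> *\<^sub>R u) \<partial>law) - \<phi> z - \<gamma> * f z\<bar> \<le> R * (\<gamma> powr (5 / 4) * (1 + norm z))" "0 \<le> R"
    and n: "n \<ge> 1" and b: "b > 0"
  defines "K \<equiv> (G + R + 2 * F) * (1 + suminf weight)"
  shows "prob {\<omega> \<in> space M. b \<le> (\<Sum>k = 1..n. step k * f (Zn U k \<omega>))} \<le>
    prefactor (1 / sqrt (step_sum n)) *
    exp (- (rate (K\<^sup>2 / G\<^sup>2) (1 / sqrt (step_sum n)) * (b\<^sup>2 * (step_sum n + 1) / (2 * (step_sum n)\<^sup>2 * G\<^sup>2))))"
proof -
  define d where "d = real CARD('d)"
  define \<Gamma> where "\<Gamma> = step_sum n"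
  define x where "x = 1 / sqrt \<Gamma>"
  define K0 where "K0 = G + R + 2 * F"
  define W where "W = 1 + suminf weight"
  \<comment> \<open>The conjugate exponents balance two losses: \<open>p\<close> tends to 1, while
    \<open>q\<close> is of order \<open>sqrt \<Gamma>\<close> and hence negligible against the
    martingale variance of order \<Gamma>.\<close>
  define p where "p = 1 + x"
  define q where "q = (1 + x) / x"
  \<comment> \<open>The effective variance: the martingale, the sub-Gaussian part of the remainder,
    and its linear part after completing a square. The choice of \<mu> minimizes
    \<open>\<mu>\<^sup>2 * V / 2 - \<mu> * b\<close>.\<close>
  define V where "V = p * \<Gamma> * G\<^sup>2 + q * (K\<^sup>2 * d\<^sup>2) + K\<^sup>2 / x"
  define \<mu> where "\<mu> = b / V"
  \<comment> \<open>\<open>p * a\<close> and \<open>q * \<beta>\<close> bound the logarithmic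
    moments of the two parts in \<open>EN\<close> and \<open>EY\<close>; \<open>a\<close> and
    \<beta> are the free constants of \<open>exp_combination\<close>.\<close>
  define a where "a = p * \<mu>\<^sup>2 * \<Gamma> * G\<^sup>2 / 2"
  define \<beta> where "\<beta> = ln 2 / q + \<mu> * K + q * \<mu>\<^sup>2 * K\<^sup>2 * d\<^sup>2 / 2"
  have KW: "K = K0 * W" by (simp add: K_def K0_def W_def)
  have F0: "0 \<le> F" using f[of 0] by simp
  have K0: "0 \<le> K0" using \<phi>(2) one(2) F0 by (simp add: K0_def)
  have \<Gamma>1: "1 \<le> \<Gamma>"
  proof -
    have "(\<Sum>k\<in>{1..1}. step k) \<le> \<Gamma>" unfolding \<Gamma>_def step_sum_def
      by (rule sum_mono2) (use n in \<open>auto simp: step_def\<close>)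
    then show ?thesis by (simp add: step_def)
  qed
  have x: "0 < x" "x\<^sup>2 = 1 / \<Gamma>" using \<Gamma>1 by (simp_all add: x_def power_divide)
  have pq: "p > 0" "q > 0" "1 / p + 1 / q = 1"
    using x by (simp_all add: p_def q_def divide_simps)
  have V0: "V > 0" unfolding V_def using pq x \<Gamma>1 \<phi>(2)
    by (intro add_pos_nonneg mult_pos_pos mult_nonneg_nonneg divide_nonneg_nonneg) auto
  have \<mu>: "\<mu> > 0" using b V0 by (simp add: \<mu>_def)
  define m where "m k z = (\<integral>u. \<phi> (sqrt (1 - step k) *\<^sub>R z + sqrt (step k) *\<^sub>R u) \<partial>law)" for k z
  define D where "D k z u = m k z - \<phi> (sqrt (1 - step k) *\<^sub>R z + sqrt (step k) *\<^sub>R u)" for k z u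
  define w where "w k = weight k + of_bool (k = n)" for k
  define S where "S \<omega> = (\<Sum>k = 1..n. step k * f (Zn U k \<omega>))" for \<omega>
  define N where "N \<omega> = (\<Sum>k = 1..n. D k (Zn U (k - 1) \<omega>) (U k \<omega>))" for \<omega>
  define Y where "Y \<omega> = (\<Sum>k\<le>n. w k * (1 + norm (Zn U k \<omega>)))" for \<omega>
  have \<phi>m[measurable]: "\<phi> \<in> borel_measurable borel" using \<phi> by (intro lipschitz_measurable[of \<phi> G]) auto
  have Sle: "S \<omega> \<le> N \<omega> + K0 * Y \<omega>" for \<omega>
    unfolding S_def N_def D_def m_def Y_def w_def K0_def
    by (rule remainder_bound[OF \<phi>(1) less_imp_le[OF \<phi>(2)] f one])
  have mm: "m k \<in> borel_measurable borel" for k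
    unfolding m_def[abs_def] by measurable
  have Dm: "(\<lambda>p. D k (fst p) (snd p)) \<in> borel_measurable (borel \<Otimes>\<^sub>M borel)" for k
    unfolding D_def using measurable_compose[OF measurable_fst mm] by measurable
  have Nm[measurable]: "N \<in> borel_measurable M"
    unfolding N_def[abs_def]
  proof (intro borel_measurable_sum)
    fix k assume "k \<in> {1..n}"
    then have "U k \<in> borel_measurable M" by (intro U_measurable) auto
    from measurable_compose[OF measurable_Pair[OF Zn_measurable this] Dm[of k]]
    show "(\<lambda>\<omega>. D k (Zn U (k - 1) \<omega>) (U k \<omega>)) \<in> borel_measurable M" by (simp only: fst_conv snd_conv)
  qed
  have Ym[measurable]: "Y \<in> borel_measurable M" unfolding Y_def[abs_def] by measurable
  have fZ: "(\<lambda>\<omega>. f (Zn U k \<omega>)) \<in> borel_measurable M" for k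
    by (rule measurable_compose[OF Zn_measurable fm])
  have Sm[measurable]: "S \<in> borel_measurable M" unfolding S_def[abs_def]
    by (intro borel_measurable_sum borel_measurable_times borel_measurable_const fZ)
  have EN: "(\<integral>\<^sup>+\<omega>. ennreal (exp (p * (\<mu> * N \<omega>))) \<partial>M) \<le> ennreal (exp (p * a))"
  proof -
    \<comment> \<open>As a function of \<open>U k\<close> the increment has Lipschitz constant
      \<open>sqrt (step k) * G\<close>, so the squared constants add up to
      \<open>\<Gamma> * G\<^sup>2\<close>.\<close>
    define c where "c k = (p * \<mu>)\<^sup>2 * (sqrt (step k) * G)\<^sup>2 / 2" for k
    have "(\<integral>\<^sup>+\<omega>. ennreal (exp (\<Sum>k = 1..n. (p * \<mu>) * D k (Zn U (k - 1) \<omega>) (U k \<omega>))) \<partial>M) \<le> ennreal (exp (\<Sum>k = 1..n. c k))"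
    proof (rule exp_sum_bound[where D = "\<lambda>k z u. (p * \<mu>) * D k z u"])
      show "(\<lambda>s. (p * \<mu>) * D k (fst s) (snd s)) \<in> borel_measurable (borel \<Otimes>\<^sub>M borel)" for k
        by (intro borel_measurable_times borel_measurable_const Dm)
      fix k :: nat and z assume k: "k \<ge> 1"
      let ?g = "\<lambda>u. - \<phi> (sqrt (1 - step k) *\<^sub>R z + sqrt (step k) *\<^sub>R u)"
      have sk: "0 < step k" using k by (simp add: step_def)
      have "\<bar>?g u - ?g v\<bar> \<le> (sqrt (step k) * G) * norm (u - v)" for u v
      proof -
        have "\<bar>?g u - ?g v\<bar> \<le> G * norm ((sqrt (1 - step k) *\<^sub>R z + sqrt (step k) *\<^sub>R v) - (sqrt (1 - step k) *\<^sub>R z + sqrt (step k) *\<^sub>R u))"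
          using \<phi>(1)[of "sqrt (1 - step k) *\<^sub>R z + sqrt (step k) *\<^sub>R v" "sqrt (1 - step k) *\<^sub>R z + sqrt (step k) *\<^sub>R u"] by simp
        also have "\<dots> = (sqrt (step k) * G) * norm (u - v)"
          using sk by (simp add: norm_minus_commute flip: scaleR_diff_right)
        finally show ?thesis .
      qed
      from law_concentration[OF this, of "p * \<mu>"]
      have "(\<integral>\<^sup>+u. ennreal (exp ((p * \<mu>) * (?g u - (\<integral>u. ?g u \<partial>law)))) \<partial>law) \<le> ennreal (exp (c k))"
        unfolding c_def using pq \<mu> sk \<phi>(2) by simp
      moreover have "?g u - (\<integral>u. ?g u \<partial>law) = D k z u" for u by (simp add: D_def m_def)
      ultimately show "(\<integral>\<^sup>+u. ennreal (exp ((p * \<mu>) * D k z u)) \<partial>law) \<le> ennreal (exp (c k))" by (simp only:)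
    qed
    also have "(\<Sum>k = 1..n. c k) = p * a"
    proof -
      have ck: "c k = (p * \<mu>)\<^sup>2 * G\<^sup>2 / 2 * step k" for k by (simp add: c_def power_mult_distrib step_def)
      have "(\<Sum>k = 1..n. c k) = (p * \<mu>)\<^sup>2 * G\<^sup>2 / 2 * \<Gamma>"
        unfolding \<Gamma>_def step_sum_def sum_distrib_left by (intro sum.cong refl ck)
      then show ?thesis by (simp add: a_def power2_eq_square mult_ac)
    qed
    finally show ?thesis by (simp add: N_def sum_distrib_left mult.assoc)
  qed
  have EY: "(\<integral>\<^sup>+\<omega>. ennreal (exp (q * (\<mu> * (K0 * Y \<omega>)))) \<partial>M) \<le> ennreal (exp (q * \<beta>))"
  proof -
    have wsum: "(\<Sum>k\<le>n. w k) = (\<Sum>k\<le>n. weight k) + 1" by (simp add: w_def sum.distrib of_bool_def)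
    have s0: "0 \<le> (\<Sum>k\<le>n. weight k)" by (intro sum_nonneg weight_nonneg)
    have "(\<Sum>k\<le>n. weight k) \<le> suminf weight" by (intro sum_le_suminf summable_weight) (auto intro: weight_nonneg)
    then have "(\<integral>\<^sup>+\<omega>. ennreal (exp ((q * \<mu> * K0) * Y \<omega>)) \<partial>M) \<le> ennreal (exp ((q * \<mu> * K0) * W) * (2 * exp (((q * \<mu> * K0) * W * d)\<^sup>2 / 2)))"
      unfolding Y_def d_def using wsum s0 pq \<mu> K0 weight_nonneg
      by (intro exp_weighted_norm_Zn) (auto simp: W_def w_def intro!: add_nonneg_nonneg)
    also have "exp ((q * \<mu> * K0) * W) * (2 * exp (((q * \<mu> * K0) * W * d)\<^sup>2 / 2)) = exp (q * \<beta>)"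
    proof -
      have "q * \<beta> = (q * \<mu> * K0) * W + ln 2 + ((q * \<mu> * K0) * W * d)\<^sup>2 / 2"
        using pq(2) by (simp add: \<beta>_def KW power2_eq_square algebra_simps)
      then show ?thesis by (simp add: exp_add)
    qed
    finally show ?thesis by (simp add: mult.assoc)
  qed
  have final_exp: "a + \<beta> - \<mu> * b \<le> ln 2 * (x / (1 + x)) + x / 2 - b\<^sup>2 / (2 * V)"
  proof -
    \<comment> \<open>The term linear in \<mu> is absorbed with the weight \<open>x\<close>: the
      constant left over is \<open>x / 2\<close>, which tends to 0, and \<open>K\<^sup>2 / x\<close>
      is again of order \<open>sqrt \<Gamma>\<close> only.\<close>
    have am: "\<mu> * K \<le> \<mu>\<^sup>2 * (K\<^sup>2 / x) / 2 + x / 2"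
    proof -
      have "0 \<le> (\<mu> * K - x)\<^sup>2 / x" using x by simp
      also have "(\<mu> * K - x)\<^sup>2 / x = \<mu>\<^sup>2 * (K\<^sup>2 / x) + x - 2 * (\<mu> * K)"
        using x by (simp add: power2_eq_square field_simps)
      finally show ?thesis by simp
    qed
    have "ln 2 / q = ln 2 * (x / (1 + x))" by (simp add: q_def)
    moreover have "a + q * \<mu>\<^sup>2 * K\<^sup>2 * d\<^sup>2 / 2 + \<mu>\<^sup>2 * (K\<^sup>2 / x) / 2 = \<mu>\<^sup>2 * V / 2"
      by (simp add: a_def V_def algebra_simps add_divide_distrib)
    moreover have "\<mu>\<^sup>2 * V / 2 - \<mu> * b = - (b\<^sup>2 / (2 * V))"
      using V0 by (simp add: \<mu>_def power2_eq_square field_simps)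
    ultimately show ?thesis using am unfolding \<beta>_def by linarith
  qed
  \<comment> \<open>Since \<open>\<Gamma> * x\<^sup>2 = 1\<close>, the variance is
    \<open>V = \<Gamma> * G\<^sup>2 * r\<close> with \<open>r\<close> the second factor in the
    denominator of \<open>rate\<close>; the factor \<open>\<Gamma> + 1\<close> prepares the
    comparison with \<open>ln (real n) + 1\<close>.\<close>
  have rate_eq: "b\<^sup>2 / (2 * V) = rate (K\<^sup>2 / G\<^sup>2) x * (b\<^sup>2 * (\<Gamma> + 1) / (2 * \<Gamma>\<^sup>2 * G\<^sup>2))"
  proof -
    define r where "r = 1 + x + (K\<^sup>2 / G\<^sup>2) * (d\<^sup>2 * (x\<^sup>2 + x) + x)"
    have G2: "G\<^sup>2 > 0" using \<phi>(2) by simp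
    have xx: "\<Gamma> * x\<^sup>2 = 1" using x \<Gamma>1 by simp
    have "\<Gamma> * G\<^sup>2 * r = \<Gamma> * G\<^sup>2 * p + K\<^sup>2 * d\<^sup>2 * (\<Gamma> * x\<^sup>2 + \<Gamma> * x) + K\<^sup>2 * (\<Gamma> * x)"
      using G2 by (simp add: r_def p_def field_simps)
    moreover have "\<Gamma> * x = 1 / x" using xx x(1) by (simp add: field_simps power2_eq_square)
    moreover have "q = 1 / x + 1" using x(1) by (simp add: q_def field_simps)
    ultimately have V: "V = \<Gamma> * G\<^sup>2 * r" using xx by (simp add: V_def algebra_simps)
    have r0: "r > 0" unfolding r_def using x(1) by (intro add_pos_nonneg mult_nonneg_nonneg add_nonneg_nonneg) auto
    have g1: "\<Gamma> + 1 = \<Gamma> * (1 + x\<^sup>2)" using xx by (simp add: algebra_simps)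
    have x1: "1 + x\<^sup>2 > 0" by (simp add: add_pos_nonneg)
    have "rate (K\<^sup>2 / G\<^sup>2) x = 1 / ((1 + x\<^sup>2) * r)" by (simp add: rate_def r_def d_def)
    then show ?thesis unfolding V g1 using r0 x1 \<Gamma>1 G2 by (simp add: power2_eq_square[of \<Gamma>])
  qed
  have "emeasure M {\<omega> \<in> space M. b \<le> S \<omega>} = (\<integral>\<^sup>+\<omega>. indicator {\<omega> \<in> space M. b \<le> S \<omega>} \<omega> \<partial>M)"
    by (rule nn_integral_indicator[symmetric]) measurable
  also have "\<dots> \<le> (\<integral>\<^sup>+\<omega>. ennreal (exp (a + \<beta> - \<mu> * b)) * (ennreal (1 / p * exp (- (p * a))) * ennreal (exp (p * (\<mu> * N \<omega>))) +
      ennreal (1 / q * exp (- (q * \<beta>))) * ennreal (exp (q * (\<mu> * (K0 * Y \<omega>))))) \<partial>M)"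
  proof (rule nn_integral_mono)
    fix \<omega>
    let ?B = "exp (a + \<beta> - \<mu> * b) * (1 / p * exp (- (p * a)) * exp (p * (\<mu> * N \<omega>)) + 1 / q * exp (- (q * \<beta>)) * exp (q * (\<mu> * (K0 * Y \<omega>))))"
    \<comment> \<open>Chernoff's argument in pointwise form: on the event,
      \<open>exp (\<mu> * (N \<omega> + K0 * Y \<omega> - b))\<close> is at least 1, and
      \<open>exp_combination\<close> separates the two parts.\<close>
    have "1 \<le> ?B" if "b \<le> S \<omega>"
    proof -
      have "\<mu> * b \<le> \<mu> * (N \<omega> + K0 * Y \<omega>)" using that Sle[of \<omega>] \<mu> by (intro mult_left_mono) auto
      then have "1 \<le> exp (- (\<mu> * b)) * exp (\<mu> * N \<omega> + \<mu> * (K0 * Y \<omega>))"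
        by (simp add: distrib_left flip: exp_add)
      also have "\<dots> \<le> exp (- (\<mu> * b)) * (exp (a + \<beta>) * ((1 / p) * (exp (p * (\<mu> * N \<omega>)) * exp (- (p * a))) + (1 / q) * (exp (q * (\<mu> * (K0 * Y \<omega>))) * exp (- (q * \<beta>)))))"
        by (intro mult_left_mono exp_combination pq) simp
      also have "\<dots> = ?B"
      proof -
        have "exp (a + \<beta> - \<mu> * b) = exp (- (\<mu> * b)) * exp (a + \<beta>)" by (simp flip: exp_add)
        then show ?thesis by (simp only: mult_ac)
      qed
      finally show ?thesis .
    qed
    then have "indicator {\<omega> \<in> space M. b \<le> S \<omega>} \<omega> \<le> ennreal ?B"
      by (auto simp: indicator_def simp flip: ennreal_1 intro!: ennreal_leI)
    also have "ennreal ?B = ennreal (exp (a + \<beta> - \<mu> * b)) * (ennreal (1 / p * exp (- (p * a))) * ennreal (exp (p * (\<mu> * N \<omega>))) +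
      ennreal (1 / q * exp (- (q * \<beta>))) * ennreal (exp (q * (\<mu> * (K0 * Y \<omega>)))))"
      using pq by (simp only: ennreal_mult_add[OF exp_ge_zero] ennreal_mult[OF _ exp_ge_zero] mult_nonneg_nonneg exp_ge_zero divide_nonneg_pos zero_le_one)
    finally show "indicator {\<omega> \<in> space M. b \<le> S \<omega>} \<omega> \<le> ennreal (exp (a + \<beta> - \<mu> * b)) * (ennreal (1 / p * exp (- (p * a))) * ennreal (exp (p * (\<mu> * N \<omega>))) +
      ennreal (1 / q * exp (- (q * \<beta>))) * ennreal (exp (q * (\<mu> * (K0 * Y \<omega>)))))" .
  qed
  also have "\<dots> = ennreal (exp (a + \<beta> - \<mu> * b)) * (ennreal (1 / p * exp (- (p * a))) * (\<integral>\<^sup>+\<omega>. ennreal (exp (p * (\<mu> * N \<omega>))) \<partial>M) +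
      ennreal (1 / q * exp (- (q * \<beta>))) * (\<integral>\<^sup>+\<omega>. ennreal (exp (q * (\<mu> * (K0 * Y \<omega>)))) \<partial>M))"
    by (simp add: nn_integral_cmult nn_integral_add)
  also have "\<dots> \<le> ennreal (exp (a + \<beta> - \<mu> * b)) * (ennreal (1 / p * exp (- (p * a))) * ennreal (exp (p * a)) +
      ennreal (1 / q * exp (- (q * \<beta>))) * ennreal (exp (q * \<beta>)))"
    by (intro mult_left_mono add_mono EN EY) auto
  also have "\<dots> = ennreal (exp (a + \<beta> - \<mu> * b) * (1 / p + 1 / q))"
  proof -
    have h: "ennreal (1 / r * exp (- s)) * ennreal (exp s) = ennreal (1 / r)" if "r > 0" for r s :: real
      using that by (simp add: exp_minus flip: ennreal_mult)
    show ?thesis unfolding h[OF pq(1)] h[OF pq(2)]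
      by (rule ennreal_mult_add[symmetric]) (use pq in auto)
  qed
  finally have "emeasure M {\<omega> \<in> space M. b \<le> S \<omega>} \<le> ennreal (exp (a + \<beta> - \<mu> * b))" using pq(3) by simp
  then have "prob {\<omega> \<in> space M. b \<le> S \<omega>} \<le> exp (a + \<beta> - \<mu> * b)" by (simp add: emeasure_eq_measure)
  also have "\<dots> \<le> exp (ln 2 * (x / (1 + x)) + x / 2 - b\<^sup>2 / (2 * V))" using final_exp by simp
  also have "\<dots> = prefactor x * exp (- (b\<^sup>2 / (2 * V)))" by (simp add: prefactor_def flip: exp_add)
  finally show ?thesis unfolding rate_eq by (simp add: S_def x_def \<Gamma>_def)
qed

section \<open>Monotonicity and limits of the explicit constants\<close>

lemma rate_antimono:
  assumes \<kappa>: "\<kappa> \<ge> 0" and x: "0 \<le> x" "x \<le> y"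
  shows "rate \<kappa> y \<le> rate \<kappa> x"
proof -
  have sq: "x\<^sup>2 \<le> y\<^sup>2" using x by (intro power_mono) auto
  define d where "d = (real CARD('d))\<^sup>2"
  have d: "0 \<le> d" by (simp add: d_def)
  have "d * (x\<^sup>2 + x) + x \<le> d * (y\<^sup>2 + y) + y" using d x sq by (intro add_mono mult_left_mono) auto
  then have "\<kappa> * (d * (x\<^sup>2 + x) + x) \<le> \<kappa> * (d * (y\<^sup>2 + y) + y)" using \<kappa> by (rule mult_left_mono)
  moreover have "0 \<le> \<kappa> * (d * (x\<^sup>2 + x) + x)" using \<kappa> d x by (intro mult_nonneg_nonneg add_nonneg_nonneg) auto
  ultimately have "(1 + x\<^sup>2) * (1 + x + \<kappa> * (d * (x\<^sup>2 + x) + x)) \<le> (1 + y\<^sup>2) * (1 + y + \<kappa> * (d * (y\<^sup>2 + y) + y))"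
    using sq x by (intro mult_mono) (auto intro!: add_nonneg_nonneg)
  moreover have "0 < (1 + x\<^sup>2) * (1 + x + \<kappa> * (d * (x\<^sup>2 + x) + x))"
    using x \<open>0 \<le> \<kappa> * (d * (x\<^sup>2 + x) + x)\<close> by (intro mult_pos_pos add_pos_nonneg) auto
  ultimately show ?thesis unfolding rate_def d_def[symmetric] by (intro frac_le) auto
qed

lemma rate_0: "rate \<kappa> 0 = 1"
  by (simp add: rate_def)

lemma rate_tendsto: "(x \<longlongrightarrow> 0) F \<Longrightarrow> ((\<lambda>n. rate \<kappa> (x n)) \<longlongrightarrow> 1) F"
  unfolding rate_def by (auto intro!: tendsto_eq_intros)

lemma prefactor_mono:
  assumes x: "0 \<le> x" "x \<le> y" shows "prefactor x \<le> prefactor y"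
proof -
  have "x / (1 + x) \<le> y / (1 + y)" using x by (simp add: divide_simps) (simp add: algebra_simps)
  then have "ln 2 * (x / (1 + x)) \<le> ln 2 * (y / (1 + y))" by (intro mult_left_mono) auto
  then show ?thesis unfolding prefactor_def using x by simp
qed

lemma prefactor_0: "prefactor 0 = 1"
  by (simp add: prefactor_def)

lemma prefactor_tendsto: "(x \<longlongrightarrow> 0) F \<Longrightarrow> ((\<lambda>n. prefactor (x n)) \<longlongrightarrow> 1) F"
  unfolding prefactor_def by (auto intro!: tendsto_eq_intros)

end

section \<open>From one-sided bounds to the deviation inequality\<close>

lemma step_sum_eq_harm: "step_sum n = harm n"
  by (simp add: step_sum_def step_def harm_def inverse_eq_divide)

text \<open>The hypothesis makes the supremum finite, and the existence of two distinct points makes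
  it nonnegative.\<close>

lemma lipschitz_lip_const:
  fixes f :: "real ^ 'd::finite \<Rightarrow> real"
  assumes "\<exists>L. L-lipschitz_on UNIV f"
  shows "(lip_const f)-lipschitz_on UNIV f"
proof -
  obtain L where L: "L-lipschitz_on UNIV f" using assms by blast
  let ?q = "\<lambda>(x, y). \<bar>f x - f y\<bar> / norm (x - y)"
  have "bdd_above (?q ` {(x, y). x \<noteq> y})"
  proof (rule bdd_aboveI2[where M = L])
    fix p :: "(real ^ 'd) \<times> (real ^ 'd)" assume "p \<in> {(x, y). x \<noteq> y}"
    then show "?q p \<le> L"
      using lipschitz_onD[OF L, of "fst p" "snd p"] by (auto simp: dist_norm divide_simps split: prod.splits)
  qed
  then have up: "\<bar>f x - f y\<bar> / norm (x - y) \<le> lip_const f" if "x \<noteq> y" for x y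
    unfolding lip_const_def using cSUP_upper[of "(x, y)" "{(x, y). x \<noteq> y}" ?q] that by auto
  show ?thesis
  proof (rule lipschitz_onI)
    fix x y
    show "dist (f x) (f y) \<le> lip_const f * dist x y"
      using up[of x y] by (cases "x = y") (auto simp: dist_norm divide_simps)
    have "axis undefined 1 \<noteq> (0 :: real ^ 'd)" by (simp add: axis_eq_0_iff)
    from up[OF this] show "0 \<le> lip_const f" by (rule order_trans[rotated]) simp
  qed
qed

context gc_sequence
begin

text \<open>Applied to \<phi> and \<open>f\<close> and to their negatives, the one-sided bound gives
  the factor 2. The event is first rewritten for the unnormalized sum, at the level
  \<open>b = a * \<Gamma> / sqrt l\<close>.\<close>

lemma deviation_bound:
  fixes \<phi> f :: "real ^ 'd \<Rightarrow> real"
  assumes \<phi>: "\<And>x y. \<bar>\<phi> x - \<phi> y\<bar> \<le> G * norm (x - y)" "0 < G"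
    and fm: "f \<in> borel_measurable borel"
    and f: "\<And>x. \<bar>f x\<bar> \<le> F * (1 + norm x)"
    and one: "\<And>\<gamma> z. 0 < \<gamma> \<Longrightarrow> \<gamma> \<le> 1 \<Longrightarrow>
      \<bar>(\<integral>u. \<phi> (sqrt (1 - \<gamma>) *\<^sub>R z + sqrt \<gamma> *\<^sub>R u) \<partial>law) - \<phi> z - \<gamma> * f z\<bar> \<le> R * (\<gamma> powr (5 / 4) * (1 + norm z))" "0 \<le> R"
    and n: "n \<ge> 1" and a: "a > 0"
  defines "K \<equiv> (G + R + 2 * F) * (1 + suminf weight)"
  shows "prob {\<omega> \<in> space M. sqrt (ln (real n) + 1) * \<bar>\<integral>x. f x \<partial>nuZ U n \<omega>\<bar> \<ge> a} \<le>
    2 * prefactor (1 / sqrt (step_sum n)) * exp (- (rate (K\<^sup>2 / G\<^sup>2) (1 / sqrt (step_sum n)) * (a\<^sup>2 / (2 * G\<^sup>2))))"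
proof -
  define \<Gamma> where "\<Gamma> = step_sum n"
  define l where "l = ln (real n) + 1"
  define b where "b = a * \<Gamma> / sqrt l"
  define S where "S \<omega> = (\<Sum>k = 1..n. step k * f (Zn U k \<omega>))" for \<omega>
  have \<Gamma>: "\<Gamma> > 0" using n by (simp add: \<Gamma>_def step_sum_eq_harm harm_pos)
  have l: "l > 0" "l \<le> \<Gamma> + 1"
  proof -
    show "l > 0" using n by (simp add: l_def add_nonneg_pos)
    \<comment> \<open>The normalization \<open>ln (real n) + 1\<close> never exceeds
      \<open>\<Gamma> + 1\<close>, so replacing one by the other in the exponent weakens the bound
      in the right direction.\<close>
    have "ln (real n) \<le> ln (real n + 1)" using n by simp
    also have "\<dots> \<le> \<Gamma>" using ln_le_harm[of n] by (simp add: \<Gamma>_def step_sum_eq_harm)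
    finally show "l \<le> \<Gamma> + 1" by (simp add: l_def)
  qed
  have b: "b > 0" using a \<Gamma> l by (simp add: b_def)
  let ?B = "prefactor (1 / sqrt \<Gamma>) * exp (- (rate (K\<^sup>2 / G\<^sup>2) (1 / sqrt \<Gamma>) * (b\<^sup>2 * (\<Gamma> + 1) / (2 * \<Gamma>\<^sup>2 * G\<^sup>2))))"
  have 1: "prob {\<omega> \<in> space M. b \<le> S \<omega>} \<le> ?B"
    unfolding S_def \<Gamma>_def K_def by (rule one_sided_deviation[OF \<phi> fm f one n b])
  have 2: "prob {\<omega> \<in> space M. b \<le> - S \<omega>} \<le> ?B"
  proof -
    have eq: "- S \<omega> = (\<Sum>k = 1..n. step k * (- f (Zn U k \<omega>)))" for \<omega> by (simp add: S_def sum_negf)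
    show ?thesis unfolding eq \<Gamma>_def K_def
    proof (rule one_sided_deviation[where \<phi> = "\<lambda>x. - \<phi> x"])
      show "\<bar>- \<phi> x - - \<phi> y\<bar> \<le> G * norm (x - y)" for x y using \<phi>(1)[of x y] by simp
      show "\<bar>(\<integral>u. - \<phi> (sqrt (1 - \<gamma>) *\<^sub>R z + sqrt \<gamma> *\<^sub>R u) \<partial>law) - - \<phi> z - \<gamma> * - f z\<bar> \<le> R * (\<gamma> powr (5 / 4) * (1 + norm z))"
        if "0 < \<gamma>" "\<gamma> \<le> 1" for \<gamma> z
        using one(1)[OF that, of z] by (simp add: abs_le_iff)
    qed (use \<phi> fm f one n b in auto)
  qed
  have fZ: "(\<lambda>\<omega>. f (Zn U k \<omega>)) \<in> borel_measurable M" for k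
    by (rule measurable_compose[OF Zn_measurable fm])
  have [measurable]: "S \<in> borel_measurable M" unfolding S_def[abs_def]
    by (intro borel_measurable_sum borel_measurable_times borel_measurable_const fZ)
  have "prob {\<omega> \<in> space M. sqrt l * \<bar>\<integral>x. f x \<partial>nuZ U n \<omega>\<bar> \<ge> a} \<le> prob ({\<omega> \<in> space M. b \<le> S \<omega>} \<union> {\<omega> \<in> space M. b \<le> - S \<omega>})"
  proof (rule finite_measure_mono)
    show "{\<omega> \<in> space M. b \<le> S \<omega>} \<union> {\<omega> \<in> space M. b \<le> - S \<omega>} \<in> sets M" by measurable
    show "{\<omega> \<in> space M. sqrt l * \<bar>\<integral>x. f x \<partial>nuZ U n \<omega>\<bar> \<ge> a} \<subseteq> {\<omega> \<in> space M. b \<le> S \<omega>} \<union> {\<omega> \<in> space M. b \<le> - S \<omega>}"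
    proof
      fix \<omega> assume \<omega>: "\<omega> \<in> {\<omega> \<in> space M. sqrt l * \<bar>\<integral>x. f x \<partial>nuZ U n \<omega>\<bar> \<ge> a}"
      have "\<bar>\<integral>x. f x \<partial>nuZ U n \<omega>\<bar> = \<bar>S \<omega>\<bar> / \<Gamma>"
        using \<Gamma> unfolding integral_nuZ[OF fm] \<Gamma>_def S_def by (simp add: abs_mult)
      with \<omega> have "a \<le> sqrt l * (\<bar>S \<omega>\<bar> / \<Gamma>)" by simp
      then have "b \<le> \<bar>S \<omega>\<bar>" using \<Gamma> l by (simp add: b_def field_simps)
      then show "\<omega> \<in> {\<omega> \<in> space M. b \<le> S \<omega>} \<union> {\<omega> \<in> space M. b \<le> - S \<omega>}" using \<omega> by auto
    qed
  qed
  also have "\<dots> \<le> prob {\<omega> \<in> space M. b \<le> S \<omega>} + prob {\<omega> \<in> space M. b \<le> - S \<omega>}"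
    by (rule measure_Un_le) measurable
  also have "\<dots> \<le> 2 * ?B" using 1 2 by simp
  also have "\<dots> \<le> 2 * (prefactor (1 / sqrt \<Gamma>) * exp (- (rate (K\<^sup>2 / G\<^sup>2) (1 / sqrt \<Gamma>) * (a\<^sup>2 / (2 * G\<^sup>2)))))"
  proof -
    have "b\<^sup>2 = a\<^sup>2 * \<Gamma>\<^sup>2 / l" using l by (simp add: b_def power_mult_distrib power_divide)
    then have "b\<^sup>2 * (\<Gamma> + 1) / (2 * \<Gamma>\<^sup>2 * G\<^sup>2) = (a\<^sup>2 / (2 * G\<^sup>2)) * ((\<Gamma> + 1) / l)" using \<Gamma> by simp
    moreover have "(a\<^sup>2 / (2 * G\<^sup>2)) * 1 \<le> (a\<^sup>2 / (2 * G\<^sup>2)) * ((\<Gamma> + 1) / l)"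
      using l by (intro mult_left_mono) auto
    ultimately have le: "a\<^sup>2 / (2 * G\<^sup>2) \<le> b\<^sup>2 * (\<Gamma> + 1) / (2 * \<Gamma>\<^sup>2 * G\<^sup>2)" by simp
    have "0 \<le> rate (K\<^sup>2 / G\<^sup>2) (1 / sqrt \<Gamma>)"
      unfolding rate_def using \<Gamma> by (intro divide_nonneg_nonneg mult_nonneg_nonneg add_nonneg_nonneg) auto
    from mult_left_mono[OF le this] show ?thesis by (intro mult_left_mono) (auto simp: prefactor_def)
  qed
  finally show ?thesis by (simp add: l_def \<Gamma>_def mult.assoc)
qed

end

theorem theorem9:
  fixes M :: "'a measure"
    and U :: "nat \<Rightarrow> 'a \<Rightarrow> real ^ 'd::finite"
    and f :: "real ^ 'd \<Rightarrow> real"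
  assumes "prob_space M"
    and "prob_space.indep_vars M (\<lambda>_. borel) U {1..}"
    and "\<forall>n\<ge>1. distr M borel (U n) = distr M borel (U 1)"
    and "GC M (U 1)"
    and "\<exists>L. L-lipschitz_on UNIV f"
    and "(\<integral>x. f x \<partial>gauss) = 0"
  shows "\<exists>\<phi>. classical_poisson_solution f \<phi> \<and>
      (\<forall>\<psi>. classical_poisson_solution f \<psi> \<longrightarrow> \<psi> = \<phi>) \<and>
      (\<forall>p>1. \<forall>\<psi>. strong_poisson_solution p f \<psi> \<longrightarrow> (AE x in lborel. \<psi> x = \<phi> x)) \<and>
      (\<forall>p>1. W2_loc p \<phi>) \<and>
      bdd_above (range (\<lambda>x. norm (grad \<phi> x))) \<and> grad_sup \<phi> \<le> 2 * lip_const f \<and>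
      (\<exists>c C :: nat \<Rightarrow> real. monoseq c \<and> monoseq C \<and>
         (\<forall>n\<ge>1. c n \<le> 1 \<and> 1 \<le> C n) \<and> c \<longlonglongrightarrow> 1 \<and> C \<longlonglongrightarrow> 1 \<and>
         (\<forall>a>0. \<forall>n\<ge>1.
            measure M {\<omega> \<in> space M. sqrt (ln (real n) + 1) * \<bar>\<integral>x. f x \<partial>nuZ U n \<omega>\<bar> \<ge> a}
            \<le> 2 * C n * (if grad_sup \<phi> = 0 then 0
                         else exp (- (c n * (a\<^sup>2 / (2 * (grad_sup \<phi>)\<^sup>2)))))))"
proof -
  interpret gc_sequence M U
    by (intro gc_sequence.intro gc_sequence_axioms.intro assms(1-4))
  interpret lipschitz_fun f "lip_const f"
    using lipschitz_lip_const[OF assms(5)] by unfold_locales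
  note f0 = assms(6)
  let ?\<phi> = ou_solution
  let ?G = "grad_sup ?\<phi>"
  note classical = classical_ou_solution[OF f0]
  have g2: "norm (grad ?\<phi> x) \<le> 2 * lip_const f" for x
    unfolding grad_ou_solution[OF f0]
    by (rule norm_gradient_le[OF ou_solution_lipschitz[OF f0] ou_solution_deriv[OF f0]])
  have bdd: "bdd_above (range (\<lambda>x. norm (grad ?\<phi> x)))" using g2 by (intro bdd_aboveI2)
  have gG: "norm (grad ?\<phi> x) \<le> ?G" for x unfolding grad_sup_def by (rule cSUP_upper[OF UNIV_I bdd])
  have G0: "0 \<le> ?G" using gG[of 0] norm_ge_zero order_trans by blast
  have sup: "?G \<le> 2 * lip_const f" unfolding grad_sup_def using g2 by (intro cSUP_least) auto
  have tail: "\<exists>c C :: nat \<Rightarrow> real. monoseq c \<and> monoseq C \<and>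
         (\<forall>n\<ge>1. c n \<le> 1 \<and> 1 \<le> C n) \<and> c \<longlonglongrightarrow> 1 \<and> C \<longlonglongrightarrow> 1 \<and>
         (\<forall>a>0. \<forall>n\<ge>1.
            measure M {\<omega> \<in> space M. sqrt (ln (real n) + 1) * \<bar>\<integral>x. f x \<partial>nuZ U n \<omega>\<bar> \<ge> a}
            \<le> 2 * C n * (if ?G = 0 then 0 else exp (- (c n * (a\<^sup>2 / (2 * ?G\<^sup>2))))))"
  proof (cases "?G = 0")
    case True
    \<comment> \<open>A vanishing gradient forces \<open>f = 0\<close> by the Poisson equation, so
      the event is empty for every positive \<open>a\<close> and the constant sequences 1 will
      do.\<close>
    have "ou_grad x = 0" for x using gG[of x] True by (simp add: grad_ou_solution[OF f0])
    then have "partial i ?\<phi> = (\<lambda>_. 0)" "grad ?\<phi> x = 0" for i x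
      by (simp_all add: partial_ou_solution[OF f0] grad_ou_solution[OF f0])
    then have "f = (\<lambda>_. 0)"
      using classical by (auto simp: classical_poisson_solution_def laplacian_def)
    then have "{\<omega> \<in> space M. sqrt (ln (real n) + 1) * \<bar>\<integral>x. f x \<partial>nuZ U n \<omega>\<bar> \<ge> a} = {}" if "a > 0" for a n
      using that by auto
    then have "prob {\<omega> \<in> space M. sqrt (ln (real n) + 1) * \<bar>\<integral>x. f x \<partial>nuZ U n \<omega>\<bar> \<ge> a} = 0" if "a > 0" for a n
      using that by (simp only: measure_empty)
    then show ?thesis using True by (intro exI[of _ "\<lambda>_. 1"]) (simp add: monoseq_def)
  next
    case False
    then have G: "?G > 0" using G0 by simp
    define F where "F = \<bar>f 0\<bar> + lip_const f"
    define R where "R = real CARD('d) * hess_const * (law_moment + 2) + 2 * lip_const f + 2 * ?G"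
    \<comment> \<open>\<open>R\<close> is the constant of \<open>one_step_estimate\<close> for this
      solution, and \<kappa> the quotient \<open>K\<^sup>2 / G\<^sup>2\<close> of
      \<open>deviation_bound\<close>.\<close>
    define \<kappa> where "\<kappa> = ((?G + R + 2 * F) * (1 + suminf weight))\<^sup>2 / ?G\<^sup>2"
    \<comment> \<open>\<open>max 1 n\<close> avoids the value \<open>1 / 0 = 0\<close> at
      \<open>n = 0\<close>, which would destroy the monotonicity of both sequences.\<close>
    define x where "x n = 1 / sqrt (step_sum (max 1 n))" for n
    \<comment> \<open>Nonnegativity is read off the Hoelder bound at two points at distance
      1.\<close>
    have hc: "0 \<le> hess_const"
      using order_trans[OF norm_ge_zero ou_hess_Hoelder[of undefined "axis undefined 1" 0]] by (simp add: norm_axis_1)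
    have \<phi>: "\<bar>?\<phi> x - ?\<phi> y\<bar> \<le> ?G * norm (x - y)" for x y
    proof -
      obtain t where "?\<phi> (y + (x - y)) - ?\<phi> y = ou_grad (y + t *\<^sub>R (x - y)) \<bullet> (x - y)"
        using gradient_mean_value[OF ou_solution_deriv[OF f0]] by blast
      then have "\<bar>?\<phi> x - ?\<phi> y\<bar> \<le> norm (ou_grad (y + t *\<^sub>R (x - y))) * norm (x - y)"
        using Cauchy_Schwarz_ineq2[of "ou_grad (y + t *\<^sub>R (x - y))" "x - y"] by simp
      also have "\<dots> \<le> ?G * norm (x - y)"
        using gG[of "y + t *\<^sub>R (x - y)"] by (intro mult_right_mono) (auto simp: grad_ou_solution[OF f0])
      finally show ?thesis .
    qed
    have f: "\<bar>f x\<bar> \<le> F * (1 + norm x)" for x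
    proof -
      have "\<bar>f x\<bar> \<le> \<bar>f 0\<bar> + lip_const f * norm x" using lip_abs[of x 0] by simp
      also have "\<dots> \<le> \<bar>f 0\<bar> + lip_const f * norm x + (lip_const f + \<bar>f 0\<bar> * norm x)" using L_nonneg by simp
      finally show ?thesis by (simp add: F_def algebra_simps)
    qed
    have one: "\<bar>(\<integral>u. ?\<phi> (sqrt (1 - \<gamma>) *\<^sub>R z + sqrt \<gamma> *\<^sub>R u) \<partial>law) - ?\<phi> z - \<gamma> * f z\<bar> \<le> R * (\<gamma> powr (5 / 4) * (1 + norm z))"
      if "0 < \<gamma>" "\<gamma> \<le> 1" for \<gamma> z
      unfolding R_def
      by (rule one_step_estimate[OF ou_solution_deriv[OF f0] ou_grad_nth_deriv ou_hess_Hoelder hc _ ou_poisson_equation[OF f0] lip_abs L_nonneg that])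
        (use gG in \<open>simp add: grad_ou_solution[OF f0]\<close>)
    have R: "0 \<le> R" unfolding R_def using hc L_nonneg G0 law_moment(2) by (intro add_nonneg_nonneg mult_nonneg_nonneg) auto
    have dev: "prob {\<omega> \<in> space M. sqrt (ln (real n) + 1) * \<bar>\<integral>x. f x \<partial>nuZ U n \<omega>\<bar> \<ge> a}
        \<le> 2 * prefactor (x n) * exp (- (rate \<kappa> (x n) * (a\<^sup>2 / (2 * ?G\<^sup>2))))" if "n \<ge> 1" "a > 0" for n a
      using deviation_bound[OF \<phi> G f_measurable f one R that] that by (simp add: x_def \<kappa>_def max_def)
    have x0: "0 \<le> x n" for n by (simp add: x_def step_sum_eq_harm harm_nonneg)
    have x_dec: "x n \<le> x m" if "m \<le> n" for m n
    proof -
      have "harm (max 1 m) \<le> (harm (max 1 n) :: real)" using that by (intro harm_mono) auto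
      then show ?thesis unfolding x_def step_sum_eq_harm by (intro divide_left_mono mult_pos_pos) (auto simp: harm_pos)
    qed
    have x_lim: "x \<longlonglongrightarrow> 0"
    proof -
      have "filterlim (\<lambda>n. harm n :: real) at_top sequentially" by (rule harm_at_top)
      then have "filterlim (\<lambda>n. sqrt (harm n)) at_top sequentially"
        by (rule filterlim_compose[OF sqrt_at_top])
      then have "(\<lambda>n. inverse (sqrt (harm n))) \<longlonglongrightarrow> (0 :: real)" by (rule tendsto_inverse_0_at_top)
      moreover have "\<forall>\<^sub>F n in sequentially. inverse (sqrt (harm n)) = x n"
        using eventually_ge_at_top[of 1] by eventually_elim (simp add: x_def step_sum_eq_harm max_def inverse_eq_divide)
      ultimately show ?thesis by (rule Lim_transform_eventually)
    qed
    have \<kappa>: "0 \<le> \<kappa>" by (simp add: \<kappa>_def)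
    show ?thesis
    proof (rule exI[of _ "\<lambda>n. rate \<kappa> (x n)"], rule exI[of _ "\<lambda>n. prefactor (x n)"], intro conjI allI impI)
      \<comment> \<open>As \<open>x\<close> decreases to 0, while \<open>rate\<close> is decreasing
        and \<open>prefactor\<close> increasing in its argument, the first sequence increases to 1
        and the second decreases to 1.\<close>
      show "monoseq (\<lambda>n. rate \<kappa> (x n))" by (intro monoI1 allI impI rate_antimono \<kappa> x0 x_dec)
      show "monoseq (\<lambda>n. prefactor (x n))" by (intro monoI2 allI impI prefactor_mono x0 x_dec)
      show "rate \<kappa> (x n) \<le> 1" for n using rate_antimono[OF \<kappa> order_refl x0[of n]] by (simp add: rate_0)
      show "1 \<le> prefactor (x n)" for n using prefactor_mono[OF order_refl x0[of n]] by (simp add: prefactor_0)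
      show "(\<lambda>n. rate \<kappa> (x n)) \<longlonglongrightarrow> 1" by (rule rate_tendsto[OF x_lim])
      show "(\<lambda>n. prefactor (x n)) \<longlonglongrightarrow> 1" by (rule prefactor_tendsto[OF x_lim])
      fix a :: real and n :: nat assume "a > 0" "n \<ge> 1"
      then show "prob {\<omega> \<in> space M. sqrt (ln (real n) + 1) * \<bar>\<integral>x. f x \<partial>nuZ U n \<omega>\<bar> \<ge> a}
        \<le> 2 * prefactor (x n) * (if ?G = 0 then 0 else exp (- (rate \<kappa> (x n) * (a\<^sup>2 / (2 * ?G\<^sup>2)))))"
        using dev[of n a] False by simp
    qed
  qed
  show ?thesis
  proof (intro exI[of _ ?\<phi>] conjI allI impI)
    show "classical_poisson_solution f ?\<phi>" by (rule classical)
    show "\<psi> = ?\<phi>" if "classical_poisson_solution f \<psi>" for \<psi>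
      by (rule classical_solution_unique[OF that classical f_measurable])
    show "AE x in lborel. \<psi> x = ?\<phi> x" if "1 < p" "strong_poisson_solution p f \<psi>" for p \<psi>
      by (rule strong_solution_unique[OF that(2) classical_imp_strong[OF classical that(1)] f_measurable])
    show "W2_loc p ?\<phi>" if "1 < p" for p
      using W2_loc_derivs_Ck[OF _ that] classical unfolding W2_loc_def classical_poisson_solution_def by blast
  qed (use bdd sup tail in auto)
qed

end
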